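(* Consider the P1 finite element eigenvalue problem: find $\lambda^h\in\mathbb{C}$ and a nonzero (possibly complex-valued) $u^h\in V^h$ such that $$(\mathbb{D}\nabla u^h,\nabla v^h)+(b\cdot\nabla u^h,v^h)+(c\,u^h,v^h)=\lambda^h(u^h,v^h)\qquad\text{for all } v^h\in V^h ,$$ equivalently $A\mathbf{u}=\lambda^h B\mathbf{u}$ with stiffness matrix $A$ and mass matrix $B$. Suppose that the stiffness matrix $A$ is an irreducible $M$-matrix. Then the principal eigenvalue $\lambda_1^h$ (the smallest eigenvalue in modulus) and the corresponding eigenfunctions have the following properties. (a) $\lambda_1^h$ is real. (b) There is an eigenfunction $u_1^h\in V^h$ associated with $\lambda_1^h$ with $u_1^h(x)>0$ for all $x\in\Omega$. (c) $\lambda_1^h$ is algebraically (and geometrically) simple; that is, if $u^h$ is an eigenfunction associated with $\lambda_1^h$, then $u^h$ is a multiple of $u_1^h$. (d) $\lambda_1^h=F(u_1^h)>0$, where $$F(v)=\frac{(\mathbb{D}\nabla v,\nabla v)+\big((c-\tfrac12\nabla\cdot b)v,v\big)}{(v,v)} .$$ (e) $\operatorname{Re}(\lambda^h)>0$ and $|\lambda^h|\ge\lambda_1^h$ for every eigenvalue $\lambda^h$. (f) In the symmetric situation ($b=0$), the variational principle $$\lambda_1^h=\min_{v^h\in V^h,\ v^h\not\equiv 0,\ v^h\ \text{real}}F(v^h)$$ holds.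
   Context: Let $\Omega\subset\mathbb{R}^d$ ($d\ge1$) be a polyhedron, and let $\mathbb{D}:\Omega\to\mathbb{R}^{d\times d}$, $b:\Omega\to\mathbb{R}^d$, $c:\Omega\to\mathbb{R}$ be given sufficiently smooth functions. Assume $\mathbb{D}(x)$ is symmetric and strictly positive definite on $\Omega$, and $c(x)-\frac12\nabla\cdot b(x)\ge0$ for all $x\in\Omega$. The underlying continuous problem is $-\nabla\cdot(\mathbb{D}\nabla u)+b\cdot\nabla u+cu=\lambda u$ in $\Omega$, $u=0$ on $\partial\Omega$. $(\cdot,\cdot)$ denotes the $L^2(\Omega)$ inner product. Let $\mathcal{T}_h$ be a simplicial mesh of $\Omega$ (from an affine family of simplicial meshes) with vertices ordered so that the first $N_v$ are the interior vertices (those not on $\partial\Omega$). Let $\phi_k$ be the P1 (continuous, piecewise linear, nodal) basis function associated with the $k$-th vertex, and $V^h=\operatorname{span}\{\phi_1,\dots,\phi_{N_v}\}\subset H_0^1(\Omega)$ (complex coefficients are allowed for eigenfunctions). Write $u^h=\sum_{k=1}^{N_v}u_k\phi_k$, $\mathbf{u}=(u_1,\dots,u_{N_v})^T$. The stiffness and mass matrices are, for $j,k=1,\dots,N_v$, $$A_{jk}=\sum_{K\in\mathcal{T}_h}\int_K\big((\nabla\phi_j)^T\mathbb{D}_K\nabla\phi_k+\phi_j\,(b\cdot\nabla\phi_k)+c\,\phi_j\phi_k\big)\,dx,\qquad B_{jk}=\sum_{K\in\mathcal{T}_h}\int_K\phi_j\phi_k\,dx,$$ where $\mathbb{D}_K=\frac1{|K|}\int_K\mathbb{D}(x)\,dx$.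 An $M$-matrix means a nonsingular $M$-matrix: a real square matrix with nonpositive off-diagonal entries that is invertible with entrywise nonnegative inverse.
   Formalization: In (b), positivity of the eigenfunction is asserted at all points of Ω outside mesh simplices (of any dimension) whose vertices all lie on the boundary; every function of V^h vanishes on such simplices, so (b) fails as written when one of them meets Ω. *)

theory Defs
  imports "HOL-Analysis.Analysis" "Jordan_Normal_Form.Determinant"
begin

text \<open>
  Both libraries use the infix dollar sign, the bullet and names such as \<open>det\<close>, \<open>vec\<close> and
  \<open>transpose\<close>.  Points, gradients and the diffusion matrix live in HOL-Analysis (\<open>real ^ 'd\<close>),
  where \<open>vec_nth\<close> and \<open>inner\<close> are written out; the stiffness and mass matrices, whose size is
  the number of interior vertices, are matrices of the AFP entry \<open>Jordan_Normal_Form\<close>.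
\<close>

text \<open>The polyhedron is the open set, not necessarily convex (the library's \<^const>\<open>polyhedron\<close> is
  closed and convex); \<open>frontier \<Omega>\<close> is its boundary.\<close>

definition polyhedral_domain :: "(real ^ 'd::finite) set \<Rightarrow> bool" where
  "polyhedral_domain \<Omega> \<longleftrightarrow> \<Omega> \<noteq> {} \<and>
     (\<exists>F. finite F \<and> (\<forall>P\<in>F. polytope P \<and> interior P \<noteq> {}) \<and> \<Omega> = interior (\<Union>F))"

definition simplicial_mesh :: "(real ^ 'd::finite) set \<Rightarrow> (real ^ 'd) set set \<Rightarrow> bool" where
  "simplicial_mesh \<Omega> \<T> \<longleftrightarrow>
     triangulation \<T> \<and> (\<forall>K\<in>\<T>. int CARD('d) simplex K) \<and> \<Union>\<T> = closure \<Omega>"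

definition mesh_vertices :: "(real ^ 'd::finite) set set \<Rightarrow> (real ^ 'd) set" where
  "mesh_vertices \<T> = {p. \<exists>K\<in>\<T>. p extreme_point_of K}"

text \<open>Zero-based numbering \<open>p 0, \<dots>, p (N - 1)\<close> of all vertices, the first \<open>Nv\<close> being exactly
  those that are not on the boundary.\<close>

definition vertex_numbering ::
  "(real ^ 'd::finite) set \<Rightarrow> (real ^ 'd) set set \<Rightarrow> nat \<Rightarrow> nat \<Rightarrow> (nat \<Rightarrow> real ^ 'd) \<Rightarrow> bool" where
  "vertex_numbering \<Omega> \<T> N Nv p \<longleftrightarrow>
     Nv \<le> N \<and> bij_betw p {..<N} (mesh_vertices \<T>) \<and> (\<forall>k<N. p k \<notin> frontier \<Omega> \<longleftrightarrow> k < Nv)"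

text \<open>This determines \<open>\<phi> k\<close> on the closure of \<open>\<Omega>\<close>; the values elsewhere play no role.\<close>

definition P1_nodal_basis ::
  "(real ^ 'd::finite) set set \<Rightarrow> nat \<Rightarrow> (nat \<Rightarrow> real ^ 'd) \<Rightarrow> (nat \<Rightarrow> real ^ 'd \<Rightarrow> real) \<Rightarrow> bool" where
  "P1_nodal_basis \<T> N p \<phi> \<longleftrightarrow>
     (\<forall>k<N. continuous_on (\<Union>\<T>) (\<phi> k) \<and>
            (\<forall>K\<in>\<T>. \<exists>g \<alpha>. \<forall>x\<in>K. \<phi> k x = inner g x + \<alpha>) \<and>
            (\<forall>l<N. \<phi> k (p l) = (if k = l then 1 else 0)))"

text \<open>The span of the first \<open>Nv\<close> basis functions, with real or complex coefficients depending on
  the type \<open>'a\<close>.\<close>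

definition Vh :: "(nat \<Rightarrow> real ^ 'd::finite \<Rightarrow> real) \<Rightarrow> nat \<Rightarrow> (real ^ 'd \<Rightarrow> 'a::real_vector) set" where
  "Vh \<phi> Nv = {u. \<exists>a. u = (\<lambda>x. \<Sum>k<Nv. \<phi> k x *\<^sub>R a k)}"

text \<open>The union of all mesh simplices, of any dimension, whose vertices all lie on the boundary.
  Every function in \<open>Vh \<phi> Nv\<close> vanishes there.  This set may meet \<open>\<Omega>\<close>, e.g. if a corner of a polygon
  is cut off by an edge of the mesh.\<close>

definition boundary_simplices :: "(real ^ 'd::finite) set \<Rightarrow> (real ^ 'd) set set \<Rightarrow> (real ^ 'd) set" where
  "boundary_simplices \<Omega> \<T> =
     \<Union>{S. (\<exists>K\<in>\<T>. S face_of K) \<and> (\<forall>v. v extreme_point_of S \<longrightarrow> v \<in> frontier \<Omega>)}"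


text \<open>Arbitrary where \<open>f\<close> is not differentiable.  For P1 functions the exceptional points in \<open>\<Omega>\<close>
  lie on the faces of the mesh elements, a null set; all integrals below are taken with respect to
  the complete measure \<^const>\<open>lebesgue\<close>, so the values there are irrelevant.\<close>

definition grad :: "(real ^ 'd::finite \<Rightarrow> 'a::real_normed_vector) \<Rightarrow> real ^ 'd \<Rightarrow> 'a ^ 'd" where
  "grad f x = (\<chi> i. frechet_derivative f (at x) (axis i 1))"

definition divergence :: "(real ^ 'd::finite \<Rightarrow> real ^ 'd) \<Rightarrow> real ^ 'd \<Rightarrow> real" where
  "divergence b x = (\<Sum>i\<in>UNIV. vec_nth (frechet_derivative b (at x) (axis i 1)) i)"

text \<open>Continuously differentiable up to the boundary.\<close>

definition C1_closure ::
  "'a::euclidean_space set \<Rightarrow> ('a \<Rightarrow> 'b::real_normed_vector) \<Rightarrow> bool" where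
  "C1_closure \<Omega> f \<longleftrightarrow> continuous_on (closure \<Omega>) f \<and>
     (\<exists>f'. (\<forall>x\<in>\<Omega>. (f has_derivative blinfun_apply (f' x)) (at x)) \<and> continuous_on (closure \<Omega>) f')"

definition sym_pos_def :: "real ^ 'd ^ 'd::finite \<Rightarrow> bool" where
  "sym_pos_def M \<longleftrightarrow>
     Finite_Cartesian_Product.transpose M = M \<and> (\<forall>\<xi>. \<xi> \<noteq> 0 \<longrightarrow> 0 < inner \<xi> (M *v \<xi>))"


definition L2_real ::
  "(real ^ 'd::finite) set \<Rightarrow> (real ^ 'd \<Rightarrow> 'a::real_inner) \<Rightarrow> (real ^ 'd \<Rightarrow> 'a) \<Rightarrow> real" where
  "L2_real \<Omega> f g = (LINT x:\<Omega>|lebesgue. inner (f x) (g x))"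

definition L2_cscalar ::
  "(real ^ 'd::finite) set \<Rightarrow> (real ^ 'd \<Rightarrow> complex) \<Rightarrow> (real ^ 'd \<Rightarrow> complex) \<Rightarrow> complex" where
  "L2_cscalar \<Omega> f g = (LINT x:\<Omega>|lebesgue. f x * cnj (g x))"

definition L2_cvector ::
  "(real ^ 'd::finite) set \<Rightarrow> (real ^ 'd \<Rightarrow> complex ^ 'd) \<Rightarrow> (real ^ 'd \<Rightarrow> complex ^ 'd) \<Rightarrow> complex" where
  "L2_cvector \<Omega> f g = (LINT x:\<Omega>|lebesgue. \<Sum>i\<in>UNIV. vec_nth (f x) i * cnj (vec_nth (g x) i))"

definition weak_form ::
  "(real ^ 'd::finite) set \<Rightarrow> (real ^ 'd \<Rightarrow> real ^ 'd ^ 'd) \<Rightarrow> (real ^ 'd \<Rightarrow> real ^ 'd) \<Rightarrow> (real ^ 'd \<Rightarrow> real)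
    \<Rightarrow> (real ^ 'd \<Rightarrow> complex) \<Rightarrow> (real ^ 'd \<Rightarrow> complex) \<Rightarrow> complex" where
  "weak_form \<Omega> D b c u v =
     L2_cvector \<Omega> (\<lambda>x. \<chi> i. \<Sum>j\<in>UNIV. vec_nth (vec_nth (D x) i) j *\<^sub>R vec_nth (grad u x) j) (grad v)
     + L2_cscalar \<Omega> (\<lambda>x. \<Sum>i\<in>UNIV. vec_nth (b x) i *\<^sub>R vec_nth (grad u x) i) v
     + L2_cscalar \<Omega> (\<lambda>x. c x *\<^sub>R u x) v"

definition fe_eigenpair ::
  "(real ^ 'd::finite) set \<Rightarrow> (real ^ 'd \<Rightarrow> real ^ 'd ^ 'd) \<Rightarrow> (real ^ 'd \<Rightarrow> real ^ 'd) \<Rightarrow> (real ^ 'd \<Rightarrow> real)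
    \<Rightarrow> (nat \<Rightarrow> real ^ 'd \<Rightarrow> real) \<Rightarrow> nat \<Rightarrow> complex \<Rightarrow> (real ^ 'd \<Rightarrow> complex) \<Rightarrow> bool" where
  "fe_eigenpair \<Omega> D b c \<phi> Nv l u \<longleftrightarrow>
     u \<in> Vh \<phi> Nv \<and> u \<noteq> (\<lambda>x. 0) \<and>
     (\<forall>v \<in> Vh \<phi> Nv. weak_form \<Omega> D b c u v = l * L2_cscalar \<Omega> u v)"

definition fe_eigenvalue ::
  "(real ^ 'd::finite) set \<Rightarrow> (real ^ 'd \<Rightarrow> real ^ 'd ^ 'd) \<Rightarrow> (real ^ 'd \<Rightarrow> real ^ 'd) \<Rightarrow> (real ^ 'd \<Rightarrow> real)
    \<Rightarrow> (nat \<Rightarrow> real ^ 'd \<Rightarrow> real) \<Rightarrow> nat \<Rightarrow> complex \<Rightarrow> bool" where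
  "fe_eigenvalue \<Omega> D b c \<phi> Nv l \<longleftrightarrow> (\<exists>u. fe_eigenpair \<Omega> D b c \<phi> Nv l u)"

definition principal_eigenvalue ::
  "(real ^ 'd::finite) set \<Rightarrow> (real ^ 'd \<Rightarrow> real ^ 'd ^ 'd) \<Rightarrow> (real ^ 'd \<Rightarrow> real ^ 'd) \<Rightarrow> (real ^ 'd \<Rightarrow> real)
    \<Rightarrow> (nat \<Rightarrow> real ^ 'd \<Rightarrow> real) \<Rightarrow> nat \<Rightarrow> complex \<Rightarrow> bool" where
  "principal_eigenvalue \<Omega> D b c \<phi> Nv l \<longleftrightarrow> fe_eigenvalue \<Omega> D b c \<phi> Nv l \<and>
     (\<forall>\<mu>. fe_eigenvalue \<Omega> D b c \<phi> Nv \<mu> \<longrightarrow> cmod l \<le> cmod \<mu>)"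

definition rayleigh ::
  "(real ^ 'd::finite) set \<Rightarrow> (real ^ 'd \<Rightarrow> real ^ 'd ^ 'd) \<Rightarrow> (real ^ 'd \<Rightarrow> real ^ 'd) \<Rightarrow> (real ^ 'd \<Rightarrow> real)
    \<Rightarrow> (real ^ 'd \<Rightarrow> real) \<Rightarrow> real" where
  "rayleigh \<Omega> D b c v =
     (L2_real \<Omega> (\<lambda>x. D x *v grad v x) (grad v)
      + L2_real \<Omega> (\<lambda>x. (c x - 1/2 * divergence b x) * v x) v) / L2_real \<Omega> v v"


definition mean_on :: "(real ^ 'd::finite) set \<Rightarrow> (real ^ 'd \<Rightarrow> real ^ 'd ^ 'd) \<Rightarrow> real ^ 'd ^ 'd" where
  "mean_on K D = (1 / measure lebesgue K) *\<^sub>R (LINT x:K|lebesgue. D x)"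

definition stiffness_mat ::
  "(real ^ 'd::finite) set set \<Rightarrow> (real ^ 'd \<Rightarrow> real ^ 'd ^ 'd) \<Rightarrow> (real ^ 'd \<Rightarrow> real ^ 'd) \<Rightarrow> (real ^ 'd \<Rightarrow> real)
    \<Rightarrow> (nat \<Rightarrow> real ^ 'd \<Rightarrow> real) \<Rightarrow> nat \<Rightarrow> real mat" where
  "stiffness_mat \<T> D b c \<phi> Nv = Matrix.mat Nv Nv (\<lambda>(j, k). \<Sum>K\<in>\<T>. LINT x:K|lebesgue.
     inner (grad (\<phi> j) x) (mean_on K D *v grad (\<phi> k) x)
     + \<phi> j x * inner (b x) (grad (\<phi> k) x) + c x * \<phi> j x * \<phi> k x)"

definition mass_mat ::
  "(real ^ 'd::finite) set set \<Rightarrow> (nat \<Rightarrow> real ^ 'd \<Rightarrow> real) \<Rightarrow> nat \<Rightarrow> real mat" where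
  "mass_mat \<T> \<phi> Nv = Matrix.mat Nv Nv (\<lambda>(j, k). \<Sum>K\<in>\<T>. LINT x:K|lebesgue. \<phi> j x * \<phi> k x)"

definition M_matrix :: "real mat \<Rightarrow> bool" where
  "M_matrix A \<longleftrightarrow> square_mat A \<and>
     (\<forall>i<dim_row A. \<forall>j<dim_row A. i \<noteq> j \<longrightarrow> A $$ (i, j) \<le> 0) \<and>
     (\<exists>A'. A' \<in> carrier_mat (dim_row A) (dim_row A) \<and> inverts_mat A A' \<and> inverts_mat A' A \<and>
           (\<forall>i<dim_row A. \<forall>j<dim_row A. 0 \<le> A' $$ (i, j)))"

text \<open>No simultaneous permutation of rows and columns brings the matrix to block triangular form
  with two nonempty diagonal blocks; the row indices of the zero block form the set \<open>I\<close>.\<close>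

definition irreducible_mat :: "real mat \<Rightarrow> bool" where
  "irreducible_mat A \<longleftrightarrow> square_mat A \<and>
     \<not> (\<exists>I. I \<noteq> {} \<and> I \<subset> {..<dim_row A} \<and> (\<forall>i\<in>I. \<forall>j\<in>{..<dim_row A} - I. A $$ (i, j) = 0))"

text \<open>Algebraic multiplicity of \<open>l\<close> as an eigenvalue of \<open>A u = l B u\<close>: the multiplicity of \<open>l\<close> as a
  root of the polynomial \<open>det (X B - A)\<close>.\<close>

definition alg_multiplicity :: "real mat \<Rightarrow> real mat \<Rightarrow> complex \<Rightarrow> nat" where
  "alg_multiplicity A B l =
     Polynomial.order l (Determinant.det (Matrix.mat (dim_row A) (dim_row A)
       (\<lambda>(j, k). [:- complex_of_real (A $$ (j, k)), complex_of_real (B $$ (j, k)):])))"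

definition generalized_eigenvector :: "real mat \<Rightarrow> real mat \<Rightarrow> complex \<Rightarrow> (nat \<Rightarrow> complex) \<Rightarrow> bool" where
  "generalized_eigenvector A B l a \<longleftrightarrow>
     (let w = Matrix.vec (dim_row A) a in
        w \<noteq> 0\<^sub>v (dim_row A) \<and>
        map_mat complex_of_real A *\<^sub>v w = l \<cdot>\<^sub>v (map_mat complex_of_real B *\<^sub>v w))"

end

theory Submission
  imports Defs
begin

text \<open>
In the nodal coordinates of the space of P1 functions the eigenvalue problem reads \<open>A u = \<lambda> B u\<close>.
Everything rests on one observation about the matrices and one about the forms.

The matrices: if \<open>A\<close> is an irreducible M-matrix, then all entries of its inverse are positive, not
merely nonnegative (\<open>inverse_pos\<close>).  The mass matrix \<open>B\<close> has nonnegative entries and a positive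
diagonal because the hat functions are nonnegative, so \<open>P = A\<^sup>-\<^sup>1 B\<close> is a positive matrix, and \<open>\<lambda>\<close> is an
eigenvalue of the pencil exactly when \<open>1 / \<lambda>\<close> is a nonzero eigenvalue of \<open>P\<close>.  The Perron root of
\<open>P\<close>, the eigenvalue of largest modulus, turns into the eigenvalue of the pencil of smallest modulus,
with all the properties that Perron's theorem supplies: it is positive, it is the only eigenvalue of
its modulus, it has an eigenvector with positive entries, and it is simple.  Perron's theorem is
proved here from a single comparison, \<open>subinvariant_imp_multiple\<close>: a real vector \<open>y\<close> with
\<open>r y \<le> P y\<close>, where \<open>P v = r v\<close> and \<open>v > 0\<close>, is a multiple of \<open>v\<close>.  Algebraic simplicity as a root
of \<open>det (X B - A)\<close> follows because a determinant with a simple null vector and without a Jordan chain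
vanishes only to first order (\<open>order_det_pencil_eq_1\<close>).

The forms: for real \<open>u\<close> that vanishes on the boundary, \<open>(b \<cdot> \<nabla>u, u) = - 1/2 ((\<nabla> \<cdot> b) u, u)\<close>, whence
\<open>u\<^sup>T A u\<close> is the numerator of the Rayleigh quotient (\<open>quad_A_eq_energy\<close>).  It is positive for
\<open>u \<noteq> 0\<close>, since a P1 function with vanishing gradient takes finitely many values and so
cannot descend continuously to zero at the boundary.  Testing the eigenvalue equation with the
eigenfunction gives \<open>\<lambda>\<^sub>1 = F(u\<^sub>1)\<close> and \<open>Re \<lambda> > 0\<close>.  In the symmetric case \<open>A - \<lambda>\<^sub>1 B\<close> has nonpositive
off-diagonal entries and a positive null vector \<open>v\<close>; such a matrix is positive semidefinite, because
its quadratic form is a sum of squares of differences of \<open>x\<^sub>i / v\<^sub>i\<close> (\<open>ground_state_nonneg\<close>).  This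
is the variational principle.

Two points need care because the domain is neither convex nor Lipschitz in general.  That a hat
function of an interior vertex vanishes on the boundary is derived from a homothety that
shrinks the star of the vertex into a small ball inside the domain (\<open>basis_support\<close>).
Integration by parts rests on translation invariance of Lebesgue measure: each component of \<open>b u\<^sup>2\<close>,
extended by zero, is globally Lipschitz with bounded support, and the integral of a directional
derivative of such a function is the limit of integrals of difference quotients, which are zero
(\<open>lipschitz_integral_directional_derivative\<close>).

The eigenfunction is positive wherever some interior hat function is positive.  The points of the
domain where none is positive form the part covered by simplices with all vertices on the boundary;
every function of the discrete space vanishes there.
\<close>

section \<open>Perron vectors of positive matrices\<close>

lemma positive_kernel_pos:
  fixes P :: "nat \<Rightarrow> nat \<Rightarrow> real"
  assumes "\<And>i j. i < n \<Longrightarrow> j < n \<Longrightarrow> 0 < P i j"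
    and "\<And>j. j < n \<Longrightarrow> 0 \<le> y j" and "k < n" "0 < y k" and "i < n"
  shows "0 < (\<Sum>j<n. P i j * y j)"
proof -
  have "0 < P i k * y k" using assms by simp
  also have "\<dots> \<le> (\<Sum>j<n. P i j * y j)"
    using assms by (intro member_le_sum) (auto simp: less_imp_le)
  finally show ?thesis .
qed

text \<open>The Perron root is found as the largest \<open>s\<close> for which some nonnegative vector \<open>x\<close> of unit sum satisfies
\<open>s x \<le> P x\<close>.  Compactness of the set of admissible pairs makes the supremum a maximum.  Vectors are
functions that vanish outside \<open>{..<n}\<close>, so that the set lies in a product of compact intervals.\<close>

lemma compact_collatz_wielandt:
  fixes P :: "nat \<Rightarrow> nat \<Rightarrow> real"
  shows "compact {(s::real, x::nat \<Rightarrow> real). s \<in> {0..R} \<and>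
      (\<forall>i. x i \<in> (if i < n then {0..1} else {0})) \<and>
      (\<Sum>i<n. x i) = 1 \<and> (\<forall>i<n. s * x i \<le> (\<Sum>j<n. P i j * x j))}" (is "compact ?C")
proof -
  let ?box = "PiE UNIV (\<lambda>i. if i < n then {0..1} else {0::real}) :: (nat \<Rightarrow> real) set"
  have "compactin (product_topology (\<lambda>i::nat. euclidean::real topology) UNIV) ?box"
    by (subst compactin_PiE) auto
  hence "compact ?box" by (simp add: euclidean_product_topology compactin_euclidean_iff)
  hence 1: "compact ({0..R} \<times> ?box)" by (intro compact_Times) auto
  have box: "?box = {x. \<forall>i. x i \<in> (if i < n then {0..1} else {0})}"
    by (simp add: PiE_UNIV_domain Pi_def)
  have 2: "closed {z :: real \<times> (nat \<Rightarrow> real). (\<Sum>i<n. snd z i) = 1}"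
    by (intro closed_Collect_eq continuous_intros continuous_on_coordinatewise_then_product
        continuous_on_product_coordinates[THEN continuous_on_compose2]) auto
  have 3: "closed {z :: real \<times> (nat \<Rightarrow> real). \<forall>i\<in>{..<n}. fst z * snd z i \<le> (\<Sum>j<n. P i j * snd z j)}"
    unfolding Collect_ball_eq
    by (intro closed_INT ballI closed_Collect_le continuous_intros
        continuous_on_product_coordinates[THEN continuous_on_compose2]) auto
  have "?C = {z. (\<Sum>i<n. snd z i) = 1} \<inter> ({z. \<forall>i\<in>{..<n}. fst z * snd z i \<le> (\<Sum>j<n. P i j * snd z j)}
     \<inter> ({0..R} \<times> ?box))"
    (is "_ = ?D")
  proof (rule Set.set_eqI)
    fix z :: "real \<times> (nat \<Rightarrow> real)"
    obtain s x where z: "z = (s, x)" by force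
    show "z \<in> ?C \<longleftrightarrow> z \<in> ?D" unfolding box z by (simp only: mem_Collect_eq prod.case Int_iff mem_Times_iff fst_conv snd_conv) blast
  qed
  moreover have "compact ?D" using closed_Int_compact[OF 2 closed_Int_compact[OF 3 1]] .
  ultimately show ?thesis by (simp only:)
qed

text \<open>At a maximal pair \<open>(r, x)\<close> equality \<open>P x = r x\<close> must hold: a strict inequality in one component would,
after one more application of the positive matrix \<open>P\<close>, become strict in all components, and then a
larger factor would be admissible.\<close>

lemma perron_vector_exists:
  fixes P :: "nat \<Rightarrow> nat \<Rightarrow> real"
  assumes n: "1 \<le> n" and P: "\<And>i j. i < n \<Longrightarrow> j < n \<Longrightarrow> 0 < P i j"
  obtains r v where "0 < r" "\<And>i. i < n \<Longrightarrow> 0 < v i"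
    "\<And>i. i < n \<Longrightarrow> (\<Sum>j<n. P i j * v j) = r * v i"
proof -
  define R where "R = (\<Sum>i<n. \<Sum>j<n. P i j)"
  define C where "C = {(s::real, x::nat \<Rightarrow> real). s \<in> {0..R} \<and>
      (\<forall>i. x i \<in> (if i < n then {0..1} else {0})) \<and>
      (\<Sum>i<n. x i) = 1 \<and> (\<forall>i<n. s * x i \<le> (\<Sum>j<n. P i j * x j))}"
  have R0: "0 \<le> R" unfolding R_def by (intro sum_nonneg) (auto simp: P less_imp_le)
  have "(0, \<lambda>i. if i = 0 then 1 else 0) \<in> C"
    using n R0 by (auto simp: C_def P less_imp_le intro!: sum_nonneg)
  hence "C \<noteq> {}" by blast
  moreover have "compact C" unfolding C_def by (rule compact_collatz_wielandt)
  ultimately obtain z where z: "z \<in> C" "\<And>z'. z' \<in> C \<Longrightarrow> fst z' \<le> fst z"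
    using continuous_attains_sup[of C fst] continuous_on_fst[OF continuous_on_id, of C] by blast
  obtain r x where rx: "z = (r, x)" by force
  have x: "0 \<le> r" "\<And>i. i < n \<Longrightarrow> 0 \<le> x i" "(\<Sum>i<n. x i) = 1"
    "\<And>i. i < n \<Longrightarrow> r * x i \<le> (\<Sum>j<n. P i j * x j)"
    using z(1) rx by (auto simp: C_def split: if_splits)
  \<comment> \<open>Normalising \<open>y\<close> to unit sum makes the pair admissible.\<close>
  have max: "s \<le> r" if s: "0 \<le> s" and y: "\<And>i. i < n \<Longrightarrow> 0 < y i"
    and le: "\<And>i. i < n \<Longrightarrow> s * y i \<le> (\<Sum>j<n. P i j * y j)" for s y
  proof -
    define S where "S = (\<Sum>i<n. y i)"
    have S: "0 < S" unfolding S_def using n y by (intro sum_pos) (auto simp: lessThan_empty_iff)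
    define w where "w = (\<lambda>i. if i < n then y i / S else 0)"
    have w1: "(\<Sum>i<n. w i) = 1" using S by (simp add: w_def S_def flip: sum_divide_distrib)
    have w0: "0 \<le> w i" for i using S y by (auto simp: w_def less_imp_le)
    have wle1: "w i \<le> 1" if "i < n" for i
      using member_le_sum[of i "{..<n}" w] that w0 w1 by auto
    have wbox: "w i \<in> (if i < n then {0..1} else {0})" for i
      using w0[of i] wle1[of i] by (cases "i < n") (auto simp: w_def)
    have wle: "s * w i \<le> (\<Sum>j<n. P i j * w j)" if "i < n" for i
      using le[OF that] that S by (simp add: w_def sum_divide_distrib[symmetric] divide_right_mono)
    have "s = (\<Sum>i<n. s * w i)" using w1 by (simp flip: sum_distrib_left)
    also have "\<dots> \<le> (\<Sum>i<n. \<Sum>j<n. P i j * w j)" by (intro sum_mono wle) auto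
    also have "\<dots> \<le> R" unfolding R_def
      using wle1 P by (intro sum_mono) (auto intro!: mult_left_le simp: less_imp_le)
    finally have "(s, w) \<in> C" using s wbox w1 wle by (simp add: C_def)
    thus ?thesis using z(2) rx by fastforce
  qed
  obtain k where k: "k < n" "0 < x k"
    using x(2,3) by (metis (no_types, lifting) lessThan_iff order_le_less sum.neutral zero_neq_one)
  define y where "y i = (\<Sum>j<n. P i j * x j)" for i
  have y: "0 < y i" if "i < n" for i
    unfolding y_def using positive_kernel_pos[of n P x k i] P x k that by auto
  have eq: "y i = r * x i" if i: "i < n" for i
  proof (rule ccontr)
    assume ne: "y i \<noteq> r * x i"
    have lt: "r * y l < (\<Sum>j<n. P l j * y j)" if l: "l < n" for l
    proof -
      have "0 < (\<Sum>j<n. P l j * (y j - r * x j))"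
        using positive_kernel_pos[of n P "\<lambda>j. y j - r * x j" i l] P x(4) ne i l
        by (force simp: y_def order_less_le)
      also have "\<dots> = (\<Sum>j<n. P l j * y j) - r * y l"
        by (simp add: y_def[of l] algebra_simps sum_subtractf sum_distrib_left)
      finally show ?thesis by simp
    qed
    define s where "s = Min ((\<lambda>l. (\<Sum>j<n. P l j * y j) / y l) ` {..<n})"
    have fin: "finite ((\<lambda>l. (\<Sum>j<n. P l j * y j) / y l) ` {..<n})"
      "(\<lambda>l. (\<Sum>j<n. P l j * y j) / y l) ` {..<n} \<noteq> {}"
      using n by (auto simp: lessThan_empty_iff)
    have "r < s" unfolding s_def using fin lt y by (subst Min_gr_iff) (auto simp: field_simps)
    moreover have "s \<le> (\<Sum>j<n. P l j * y j) / y l" if "l < n" for l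
      unfolding s_def using fin that by (intro Min_le) auto
    hence "s * y l \<le> (\<Sum>j<n. P l j * y j)" if "l < n" for l
      using y[OF that] pos_le_divide_eq[of "y l" s] that by blast
    ultimately show False using max[of s y] y x(1) by force
  qed
  have "0 < r * x i" if "i < n" for i using y eq that by simp
  hence "0 < r" "\<And>i. i < n \<Longrightarrow> 0 < x i" using x(1,2) k by (auto simp: zero_less_mult_iff)
  thus thesis using that[of r x] eq by (simp add: y_def)
qed

text \<open>Take the smallest \<open>C\<close> with \<open>y \<le> C v\<close>; it is attained at some index \<open>k\<close>.  There
\<open>r y\<^sub>k \<le> (P y)\<^sub>k \<le> C (P v)\<^sub>k = r y\<^sub>k\<close>, so the middle inequality is an equality, which for positive
\<open>P\<close> forces \<open>y = C v\<close> in all components.  The entries of \<open>y\<close> may have either sign,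
so the comparison covers real parts, imaginary parts and moduli of complex vectors.\<close>

lemma subinvariant_imp_multiple:
  fixes P :: "nat \<Rightarrow> nat \<Rightarrow> real"
  assumes n: "1 \<le> n" and P: "\<And>i j. i < n \<Longrightarrow> j < n \<Longrightarrow> 0 < P i j"
    and v: "\<And>i. i < n \<Longrightarrow> 0 < v i" "\<And>i. i < n \<Longrightarrow> (\<Sum>j<n. P i j * v j) = r * v i"
    and y: "\<And>i. i < n \<Longrightarrow> r * y i \<le> (\<Sum>j<n. P i j * y j)"
  obtains C where "\<And>i. i < n \<Longrightarrow> y i = C * v i"
proof -
  define C where "C = Max ((\<lambda>i. y i / v i) ` {..<n})"
  have fin: "finite ((\<lambda>i. y i / v i) ` {..<n})" "(\<lambda>i. y i / v i) ` {..<n} \<noteq> {}"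
    using n by (auto simp: lessThan_empty_iff)
  have le: "y i \<le> C * v i" if "i < n" for i
  proof -
    have "y i / v i \<le> C" unfolding C_def using fin that by (intro Max_ge) auto
    thus ?thesis using v(1)[OF that] by (simp add: field_simps)
  qed
  obtain k where k: "k < n" "y k = C * v k"
    using Max_in[OF fin] v(1) unfolding C_def[symmetric] by (force simp: field_simps)
  have "(\<Sum>j<n. P k j * (C * v j - y j)) = C * (r * v k) - (\<Sum>j<n. P k j * y j)"
    using v(2)[OF k(1)] by (simp add: algebra_simps sum_subtractf flip: sum_distrib_left)
  also have "\<dots> \<le> 0" using y[OF k(1)] k(2) by (simp add: algebra_simps)
  finally have "(\<Sum>j<n. P k j * (C * v j - y j)) \<le> 0" .
  hence "\<not> 0 < C * v i - y i" if "i < n" for i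
    using positive_kernel_pos[of n P "\<lambda>j. C * v j - y j" i k] P le k(1) that by fastforce
  hence "y i = C * v i" if "i < n" for i using le[OF that] that by fastforce
  thus thesis by (rule that)
qed

text \<open>The moduli of an eigenvector satisfy \<open>\<bar>\<mu>\<bar> \<bar>z\<bar> \<le> P \<bar>z\<bar>\<close>.  If \<open>\<bar>\<mu>\<bar>\<close> exceeded \<open>r\<close>, the comparison
would make \<open>\<bar>z\<bar>\<close> a Perron vector, and then \<open>\<bar>\<mu>\<bar> \<le> r\<close> after all.\<close>

lemma perron_bound:
  fixes P :: "nat \<Rightarrow> nat \<Rightarrow> real" and z :: "nat \<Rightarrow> complex"
  assumes n: "1 \<le> n" and P: "\<And>i j. i < n \<Longrightarrow> j < n \<Longrightarrow> 0 < P i j"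
    and v: "\<And>i. i < n \<Longrightarrow> 0 < v i" "\<And>i. i < n \<Longrightarrow> (\<Sum>j<n. P i j * v j) = r * v i"
    and z: "\<And>i. i < n \<Longrightarrow> (\<Sum>j<n. of_real (P i j) * z j) = \<mu> * z i" and nz: "k < n" "z k \<noteq> 0"
  shows "cmod \<mu> \<le> r"
proof (rule ccontr)
  assume "\<not> cmod \<mu> \<le> r"
  hence less: "r < cmod \<mu>" by simp
  have ge: "cmod \<mu> * cmod (z i) \<le> (\<Sum>j<n. P i j * cmod (z j))" if "i < n" for i
  proof -
    have "cmod \<mu> * cmod (z i) = cmod (\<Sum>j<n. of_real (P i j) * z j)"
      using z[OF that] by (simp add: norm_mult)
    also have "\<dots> \<le> (\<Sum>j<n. cmod (of_real (P i j) * z j))" by (rule norm_sum)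
    also have "\<dots> = (\<Sum>j<n. P i j * cmod (z j))"
      using P that by (intro sum.cong) (auto simp: norm_mult less_imp_le)
    finally show ?thesis .
  qed
  have "r * cmod (z i) \<le> (\<Sum>j<n. P i j * cmod (z j))" if "i < n" for i
    using ge[OF that] less mult_right_mono[of r "cmod \<mu>" "cmod (z i)"] by simp
  then obtain C where C: "\<And>i. i < n \<Longrightarrow> cmod (z i) = C * v i"
    using subinvariant_imp_multiple[of n P v r "\<lambda>i. cmod (z i)"] n P v by blast
  have "(\<Sum>j<n. P k j * cmod (z j)) = r * cmod (z k)"
    using C v(2)[OF nz(1)] nz(1) by (simp add: mult.left_commute[of _ C] flip: sum_distrib_left)
  with ge[OF nz(1)] less nz(2) show False by simp
qed

text \<open>For small \<open>\<epsilon> > 0\<close> the matrix \<open>P - \<epsilon> I\<close> is still positive, with Perron root \<open>r - \<epsilon>\<close> and eigenvalue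
\<open>\<mu> - \<epsilon>\<close>.  Hence \<open>\<bar>\<mu> - \<epsilon>\<bar> \<le> r - \<epsilon>\<close>, which a number of modulus \<open>r\<close> satisfies only if it equals \<open>r\<close>.\<close>

lemma perron_peripheral:
  fixes P :: "nat \<Rightarrow> nat \<Rightarrow> real" and z :: "nat \<Rightarrow> complex"
  assumes n: "1 \<le> n" and P: "\<And>i j. i < n \<Longrightarrow> j < n \<Longrightarrow> 0 < P i j"
    and v: "\<And>i. i < n \<Longrightarrow> 0 < v i" "\<And>i. i < n \<Longrightarrow> (\<Sum>j<n. P i j * v j) = r * v i"
    and z: "\<And>i. i < n \<Longrightarrow> (\<Sum>j<n. of_real (P i j) * z j) = \<mu> * z i" and nz: "k < n" "z k \<noteq> 0"
    and eq: "cmod \<mu> = r"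
  shows "\<mu> = of_real r"
proof -
  \<comment> \<open>Half of the smallest diagonal entry keeps the shifted diagonal strictly positive.\<close>
  define \<epsilon> where "\<epsilon> = Min ((\<lambda>i. P i i) ` {..<n}) / 2"
  have ne: "finite ((\<lambda>i. P i i) ` {..<n})" "(\<lambda>i. P i i) ` {..<n} \<noteq> {}"
    using n by (auto simp: lessThan_empty_iff)
  have "0 < Min ((\<lambda>i. P i i) ` {..<n})" using ne P by (subst Min_gr_iff) auto
  hence e0: "0 < \<epsilon>" by (simp add: \<epsilon>_def)
  have Min: "Min ((\<lambda>i. P i i) ` {..<n}) \<le> P i i" if "i < n" for i using ne that by (intro Min_le) auto
  have e: "\<epsilon> < P i i" if "i < n" for i
    using Min[OF that] e0 unfolding \<epsilon>_def by linarith
  define Q where "Q i j = P i j - (if i = j then \<epsilon> else 0)" for i j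
  have Q: "0 < Q i j" if "i < n" "j < n" for i j using that e P by (auto simp: Q_def)
  have Qv: "(\<Sum>j<n. Q i j * v j) = (r - \<epsilon>) * v i" if "i < n" for i
  proof -
    have "(\<Sum>j<n. Q i j * v j) = (\<Sum>j<n. P i j * v j) - (\<Sum>j<n. if i = j then \<epsilon> * v j else 0)"
      unfolding sum_subtractf[symmetric] by (intro sum.cong) (auto simp: Q_def left_diff_distrib)
    thus ?thesis using that v(2)[OF that] by (simp add: algebra_simps)
  qed
  have Qz: "(\<Sum>j<n. of_real (Q i j) * z j) = (\<mu> - of_real \<epsilon>) * z i" if "i < n" for i
  proof -
    have "(\<Sum>j<n. of_real (Q i j) * z j)
        = (\<Sum>j<n. of_real (P i j) * z j) - (\<Sum>j<n. if i = j then of_real \<epsilon> * z j else 0)"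
      unfolding sum_subtractf[symmetric] by (intro sum.cong) (auto simp: Q_def left_diff_distrib)
    thus ?thesis using that z[OF that] by (simp add: algebra_simps)
  qed
  have "cmod (\<mu> - of_real \<epsilon>) \<le> r - \<epsilon>"
    by (rule perron_bound[of n Q v "r - \<epsilon>" z "\<mu> - of_real \<epsilon>" k]) (use n Q v Qv Qz nz in auto)
  hence "(cmod (\<mu> - of_real \<epsilon>))\<^sup>2 \<le> (r - \<epsilon>)\<^sup>2" by (intro power_mono) auto
  hence "(cmod \<mu>)\<^sup>2 - 2 * \<epsilon> * Re \<mu> + \<epsilon>\<^sup>2 \<le> r\<^sup>2 - 2 * \<epsilon> * r + \<epsilon>\<^sup>2"
    by (simp add: cmod_power2 power2_diff algebra_simps)
  hence "\<epsilon> * r \<le> \<epsilon> * Re \<mu>" using eq by simp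
  hence "r \<le> Re \<mu>" using e0 by simp
  moreover have "(Re \<mu>)\<^sup>2 + (Im \<mu>)\<^sup>2 = r\<^sup>2" using eq cmod_power2 by metis
  moreover have "0 \<le> r" using eq by auto
  ultimately have "Re \<mu> = r \<and> Im \<mu> = 0"
    by (smt (verit) power2_less_eq_zero_iff power_mono zero_le_power2 abs_Re_le_cmod eq)
  thus ?thesis by (simp add: complex_eq_iff)
qed

lemma perron_geometrically_simple:
  fixes P :: "nat \<Rightarrow> nat \<Rightarrow> real" and z :: "nat \<Rightarrow> complex"
  assumes n: "1 \<le> n" and P: "\<And>i j. i < n \<Longrightarrow> j < n \<Longrightarrow> 0 < P i j"
    and v: "\<And>i. i < n \<Longrightarrow> 0 < v i" "\<And>i. i < n \<Longrightarrow> (\<Sum>j<n. P i j * v j) = r * v i"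
    and z: "\<And>i. i < n \<Longrightarrow> (\<Sum>j<n. of_real (P i j) * z j) = of_real r * z i"
  obtains \<alpha> where "\<And>i. i < n \<Longrightarrow> z i = \<alpha> * of_real (v i)"
proof -
  have Re: "(\<Sum>j<n. P i j * Re (z j)) = r * Re (z i)" if "i < n" for i
    using arg_cong[OF z[OF that], of Re] by simp
  have Im: "(\<Sum>j<n. P i j * Im (z j)) = r * Im (z i)" if "i < n" for i
    using arg_cong[OF z[OF that], of Im] by simp
  obtain C where C: "\<And>i. i < n \<Longrightarrow> Re (z i) = C * v i"
    using subinvariant_imp_multiple[of n P v r "\<lambda>i. Re (z i)"] n P v eq_refl[OF Re[symmetric]] by blast
  obtain C' where C': "\<And>i. i < n \<Longrightarrow> Im (z i) = C' * v i"
    using subinvariant_imp_multiple[of n P v r "\<lambda>i. Im (z i)"] n P v eq_refl[OF Im[symmetric]] by blast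
  show thesis by (rule that[of "Complex C C'"]) (simp add: complex_eq_iff C C')
qed

text \<open>There is no Jordan chain \<open>(P - r) z = \<beta> v\<close> at the Perron root.  After division by \<open>\<beta>\<close> the real part \<open>y\<close>
satisfies \<open>P y = r y + v \<ge> r y\<close>; the comparison makes \<open>y\<close> a multiple of \<open>v\<close>, hence \<open>P y = r y\<close>, a
contradiction to \<open>v > 0\<close>.\<close>

lemma perron_no_chain:
  fixes P :: "nat \<Rightarrow> nat \<Rightarrow> real" and z :: "nat \<Rightarrow> complex"
  assumes n: "1 \<le> n" and P: "\<And>i j. i < n \<Longrightarrow> j < n \<Longrightarrow> 0 < P i j"
    and v: "\<And>i. i < n \<Longrightarrow> 0 < v i" "\<And>i. i < n \<Longrightarrow> (\<Sum>j<n. P i j * v j) = r * v i"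
    and z: "\<And>i. i < n \<Longrightarrow> (\<Sum>j<n. of_real (P i j) * z j) = of_real r * z i + \<beta> * of_real (v i)"
  shows "\<beta> = 0"
proof (rule ccontr)
  assume b: "\<beta> \<noteq> 0"
  define y where "y i = Re (z i / \<beta>)" for i
  have y: "(\<Sum>j<n. P i j * y j) = r * y i + v i" if "i < n" for i
  proof -
    have "(\<Sum>j<n. of_real (P i j) * (z j / \<beta>)) = of_real r * (z i / \<beta>) + of_real (v i)"
      using z[OF that] b by (simp add: field_simps flip: sum_divide_distrib)
    from arg_cong[OF this, of Re] show ?thesis
      unfolding y_def Re_sum plus_complex.sel Re_complex_of_real
      by (simp del: times_divide_eq_right)
  qed
  have "r * y i \<le> (\<Sum>j<n. P i j * y j)" if "i < n" for i using y[OF that] v(1)[OF that] by simp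
  then obtain C where C: "\<And>i. i < n \<Longrightarrow> y i = C * v i"
    using subinvariant_imp_multiple[of n P v r y] n P v by blast
  have 0: "0 < n" using n by simp
  have "(\<Sum>j<n. P 0 j * y j) = r * y 0"
    using C v(2)[OF 0] 0 by (simp add: mult.left_commute[of _ C] flip: sum_distrib_left)
  with y[OF 0] v(1)[OF 0] show False by simp
qed

section \<open>Simple roots of a matrix pencil\<close>

text \<open>Replace the first column of the identity matrix by the eigenvector \<open>v\<close> to get \<open>S\<close>, whose
determinant is \<open>v\<^sub>0 \<noteq> 0\<close>.  The first column of \<open>(X B - A) S\<close> is \<open>(X - l) B v\<close>, so one factor
\<open>X - l\<close> splits off from the determinant.  What remains is \<open>det Q\<close>, where \<open>Q\<close> is \<open>X B - A\<close> with first
column \<open>B v\<close>.  A null vector of \<open>Q\<close> at \<open>X = l\<close> would give either a second eigenvector or a Jordan chain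
\<open>(A - l B) z = \<beta> B v\<close>, and both are excluded by the hypotheses.\<close>

lemma order_det_pencil_eq_1:
  fixes A B :: "nat \<Rightarrow> nat \<Rightarrow> complex" and v :: "nat \<Rightarrow> complex"
  assumes n: "1 \<le> n" and v0: "v 0 \<noteq> 0"
    and eig: "\<And>i. i < n \<Longrightarrow> (\<Sum>j<n. A i j * v j) = l * (\<Sum>j<n. B i j * v j)"
    and simple: "\<And>z. (\<And>i. i < n \<Longrightarrow> (\<Sum>j<n. A i j * z j) = l * (\<Sum>j<n. B i j * z j))
      \<Longrightarrow> \<exists>\<alpha>. \<forall>i<n. z i = \<alpha> * v i"
    and no_chain: "\<And>z \<beta>. (\<And>i. i < n \<Longrightarrow> (\<Sum>j<n. A i j * z j)
        = l * (\<Sum>j<n. B i j * z j) + \<beta> * (\<Sum>j<n. B i j * v j)) \<Longrightarrow> \<beta> = 0"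
  shows "Polynomial.order l (Determinant.det (Matrix.mat n n (\<lambda>(i, j). [:- A i j, B i j:]))) = 1"
proof -
  define w where "w i = (\<Sum>j<n. B i j * v j)" for i
  define M where "M = Matrix.mat n n (\<lambda>(i, j). [:- A i j, B i j:])"
  define S where "S = Matrix.mat n n (\<lambda>(i, j). if j = 0 then [:v i:] else if i = j then 1 else 0)"
  define E where "E = Matrix.mat n n (\<lambda>(i, j). if i = j then if i = 0 then [:- l, 1:] else 1 else 0)"
  define Q where "Q = Matrix.mat n n (\<lambda>(i, j). if j = 0 then [:w i:] else [:- A i j, B i j:])"
  have carr: "M \<in> carrier_mat n n" "S \<in> carrier_mat n n" "E \<in> carrier_mat n n" "Q \<in> carrier_mat n n"
    by (auto simp: M_def S_def E_def Q_def)
  have MS: "M * S = Q * E"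
  proof (rule eq_matI)
    fix i j assume "i < dim_row (Q * E)" "j < dim_col (Q * E)"
    hence ij: "i < n" "j < n" by (auto simp: Q_def E_def)
    have QE: "(Q * E) $$ (i, j) = (if j = 0 then [:w i:] * [:- l, 1:] else [:- A i j, B i j:])"
    proof -
      have "(Q * E) $$ (i, j) = (\<Sum>k<n. Q $$ (i, k) * E $$ (k, j))"
        using ij by (simp add: scalar_prod_def atLeast0LessThan Q_def E_def)
      also have "\<dots> = (\<Sum>k<n. if k = j then Q $$ (i, j) * E $$ (j, j) else 0)"
        using ij by (intro sum.cong) (auto simp: E_def)
      finally have "(Q * E) $$ (i, j) = \<dots>" .
      thus ?thesis using ij by (simp add: Q_def E_def)
    qed
    have MS: "(M * S) $$ (i, j) = (\<Sum>k<n. M $$ (i, k) * S $$ (k, j))"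
      using ij by (auto simp: M_def S_def scalar_prod_def atLeast0LessThan)
    show "(M * S) $$ (i, j) = (Q * E) $$ (i, j)"
    proof (cases "j = 0")
      case True
      have "(M * S) $$ (i, j) = (\<Sum>k<n. [:- A i k * v k, B i k * v k:])"
        using ij True unfolding MS by (intro sum.cong) (auto simp: M_def S_def mult.commute)
      also have "\<dots> = [:- (\<Sum>k<n. A i k * v k), (\<Sum>k<n. B i k * v k):]"
        by (rule poly_eqI) (auto simp: coeff_sum coeff_pCons sum_negf split: nat.splits)
      also have "\<dots> = [:w i:] * [:- l, 1:]" using ij eig by (simp add: w_def)
      finally show ?thesis using True QE by simp
    next
      case False
      have "(M * S) $$ (i, j) = (\<Sum>k<n. if k = j then M $$ (i, j) else 0)"
        using ij False unfolding MS by (intro sum.cong) (auto simp: S_def)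
      thus ?thesis using ij False QE by (simp add: M_def)
    qed
  qed (auto simp: M_def S_def E_def Q_def)
  obtain m where m: "n = Suc m" using n by (cases n) auto
  have detS: "Determinant.det S = [:v 0:]"
  proof -
    have "Determinant.det S = prod_list (diag_mat S)"
      using carr(2) by (intro det_lower_triangular[of n]) (auto simp: S_def)
    also have "diag_mat S = [:v 0:] # map (\<lambda>i. 1) [1..<n]"
      using m by (simp add: diag_mat_def S_def upt_conv_Cons del: upt_Suc)
    finally show ?thesis by (simp add: map_replicate_const)
  qed
  have detE: "Determinant.det E = [:- l, 1:]"
  proof -
    have "Determinant.det E = prod_list (diag_mat E)"
      using carr(3) by (intro det_lower_triangular[of n]) (auto simp: E_def)
    also have "diag_mat E = [:- l, 1:] # map (\<lambda>i. 1) [1..<n]"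
      using m by (simp add: diag_mat_def E_def upt_conv_Cons del: upt_Suc)
    finally show ?thesis by (simp add: map_replicate_const)
  qed
  have prod: "Determinant.det M * [:v 0:] = Determinant.det Q * [:- l, 1:]"
    using arg_cong[OF MS, of Determinant.det] carr by (simp add: det_mult detS detE)
  interpret ev: comm_ring_hom "\<lambda>p. poly p l" by unfold_locales auto
  have "poly (Determinant.det Q) l \<noteq> 0"
  proof
    define Q' where "Q' = map_mat (\<lambda>p. poly p l) Q"
    have Q': "Q' \<in> carrier_mat n n" using carr(4) by (simp add: Q'_def)
    assume "poly (Determinant.det Q) l = 0"
    hence "Determinant.det Q' = 0" unfolding Q'_def by simp
    then obtain zv where zv: "zv \<in> carrier_vec n" "zv \<noteq> 0\<^sub>v n" "Q' *\<^sub>v zv = 0\<^sub>v n"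
      using det_0_iff_vec_prod_zero[OF Q'] by blast
    \<comment> \<open>The entry \<open>zv\<^sub>0\<close> multiplies the column \<open>B v\<close>; the other entries form a vector \<open>z\<close> with \<open>z\<^sub>0 = 0\<close>.\<close>
    define z where "z i = (if i = 0 then 0 else vec_index zv i)" for i
    have eq: "(\<Sum>j<n. A i j * z j) = l * (\<Sum>j<n. B i j * z j) + vec_index zv 0 * (\<Sum>j<n. B i j * v j)"
      if i: "i < n" for i
    proof -
      have "0 = vec_index (Q' *\<^sub>v zv) i" using zv(3) i by simp
      also have "\<dots> = (\<Sum>j<n. Q' $$ (i, j) * vec_index zv j)"
        using i zv(1) Q' by (auto simp: scalar_prod_def atLeast0LessThan intro!: sum.cong)
      also have "\<dots> = (\<Sum>j<n. (l * B i j - A i j) * z j + (if j = 0 then w i * vec_index zv 0 else 0))"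
        using i carr(4) by (intro sum.cong) (auto simp: Q'_def Q_def z_def algebra_simps)
      also have "\<dots> = l * (\<Sum>j<n. B i j * z j) - (\<Sum>j<n. A i j * z j) + w i * vec_index zv 0"
        using n by (simp add: sum.distrib sum_subtractf sum_distrib_left algebra_simps)
      finally show ?thesis by (simp add: w_def algebra_simps)
    qed
    have zv0: "vec_index zv 0 = 0" by (rule no_chain[of z]) (rule eq)
    obtain \<alpha> where \<alpha>: "\<forall>i<n. z i = \<alpha> * v i"
      using simple[of z] eq zv0 by auto
    \<comment> \<open>A multiple of \<open>v\<close> whose first entry vanishes is zero.\<close>
    have "\<alpha> = 0" using \<alpha> n v0 by (auto simp: z_def dest!: spec[of _ 0])
    hence "vec_index zv i = 0" if "i < n" for i using \<alpha> zv0 that by (cases "i = 0") (auto simp: z_def)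
    hence "zv = 0\<^sub>v n" using zv(1) by (intro eq_vecI) auto
    thus False using zv(2) by simp
  qed
  hence Q0: "Polynomial.order l (Determinant.det Q) = 0" "Determinant.det Q \<noteq> 0"
    by (auto simp: order_0I)
  have ne: "Determinant.det M * [:v 0:] \<noteq> 0" unfolding prod by (rule no_zero_divisors) (use Q0 in auto)
  have "Polynomial.order l (Determinant.det M) = Polynomial.order l (Determinant.det M * [:v 0:])"
    using ne v0 by (subst order_mult) (auto simp: order_0I)
  also have "\<dots> = Polynomial.order l (Determinant.det Q) + Polynomial.order l [:- l, 1:]"
    using ne unfolding prod by (rule order_mult)
  also have "Polynomial.order l [:- l, 1:] = 1" using order_power_n_n[of l 1] by simp
  finally show ?thesis using Q0 by (simp add: M_def)
qed

section \<open>Pencils of an irreducible M-matrix and a nonnegative matrix\<close>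

text \<open>The matrices are functions of two indices below \<open>n\<close>, which keeps the Perron argument free of dimension
conditions; \<open>A'\<close> is the inverse of \<open>A\<close>.\<close>

locale m_matrix_pencil =
  fixes n :: nat and A A' B :: "nat \<Rightarrow> nat \<Rightarrow> real"
  assumes n: "1 \<le> n"
    and off_diagonal: "\<And>i j. i < n \<Longrightarrow> j < n \<Longrightarrow> i \<noteq> j \<Longrightarrow> A i j \<le> 0"
    and right_inverse: "\<And>i j. i < n \<Longrightarrow> j < n \<Longrightarrow> (\<Sum>k<n. A i k * A' k j) = (if i = j then 1 else 0)"
    and left_inverse: "\<And>i j. i < n \<Longrightarrow> j < n \<Longrightarrow> (\<Sum>k<n. A' i k * A k j) = (if i = j then 1 else 0)"
    and inverse_nonneg: "\<And>i j. i < n \<Longrightarrow> j < n \<Longrightarrow> 0 \<le> A' i j"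
    and irreducible: "\<And>I. I \<noteq> {} \<Longrightarrow> I \<subset> {..<n} \<Longrightarrow> \<exists>i\<in>I. \<exists>j\<in>{..<n} - I. A i j \<noteq> 0"
    and B_nonneg: "\<And>i j. i < n \<Longrightarrow> j < n \<Longrightarrow> 0 \<le> B i j"
    and B_diag: "\<And>i. i < n \<Longrightarrow> 0 < B i i"
begin

text \<open>A column \<open>x\<close> of the inverse is nonnegative and \<open>A x\<close> is a unit vector.  In a row \<open>l\<close> with \<open>x\<^sub>l = 0\<close> all
terms of \<open>(A x)\<^sub>l \<ge> 0\<close> are nonpositive, so \<open>A\<^sub>l\<^sub>m = 0\<close> whenever \<open>x\<^sub>m > 0\<close>.  Thus the zero set of
\<open>x\<close> would reduce \<open>A\<close>, and by irreducibility it is empty.\<close>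

lemma inverse_pos:
  assumes i: "i < n" and j: "j < n" shows "0 < A' i j"
proof -
  define I where "I = {i. i < n \<and> A' i j = 0}"
  have "I \<noteq> {..<n}"
  proof
    assume I: "I = {..<n}"
    have "(\<Sum>k<n. A j k * A' k j) = 0"
    proof (rule sum.neutral, rule ballI)
      fix k assume "k \<in> {..<n}"
      hence "A' k j = 0" unfolding I[symmetric] I_def by simp
      thus "A j k * A' k j = 0" by simp
    qed
    thus False using right_inverse[OF j j] by simp
  qed
  moreover have "A l m = 0" if l: "l \<in> I" and m: "m \<in> {..<n} - I" for l m
  proof -
    have nonpos: "A l k * A' k j \<le> 0" if "k \<in> {..<n}" for k
      using off_diagonal[of l k] inverse_nonneg[of k j] that l j
      by (cases "k = l") (auto simp: I_def mult_nonpos_nonneg)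
    have "(\<Sum>k<n. A l k * A' k j) \<ge> 0" using right_inverse[of l j] l j by (simp add: I_def)
    hence "(\<Sum>k<n. - (A l k * A' k j)) = 0"
      using sum_nonpos[of "{..<n}" "\<lambda>k. A l k * A' k j"] nonpos by (simp add: sum_negf)
    hence "A l m * A' m j = 0"
      using m nonpos by (subst (asm) sum_nonneg_eq_0_iff) auto
    thus ?thesis using m by (auto simp: I_def)
  qed
  ultimately have "I = {}" using irreducible[of I] by (force simp: I_def)
  hence "A' i j \<noteq> 0" using i by (auto simp: I_def)
  thus ?thesis using inverse_nonneg[OF i j] by simp
qed

definition P :: "nat \<Rightarrow> nat \<Rightarrow> real" where "P i j = (\<Sum>k<n. A' i k * B k j)"

lemma P_pos: "i < n \<Longrightarrow> j < n \<Longrightarrow> 0 < P i j"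
  unfolding P_def using positive_kernel_pos[of n A' "\<lambda>k. B k j" j i] inverse_pos B_nonneg B_diag by blast

lemma inverse_apply:
  fixes z y :: "nat \<Rightarrow> complex"
  assumes "\<And>i. i < n \<Longrightarrow> (\<Sum>j<n. of_real (A i j) * z j) = y i" and i: "i < n"
  shows "z i = (\<Sum>k<n. of_real (A' i k) * y k)"
proof -
  have "(\<Sum>k<n. of_real (A' i k) * y k) = (\<Sum>k<n. \<Sum>j<n. of_real (A' i k * A k j) * z j)"
    using assms(1) by (intro sum.cong refl) (simp add: sum_distrib_left mult.assoc flip: assms(1))
  also have "\<dots> = (\<Sum>j<n. of_real (\<Sum>k<n. A' i k * A k j) * z j)"
    by (subst sum.swap) (simp add: sum_distrib_right)
  also have "\<dots> = (\<Sum>j<n. if i = j then z j else 0)"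
    using i by (intro sum.cong) (auto simp: left_inverse)
  finally show ?thesis using i by simp
qed

lemma P_apply: "(\<Sum>k<n. of_real (A' i k) * (\<Sum>j<n. of_real (B k j) * z j)) = (\<Sum>j<n. complex_of_real (P i j) * z j)"
  unfolding P_def sum_distrib_left of_real_sum sum_distrib_right
  by (subst sum.swap) (simp add: mult.assoc)

text \<open>The equation \<open>A z = l B z + \<beta> B v\<close> is equivalent to \<open>z = l P z + \<beta> r v\<close>, where \<open>P v = r v\<close>.  Eigenvectors of
the pencil are therefore eigenvectors of \<open>P\<close> with the reciprocal eigenvalue, and chains
correspond to chains.  So the statement is Perron's theorem for \<open>P\<close>, read with \<open>l1 = 1 / r\<close>.\<close>

lemma principal_pencil_eigenvalue:
  obtains l1 v where "0 < l1" "\<And>i. i < n \<Longrightarrow> 0 < v i"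
    "\<And>i. i < n \<Longrightarrow> (\<Sum>j<n. A i j * v j) = l1 * (\<Sum>j<n. B i j * v j)"
    "\<And>l z k. (\<And>i. i < n \<Longrightarrow> (\<Sum>j<n. of_real (A i j) * z j) = l * (\<Sum>j<n. of_real (B i j) * z j))
       \<Longrightarrow> k < n \<Longrightarrow> z k \<noteq> 0 \<Longrightarrow> l1 \<le> cmod l \<and> (cmod l = l1 \<longrightarrow> l = of_real l1)"
    "\<And>z. (\<And>i. i < n \<Longrightarrow> (\<Sum>j<n. of_real (A i j) * z j) = of_real l1 * (\<Sum>j<n. of_real (B i j) * z j))
       \<Longrightarrow> \<exists>\<alpha>. \<forall>i<n. z i = \<alpha> * complex_of_real (v i)"
    "Polynomial.order (complex_of_real l1) (Determinant.det (Matrix.mat n n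
        (\<lambda>(i, j). [:- complex_of_real (A i j), complex_of_real (B i j):]))) = 1"
proof -
  obtain r v where r: "0 < r" and v: "\<And>i. i < n \<Longrightarrow> 0 < v i"
    and Pv: "\<And>i. i < n \<Longrightarrow> (\<Sum>j<n. P i j * v j) = r * v i"
    using perron_vector_exists[of n P] n P_pos by blast
  note perron = n P_pos v Pv
  define l1 where "l1 = 1 / r"
  have l1: "0 < l1" "l1 * r = 1" using r by (auto simp: l1_def)
  have Av: "(\<Sum>j<n. A i j * v j) = l1 * (\<Sum>j<n. B i j * v j)" if i: "i < n" for i
  proof -
    define w where "w k = (\<Sum>m<n. B k m * v m)" for k
    have vw: "v j = l1 * (\<Sum>k<n. A' j k * w k)" if "j < n" for j
    proof -
      have "(\<Sum>k<n. A' j k * w k) = (\<Sum>m<n. P j m * v m)"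
        unfolding P_def w_def sum_distrib_left sum_distrib_right by (subst sum.swap) (simp add: mult.assoc)
      thus ?thesis using Pv[OF that] l1(2) by (simp add: mult.assoc[symmetric])
    qed
    have "(\<Sum>j<n. A i j * v j) = (\<Sum>j<n. \<Sum>k<n. l1 * ((A i j * A' j k) * w k))"
      by (intro sum.cong refl) (simp add: vw sum_distrib_left mult_ac)
    also have "\<dots> = (\<Sum>k<n. l1 * ((\<Sum>j<n. A i j * A' j k) * w k))"
      by (subst sum.swap) (simp add: sum_distrib_left sum_distrib_right)
    also have "\<dots> = (\<Sum>k<n. if i = k then l1 * w k else 0)"
      using i by (intro sum.cong) (auto simp: right_inverse)
    finally show ?thesis using i by (simp add: w_def)
  qed
  have conv: "z i = l * (\<Sum>j<n. complex_of_real (P i j) * z j) + \<beta> * (of_real r * of_real (v i))"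
    if z: "\<And>i. i < n \<Longrightarrow> (\<Sum>j<n. of_real (A i j) * z j)
      = l * (\<Sum>j<n. of_real (B i j) * z j) + \<beta> * (\<Sum>j<n. of_real (B i j) * complex_of_real (v j))"
      and i: "i < n" for z l \<beta> i
  proof -
    have lin: "(\<Sum>k<n. f k * (l * s k + \<beta> * t k)) = l * (\<Sum>k<n. f k * s k) + \<beta> * (\<Sum>k<n. f k * t k)"
      for f s t :: "nat \<Rightarrow> complex"
      by (simp add: distrib_left sum.distrib sum_distrib_left mult.left_commute)
    have "z i = (\<Sum>k<n. of_real (A' i k) * (l * (\<Sum>j<n. of_real (B k j) * z j)
        + \<beta> * (\<Sum>j<n. of_real (B k j) * complex_of_real (v j))))"
      using z i by (rule inverse_apply)
    also have "\<dots> = l * (\<Sum>k<n. of_real (A' i k) * (\<Sum>j<n. of_real (B k j) * z j))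
        + \<beta> * (\<Sum>k<n. of_real (A' i k) * (\<Sum>j<n. of_real (B k j) * complex_of_real (v j)))"
      by (rule lin)
    also have "\<dots> = l * (\<Sum>j<n. complex_of_real (P i j) * z j) + \<beta> * (of_real r * of_real (v i))"
      unfolding P_apply using Pv[OF i] by (simp flip: of_real_mult of_real_sum)
    finally show ?thesis .
  qed
  have eig: "l \<noteq> 0" "\<And>i. i < n \<Longrightarrow> (\<Sum>j<n. complex_of_real (P i j) * z j) = (1 / l) * z i"
    if z: "\<And>i. i < n \<Longrightarrow> (\<Sum>j<n. of_real (A i j) * z j) = l * (\<Sum>j<n. of_real (B i j) * z j)"
      and k: "k < n" "z k \<noteq> 0" for z l k
  proof -
    have c: "z i = l * (\<Sum>j<n. complex_of_real (P i j) * z j)" if "i < n" for i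
      using conv[of z l 0 i] z that by simp
    thus l: "l \<noteq> 0" using k by fastforce
    show "(\<Sum>j<n. complex_of_real (P i j) * z j) = (1 / l) * z i" if "i < n" for i
      using c[OF that] l by (simp add: field_simps)
  qed
  have bound: "l1 \<le> cmod l \<and> (cmod l = l1 \<longrightarrow> l = of_real l1)"
    if z: "\<And>i. i < n \<Longrightarrow> (\<Sum>j<n. of_real (A i j) * z j) = l * (\<Sum>j<n. of_real (B i j) * z j)"
      and k: "k < n" "z k \<noteq> 0" for z l k
  proof -
    note e = eig[of z l, OF z k]
    have "cmod (1 / l) \<le> r" by (rule perron_bound[OF perron e(2) k])
    hence "l1 \<le> cmod l" using e(1) r by (simp add: l1_def norm_divide field_simps)
    moreover have "l = of_real l1" if "cmod l = l1"
    proof -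
      have "cmod (1 / l) = r" using that by (simp add: norm_divide l1_def)
      hence "1 / l = of_real r" by (intro perron_peripheral[OF perron e(2) k])
      thus ?thesis using e(1) r by (simp add: l1_def field_simps)
    qed
    ultimately show ?thesis by blast
  qed
  have simple: "\<exists>\<alpha>. \<forall>i<n. z i = \<alpha> * complex_of_real (v i)"
    if z: "\<And>i. i < n \<Longrightarrow> (\<Sum>j<n. of_real (A i j) * z j) = of_real l1 * (\<Sum>j<n. of_real (B i j) * z j)" for z
  proof -
    have "(\<Sum>j<n. complex_of_real (P i j) * z j) = of_real r * z i" if "i < n" for i
      using conv[of z "of_real l1" 0 i] z that r by (simp add: l1_def)
    then obtain \<alpha> where "\<And>i. i < n \<Longrightarrow> z i = \<alpha> * complex_of_real (v i)"
      using perron_geometrically_simple[of n P v r z] perron by blast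
    thus ?thesis by blast
  qed
  have chain: "\<beta> = 0"
    if z: "\<And>i. i < n \<Longrightarrow> (\<Sum>j<n. of_real (A i j) * z j)
      = of_real l1 * (\<Sum>j<n. of_real (B i j) * z j) + \<beta> * (\<Sum>j<n. of_real (B i j) * complex_of_real (v j))" for z \<beta>
  proof -
    have Pz: "(\<Sum>j<n. complex_of_real (P i j) * z j) = of_real r * z i + (- \<beta> * of_real (r * r)) * of_real (v i)" if "i < n" for i
    proof -
      have "z i = of_real l1 * (\<Sum>j<n. complex_of_real (P i j) * z j) + \<beta> * (of_real r * of_real (v i))"
        using z that by (rule conv)
      hence "of_real r * z i = of_real r * (of_real l1 * (\<Sum>j<n. complex_of_real (P i j) * z j)
          + \<beta> * (of_real r * of_real (v i)))" by (rule arg_cong)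
      also have "\<dots> = of_real r * (of_real l1 * (\<Sum>j<n. complex_of_real (P i j) * z j))
          + \<beta> * of_real (r * r) * of_real (v i)"
        by (simp add: distrib_left mult_ac)
      finally have "of_real r * z i = \<dots>" .
      moreover have "of_real r * (of_real l1 * s) = s" for s :: complex using r by (simp add: l1_def)
      ultimately show ?thesis by simp
    qed
    have "- \<beta> * of_real (r * r) = 0" by (rule perron_no_chain[OF perron Pz])
    thus ?thesis using r by simp
  qed
  have "Polynomial.order (complex_of_real l1) (Determinant.det (Matrix.mat n n
        (\<lambda>(i, j). [:- complex_of_real (A i j), complex_of_real (B i j):]))) = 1"
  proof (rule order_det_pencil_eq_1[OF n, where v = "\<lambda>i. complex_of_real (v i)"])
    show "complex_of_real (v 0) \<noteq> 0" using v[of 0] n by simp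
    show "(\<Sum>j<n. complex_of_real (A i j) * complex_of_real (v j))
        = of_real l1 * (\<Sum>j<n. complex_of_real (B i j) * complex_of_real (v j))" if "i < n" for i
      using Av[OF that] by (simp flip: of_real_mult of_real_sum)
  qed (fact simple chain)+
  thus thesis using that[of l1 v] l1(1) v Av bound simple by blast
qed

end

section \<open>Geometry of the mesh and of the nodal basis\<close>

lemma has_derivative_affine_on:
  fixes f :: "'a::euclidean_space \<Rightarrow> 'b::real_normed_vector"
  assumes "x \<in> interior K" and "bounded_linear L" and "\<And>y. y \<in> K \<Longrightarrow> f y = L y + c"
  shows "(f has_derivative L) (at x)"
proof -
  have "((\<lambda>y. L y + c) has_derivative L) (at x)"
    by (intro has_derivative_add_const bounded_linear_imp_has_derivative assms)
  thus ?thesis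
    by (rule has_derivative_transform_within_open[OF _ open_interior assms(1)])
      (use assms(3) interior_subset in fastforce)
qed

lemma grad_eqI:
  assumes "(f has_derivative f') (at x)" shows "grad f x = (\<chi> i. f' (axis i 1))"
  unfolding grad_def frechet_derivative_at[OF assms, symmetric] by (rule refl)

locale p1_mesh =
  fixes \<Omega> :: "(real ^ 'd::finite) set" and \<T> :: "(real ^ 'd) set set"
    and p :: "nat \<Rightarrow> real ^ 'd" and \<phi> :: "nat \<Rightarrow> real ^ 'd \<Rightarrow> real" and N Nv :: nat
  assumes domain: "polyhedral_domain \<Omega>" and mesh: "simplicial_mesh \<Omega> \<T>"
    and numbering: "vertex_numbering \<Omega> \<T> N Nv p" and basis: "P1_nodal_basis \<T> N p \<phi>"
begin

lemma Nv_le_N: "Nv \<le> N"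
  using numbering by (simp add: vertex_numbering_def)

lemma finite_mesh: "finite \<T>" and Union_mesh: "\<Union>\<T> = closure \<Omega>"
  using mesh by (auto simp: simplicial_mesh_def triangulation_def)

lemma domain_union: obtains F where "finite F" "\<And>P. P \<in> F \<Longrightarrow> polytope P" "\<Omega> = interior (\<Union>F)"
  using domain by (auto simp: polyhedral_domain_def)

lemma open_domain: "open \<Omega>"
  using domain_union by (metis open_interior)

text \<open>A domain that is the interior of a finite union of polytopes has no slits: it is the interior of its
closure, and its boundary lies in the boundaries of the polytopes.\<close>

lemma interior_closure_domain: "interior (closure \<Omega>) = \<Omega>"
proof -
  obtain F where F: "finite F" "\<And>P. P \<in> F \<Longrightarrow> polytope P" "\<Omega> = interior (\<Union>F)"
    using domain_union by blast
  have "closed (\<Union>F)" using F by (intro closed_Union) (auto intro: polytope_imp_closed)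
  hence "closure \<Omega> \<subseteq> \<Union>F" using F(3) by (metis closure_minimal interior_subset)
  hence "interior (closure \<Omega>) \<subseteq> \<Omega>" using F(3) interior_mono by blast
  thus ?thesis using open_domain closure_subset interior_maximal by blast
qed

lemma bounded_domain: "bounded \<Omega>"
proof -
  obtain F where F: "finite F" "\<And>P. P \<in> F \<Longrightarrow> polytope P" "\<Omega> = interior (\<Union>F)"
    using domain_union by blast
  have "bounded (\<Union>F)" using F by (intro bounded_Union) (auto intro: polytope_imp_bounded)
  thus ?thesis using F(3) bounded_subset interior_subset by blast
qed

lemma negligible_frontier_domain: "negligible (frontier \<Omega>)"
proof -
  obtain F where F: "finite F" "\<And>P. P \<in> F \<Longrightarrow> polytope P" "\<Omega> = interior (\<Union>F)"
    using domain_union by blast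
  have cl: "closed (\<Union>F)" using F by (intro closed_Union) (auto intro: polytope_imp_closed)
  have "frontier \<Omega> \<subseteq> \<Union>(frontier ` F)"
  proof
    fix x assume x: "x \<in> frontier \<Omega>"
    hence "x \<in> \<Union>F" using cl F(3)
      by (metis DiffD1 closure_minimal frontier_def interior_subset subsetD)
    then obtain P where P: "P \<in> F" "x \<in> P" by blast
    have "x \<notin> interior P" using x F(3) P(1) open_domain
      by (metis DiffD2 Union_upper frontier_def interior_mono interior_open subsetD)
    hence "x \<in> frontier P" using P(2) closure_subset unfolding frontier_def by blast
    thus "x \<in> \<Union>(frontier ` F)" using P(1) by blast
  qed
  moreover have "negligible (\<Union>(frontier ` F))"
  proof (intro negligible_Union finite_imageI F(1))
    fix S assume "S \<in> frontier ` F"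
    thus "negligible S" using negligible_convex_frontier[OF polytope_imp_convex[OF F(2)]] by blast
  qed
  ultimately show ?thesis by (rule negligible_subset[rotated])
qed

lemma element_simplex:
  assumes "K \<in> \<T>"
  obtains C where "finite C" "\<not> affine_dependent C" "K = convex hull C"
    "\<forall>v. v extreme_point_of K \<longleftrightarrow> v \<in> C"
proof -
  have "int CARD('d) simplex K" using assms mesh by (auto simp: simplicial_mesh_def)
  then obtain C where C: "finite C" "\<not> affine_dependent C" "int (card C) = int CARD('d) + 1"
    "K = convex hull C" unfolding simplex by blast
  have "\<forall>v. v extreme_point_of K \<longleftrightarrow> v \<in> C"
    using extreme_point_of_convex_hull_affine_independent[OF C(2)] unfolding C(4) by blast
  thus thesis using C that by blast
qed

lemma element_compact: assumes "K \<in> \<T>" shows "compact K"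
  by (rule element_simplex[OF assms]) (simp add: finite_imp_compact_convex_hull)

lemma element_convex: assumes "K \<in> \<T>" shows "convex K"
  by (rule element_simplex[OF assms]) simp

lemma element_interior_nonempty: assumes "K \<in> \<T>" shows "interior K \<noteq> {}"
proof -
  have "int CARD('d) simplex K" using assms mesh by (auto simp: simplicial_mesh_def)
  hence "aff_dim K = int DIM(real ^ 'd)" using aff_dim_simplex by force
  hence "affine hull K = UNIV" using aff_dim_eq_full by blast
  hence "interior K = rel_interior K" using rel_interior_interior by blast
  moreover have "K \<noteq> {}" using \<open>aff_dim K = _\<close> aff_dim_empty[of K] by auto
  ultimately show ?thesis using rel_interior_eq_empty[OF element_convex[OF assms]] by blast
qed

lemma element_closure_interior: assumes "K \<in> \<T>" shows "closure (interior K) = K"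
  unfolding convex_closure_interior[OF element_convex[OF assms] element_interior_nonempty[OF assms]]
  by (rule closure_closed[OF compact_imp_closed[OF element_compact[OF assms]]])

lemma element_subset: assumes "K \<in> \<T>" shows "K \<subseteq> closure \<Omega>"
  using assms unfolding Union_mesh[symmetric] by (rule Union_upper)

lemma element_interior_subset: assumes "K \<in> \<T>" shows "interior K \<subseteq> \<Omega>"
  using interior_mono[OF element_subset[OF assms]] by (simp only: interior_closure_domain)

text \<open>The null set outside of which a point of \<open>\<Omega>\<close> lies in the interior of exactly one mesh element.\<close>

definition skeleton :: "(real ^ 'd) set" where
  "skeleton = frontier \<Omega> \<union> \<Union>(frontier ` \<T>)"

lemma negligible_skeleton: "negligible skeleton"
  unfolding skeleton_def
proof (intro negligible_Un negligible_frontier_domain negligible_Union finite_imageI finite_mesh)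
  fix S assume "S \<in> frontier ` \<T>"
  thus "negligible S" using negligible_convex_frontier[OF element_convex] by blast
qed

lemma elements_Int_subset_skeleton:
  assumes "K \<in> \<T>" "K' \<in> \<T>" "K \<noteq> K'" shows "K \<inter> K' \<subseteq> skeleton"
proof -
  have "triangulation \<T>" using mesh by (simp add: simplicial_mesh_def)
  hence "(L \<inter> L') face_of L" if "L \<in> \<T>" "L' \<in> \<T>" for L L'
    using that unfolding triangulation_def by blast
  from this[OF assms(1,2)] this[OF assms(2,1)]
  have face: "(K \<inter> K') face_of K" "(K \<inter> K') face_of K'" by (simp_all add: Int_commute)
  have fr: "S \<subseteq> frontier L" if "S face_of L" "S \<noteq> L" for S L :: "(real ^ 'd) set"
    using face_of_disjoint_interior[OF that] face_of_imp_subset[OF that(1)] closure_subset[of L]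
    by (auto simp: frontier_def)
  have "K \<inter> K' \<subseteq> frontier K \<or> K \<inter> K' \<subseteq> frontier K'"
    using fr[OF face(1)] fr[OF face(2)] assms(3) by blast
  thus ?thesis using assms unfolding skeleton_def by blast
qed

lemma off_skeleton:
  assumes "x \<in> \<Omega>" "x \<notin> skeleton"
  obtains K where "K \<in> \<T>" "x \<in> interior K" "\<And>K'. K' \<in> \<T> \<Longrightarrow> x \<in> K' \<Longrightarrow> K' = K"
proof -
  obtain K where K: "K \<in> \<T>" "x \<in> K" using Union_mesh assms(1) closure_subset by blast
  have "x \<in> interior K" using K assms(2) closure_subset unfolding skeleton_def frontier_def by blast
  thus thesis using that K elements_Int_subset_skeleton assms(2) by blast
qed

lemma vertex_inj: "l < N \<Longrightarrow> m < N \<Longrightarrow> p l = p m \<longleftrightarrow> l = m"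
  using numbering by (auto simp: vertex_numbering_def bij_betw_def dest: inj_onD)

lemma vertex_surj:
  assumes "K \<in> \<T>" "v extreme_point_of K" obtains l where "l < N" "v = p l"
proof -
  have "v \<in> mesh_vertices \<T>" using assms by (auto simp: mesh_vertices_def)
  also have "mesh_vertices \<T> = p ` {..<N}" using numbering by (simp add: vertex_numbering_def bij_betw_def)
  finally show thesis using that by blast
qed

lemma interior_vertex: assumes "k < Nv" shows "p k \<in> \<Omega>"
proof -
  have k: "k < N" using assms Nv_le_N by simp
  hence "p k \<in> mesh_vertices \<T>" using numbering by (auto simp: vertex_numbering_def bij_betw_def)
  hence "p k \<in> closure \<Omega>" using element_subset unfolding mesh_vertices_def extreme_point_of_def by blast
  moreover have "p k \<notin> frontier \<Omega>" using numbering assms k by (auto simp: vertex_numbering_def)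
  ultimately show ?thesis by (simp add: frontier_def interior_open[OF open_domain])
qed

lemma basis_vertex: "k < N \<Longrightarrow> l < N \<Longrightarrow> \<phi> k (p l) = (if k = l then 1 else 0)"
  using basis by (simp add: P1_nodal_basis_def)

lemma basis_continuous: "k < N \<Longrightarrow> continuous_on (closure \<Omega>) (\<phi> k)"
  using basis by (simp add: P1_nodal_basis_def Union_mesh)

text \<open>The constant gradient of \<open>\<phi> k\<close> on the element \<open>K\<close>.\<close>

definition gradient :: "(real ^ 'd) set \<Rightarrow> nat \<Rightarrow> real ^ 'd" where
  "gradient K k = (SOME g. \<exists>\<alpha>. \<forall>x\<in>K. \<phi> k x = inner g x + \<alpha>)"

lemma basis_affine:
  assumes "K \<in> \<T>" "k < N" obtains \<alpha> where "\<And>x. x \<in> K \<Longrightarrow> \<phi> k x = inner (gradient K k) x + \<alpha>"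
proof -
  have "\<exists>g \<alpha>. \<forall>x\<in>K. \<phi> k x = inner g x + \<alpha>" using basis assms by (auto simp: P1_nodal_basis_def)
  from someI_ex[OF this] show thesis using that unfolding gradient_def by blast
qed

text \<open>An affine function is determined by its values at the vertices of a simplex, so on each element the
nodal basis functions are the barycentric coordinates, or zero if their node is not a vertex of the
element.\<close>

lemma barycentric:
  assumes "K \<in> \<T>" "x \<in> K"
  obtains C \<mu> where "finite C" "\<not> affine_dependent C" "K = convex hull C" "\<forall>v. v extreme_point_of K \<longleftrightarrow> v \<in> C"
    "\<forall>v\<in>C. 0 \<le> \<mu> v" "sum \<mu> C = 1" "x = (\<Sum>v\<in>C. \<mu> v *\<^sub>R v)"
    "\<forall>k<N. \<phi> k x = (if p k \<in> C then \<mu> (p k) else 0)"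
proof -
  obtain C where C: "finite C" "\<not> affine_dependent C" "K = convex hull C" "\<forall>v. v extreme_point_of K \<longleftrightarrow> v \<in> C"
    using element_simplex[OF assms(1)] by metis
  obtain \<mu> where \<mu>: "\<forall>v\<in>C. 0 \<le> \<mu> v" "sum \<mu> C = 1" "(\<Sum>v\<in>C. \<mu> v *\<^sub>R v) = x"
    using assms(2) unfolding C(3) convex_hull_finite[OF C(1)] by blast
  have "\<phi> k x = (if p k \<in> C then \<mu> (p k) else 0)" if k: "k < N" for k
  proof -
    obtain \<alpha> where \<alpha>: "\<And>x. x \<in> K \<Longrightarrow> \<phi> k x = inner (gradient K k) x + \<alpha>"
      using basis_affine[OF assms(1) k] by blast
    have "\<phi> k x = (\<Sum>v\<in>C. \<mu> v * inner (gradient K k) v) + \<alpha> * sum \<mu> C"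
      unfolding \<alpha>[OF assms(2)] \<mu>(2) using \<mu>(3) by (auto simp: inner_sum_right)
    also have "\<dots> = (\<Sum>v\<in>C. \<mu> v * \<phi> k v)"
      unfolding sum_distrib_left sum.distrib[symmetric]
    proof (intro sum.cong refl)
      fix v assume "v \<in> C"
      hence "v \<in> K" unfolding C(3) by (rule hull_inc)
      thus "\<mu> v * inner (gradient K k) v + \<alpha> * \<mu> v = \<mu> v * \<phi> k v" by (simp add: \<alpha> algebra_simps)
    qed
    also have "\<dots> = (\<Sum>v\<in>C. if p k = v then \<mu> v else 0)"
    proof (intro sum.cong refl)
      fix v assume "v \<in> C"
      then obtain l where "l < N" "v = p l" using C(4) vertex_surj[OF assms(1)] by blast
      thus "\<mu> v * \<phi> k v = (if p k = v then \<mu> v else 0)"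
        using basis_vertex[OF k] vertex_inj[OF k] by simp
    qed
    also have "\<dots> = (if p k \<in> C then \<mu> (p k) else 0)" using C(1) by simp
    finally show ?thesis .
  qed
  thus thesis using that[OF C, of \<mu>] \<mu> by blast
qed

lemma basis_nonneg: assumes "k < N" "x \<in> closure \<Omega>" shows "0 \<le> \<phi> k x"
proof -
  obtain K where "K \<in> \<T>" "x \<in> K" using assms(2) Union_mesh by blast
  then obtain C \<mu> where "\<And>v. v \<in> C \<Longrightarrow> 0 \<le> \<mu> v" "\<phi> k x = (if p k \<in> C then \<mu> (p k) else 0)"
    by (rule barycentric) (use assms(1) in blast)
  thus ?thesis by simp
qed

text \<open>Let \<open>h\<close> be the homothety \<open>y \<mapsto> p k + \<delta> (y - p k)\<close>.  On a simplex with vertex \<open>p k\<close> the homothety maps the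
part where \<open>\<phi> k > 0\<close> onto the part where \<open>\<phi> k > 1 - \<delta>\<close>.  For small \<open>\<delta>\<close> the image of the whole domain
lies in a ball around \<open>p k\<close> inside \<open>\<Omega>\<close>, where the set \<open>\<phi> k > 1 - \<delta>\<close> is open.  Its preimage under \<open>h\<close>
is an open neighbourhood of \<open>x\<close> within the closure of \<open>\<Omega>\<close>, so \<open>x\<close> is not a boundary point.\<close>

lemma basis_support:
  assumes k: "k < Nv" and x: "x \<in> closure \<Omega>" and pos: "\<phi> k x \<noteq> 0"
  shows "x \<in> \<Omega>"
proof -
  have kN: "k < N" using k Nv_le_N by simp
  obtain R where R: "\<And>y. y \<in> closure \<Omega> \<Longrightarrow> dist (p k) y \<le> R"
    using bounded_domain bounded_closure 
    by (metis bounded_any_center)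
  obtain \<epsilon> where \<epsilon>: "0 < \<epsilon>" "ball (p k) \<epsilon> \<subseteq> \<Omega>"
    using open_domain interior_vertex[OF k] openE by blast
  have R0: "0 \<le> R" using R[OF x] zero_le_dist order_trans by blast
  \<comment> \<open>Small enough that \<open>\<delta> R < \<epsilon>\<close>, and \<open>R + 1\<close> is positive even if \<open>R = 0\<close>.\<close>
  define \<delta> where "\<delta> = min (1/2) (\<epsilon> / (2 * (R + 1)))"
  have \<delta>: "0 < \<delta>" "\<delta> < 1" using \<epsilon>(1) R0 by (auto simp: \<delta>_def)
  have "\<delta> * R \<le> \<epsilon> / (2 * (R + 1)) * R" using R0 by (intro mult_right_mono) (auto simp: \<delta>_def)
  also have "\<dots> < \<epsilon>" using R0 \<epsilon>(1) by (simp add: field_simps add_nonneg_pos)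
  finally have \<delta>R: "\<delta> * R < \<epsilon>" .
  define h where "h y = p k + \<delta> *\<^sub>R (y - p k)" for y
  define W where "W = ball (p k) \<epsilon> \<inter> \<phi> k -` {1 - \<delta><..}"
  have "continuous_on (ball (p k) \<epsilon>) (\<phi> k)"
    by (rule continuous_on_subset[OF basis_continuous[OF kN] order_trans[OF \<epsilon>(2) closure_subset]])
  hence "open W" unfolding W_def by (rule continuous_open_preimage) auto
  hence openV: "open (h -` W)" unfolding h_def by (intro open_vimage continuous_intros)
  have "h -` W \<subseteq> closure \<Omega>"
  proof
    fix z assume "z \<in> h -` W"
    hence z: "h z \<in> \<Omega>" "1 - \<delta> < \<phi> k (h z)" using \<epsilon>(2) by (auto simp: W_def)
    obtain K where K: "K \<in> \<T>" "h z \<in> K" using z(1) closure_subset Union_mesh by blast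
    obtain C \<mu> where C: "finite C" "\<not> affine_dependent C" "K = convex hull C" "\<forall>v. v extreme_point_of K \<longleftrightarrow> v \<in> C"
      "\<forall>v\<in>C. 0 \<le> \<mu> v" "sum \<mu> C = 1" "h z = (\<Sum>v\<in>C. \<mu> v *\<^sub>R v)"
      "\<forall>k<N. \<phi> k (h z) = (if p k \<in> C then \<mu> (p k) else 0)"
      by (rule barycentric[OF K], rule that)
    have pC: "p k \<in> C" and \<mu>p: "1 - \<delta> < \<mu> (p k)"
      using z(2) C(8)[rule_format, OF kN] \<delta> by (auto split: if_splits)
    \<comment> \<open>Barycentric coordinates of \<open>z\<close>, obtained by inverting \<open>h\<close>; they are nonnegative since \<open>\<mu> (p k) > 1 - \<delta>\<close>.\<close>
    define \<nu> where "\<nu> v = (\<mu> v - (if p k = v then 1 - \<delta> else 0)) / \<delta>" for v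
    have "sum \<nu> C = (sum \<mu> C - (1 - \<delta>)) / \<delta>"
      unfolding \<nu>_def using C(1) pC by (simp add: sum_subtractf flip: sum_divide_distrib)
    hence "sum \<nu> C = 1" using C(6) \<delta> by simp
    moreover have "0 \<le> \<nu> v" if "v \<in> C" for v using C(5)[rule_format, OF that] \<mu>p \<delta> by (auto simp: \<nu>_def)
    moreover have "(\<Sum>v\<in>C. \<nu> v *\<^sub>R v) = z"
    proof -
      have "\<delta> *\<^sub>R (\<Sum>v\<in>C. \<nu> v *\<^sub>R v) = (\<Sum>v\<in>C. \<mu> v *\<^sub>R v - (if p k = v then (1 - \<delta>) *\<^sub>R v else 0))"
        unfolding scaleR_sum_right scaleR_scaleR
      proof (intro sum.cong refl)
        fix v
        have "\<delta> * \<nu> v = \<mu> v - (if p k = v then 1 - \<delta> else 0)" using \<delta> by (simp add: \<nu>_def)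
        thus "(\<delta> * \<nu> v) *\<^sub>R v = \<mu> v *\<^sub>R v - (if p k = v then (1 - \<delta>) *\<^sub>R v else 0)"
          by (simp add: scaleR_left_diff_distrib)
      qed
      also have "\<dots> = h z - (1 - \<delta>) *\<^sub>R p k" using C(1,7) pC by (simp add: sum_subtractf)
      also have "\<dots> = \<delta> *\<^sub>R z" by (simp add: h_def algebra_simps)
      finally show ?thesis using \<delta> by simp
    qed
    ultimately have "z \<in> K" unfolding C(3) convex_hull_finite[OF C(1)] by blast
    thus "z \<in> closure \<Omega>" using K(1) element_subset by blast
  qed
  hence "h -` W \<subseteq> interior (closure \<Omega>)" using openV by (rule interior_maximal)
  hence "h -` W \<subseteq> \<Omega>" by (simp only: interior_closure_domain)
  moreover have "h x \<in> W"
  proof -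
    obtain K where K: "K \<in> \<T>" "x \<in> K" using x unfolding Union_mesh[symmetric] by (rule UnionE)
    obtain C \<mu> where C: "finite C" "\<not> affine_dependent C" "K = convex hull C" "\<forall>v. v extreme_point_of K \<longleftrightarrow> v \<in> C"
      "\<forall>v\<in>C. 0 \<le> \<mu> v" "sum \<mu> C = 1" "x = (\<Sum>v\<in>C. \<mu> v *\<^sub>R v)"
      "\<forall>k<N. \<phi> k (x) = (if p k \<in> C then \<mu> (p k) else 0)"
      by (rule barycentric[OF K], rule that)
    have pK: "p k \<in> K" 
      unfolding C(3) by (rule hull_inc) (use pos C(8)[rule_format, OF kN] in \<open>simp split: if_splits\<close>)
    have hx: "h x = (1 - \<delta>) *\<^sub>R p k + \<delta> *\<^sub>R x" by (simp add: h_def algebra_simps)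
    have hK: "h x \<in> K" unfolding hx by (rule convexD[OF element_convex[OF K(1)] pK K(2)]) (use \<delta> in auto)
    obtain \<alpha> where \<alpha>: "\<And>x. x \<in> K \<Longrightarrow> \<phi> k x = inner (gradient K k) x + \<alpha>"
      using basis_affine[OF K(1) kN] by blast
    have "\<phi> k (h x) = (1 - \<delta>) * \<phi> k (p k) + \<delta> * \<phi> k x"
      unfolding \<alpha>[OF hK] \<alpha>[OF pK] \<alpha>[OF K(2)] unfolding hx inner_add_right inner_scaleR_right
      by (simp add: algebra_simps)
    moreover have "0 < \<phi> k x" using basis_nonneg[OF kN x] pos by simp
    ultimately have "1 - \<delta> < \<phi> k (h x)" using \<delta> basis_vertex[OF kN kN] by simp
    moreover have "dist (p k) (h x) = \<delta> * dist (p k) x"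
      using \<delta> by (simp add: h_def dist_norm norm_minus_commute)
    hence "dist (p k) (h x) < \<epsilon>"
      using mult_left_mono[OF R[OF x], of \<delta>] \<delta> \<delta>R by linarith
    ultimately show ?thesis by (simp add: W_def)
  qed
  ultimately show ?thesis by blast
qed

lemma basis_frontier: "k < Nv \<Longrightarrow> x \<in> frontier \<Omega> \<Longrightarrow> \<phi> k x = 0"
  using basis_support[of k x] by (auto simp: frontier_def interior_open[OF open_domain])

text \<open>If all interior hat functions vanish at a point of an element, then its barycentric coordinates are
concentrated on the vertices of that element that lie on the boundary, so the point belongs to the
face that they span.\<close>

lemma basis_pos_off_boundary_simplices:
  assumes "x \<in> \<Omega> - boundary_simplices \<Omega> \<T>"
  shows "\<exists>k<Nv. 0 < \<phi> k x"
proof (rule ccontr)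
  assume "\<not> (\<exists>k<Nv. 0 < \<phi> k x)"
  hence not: "\<not> 0 < \<phi> k x" if "k < Nv" for k using that by blast
  have x: "x \<in> closure \<Omega>" using assms closure_subset by blast
  then obtain K where K: "K \<in> \<T>" "x \<in> K" using Union_mesh by blast
  obtain C \<mu> where C: "finite C" "\<not> affine_dependent C" "K = convex hull C" "\<forall>v. v extreme_point_of K \<longleftrightarrow> v \<in> C"
    "\<forall>v\<in>C. 0 \<le> \<mu> v" "sum \<mu> C = 1" "x = (\<Sum>v\<in>C. \<mu> v *\<^sub>R v)"
    "\<forall>k<N. \<phi> k x = (if p k \<in> C then \<mu> (p k) else 0)"
    by (rule barycentric[OF K], rule that)
  define C' where "C' = C \<inter> frontier \<Omega>"
  have 0: "\<mu> v = 0" if v: "v \<in> C - C'" for v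
  proof -
    obtain l where l: "l < N" "v = p l" using v C(4) vertex_surj[OF K(1)] by blast
    have "l < Nv" using v l numbering by (auto simp: C'_def vertex_numbering_def)
    hence "\<phi> l x = 0" using not basis_nonneg[OF l(1) x] by force
    thus ?thesis using C(8)[rule_format, OF l(1)] v l by auto
  qed
  have "sum \<mu> C' = 1" "(\<Sum>v\<in>C'. \<mu> v *\<^sub>R v) = x"
    using C(1,6,7) 0 sum.mono_neutral_left[of C C' \<mu>] sum.mono_neutral_left[of C C' "\<lambda>v. \<mu> v *\<^sub>R v"]
    by (auto simp: C'_def)
  moreover have fin: "finite C'" using C(1) by (simp add: C'_def)
  ultimately have "x \<in> convex hull C'"
    unfolding convex_hull_finite[OF fin] using C(5) by (auto simp: C'_def)
  moreover have "(convex hull C') face_of K"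
    unfolding C(3) using face_of_convex_hull_affine_independent[OF C(2)] C'_def by blast
  moreover have "v \<in> frontier \<Omega>" if "v extreme_point_of (convex hull C')" for v
    using extreme_point_of_convex_hull[OF that] by (simp add: C'_def)
  ultimately have "x \<in> boundary_simplices \<Omega> \<T>" unfolding boundary_simplices_def using K(1) by blast
  thus False using assms by blast
qed

lemma Vh_frontier:
  fixes a :: "nat \<Rightarrow> 'a::real_vector"
  shows "x \<in> frontier \<Omega> \<Longrightarrow> (\<Sum>k<Nv. \<phi> k x *\<^sub>R a k) = 0"
  by (intro sum.neutral ballI) (simp add: basis_frontier)

lemma Vh_vertex:
  fixes a :: "nat \<Rightarrow> 'a::real_vector"
  shows "l < Nv \<Longrightarrow> (\<Sum>k<Nv. \<phi> k (p l) *\<^sub>R a k) = a l"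
proof -
  assume l: "l < Nv"
  have "(\<Sum>k<Nv. \<phi> k (p l) *\<^sub>R a k) = (\<Sum>k<Nv. if k = l then a l else 0)"
    using l Nv_le_N by (intro sum.cong) (auto simp: basis_vertex)
  thus ?thesis using l by simp
qed

lemma Vh_has_derivative:
  fixes a :: "nat \<Rightarrow> 'a::real_normed_vector"
  assumes "K \<in> \<T>" "x \<in> interior K"
  shows "((\<lambda>x. \<Sum>k<Nv. \<phi> k x *\<^sub>R a k) has_derivative (\<lambda>h. \<Sum>k<Nv. inner (gradient K k) h *\<^sub>R a k)) (at x)"
proof (intro has_derivative_sum has_derivative_scaleR_left)
  fix k assume "k \<in> {..<Nv}"
  hence k: "k < N" using Nv_le_N by simp
  obtain \<alpha> where \<alpha>: "\<And>x. x \<in> K \<Longrightarrow> \<phi> k x = inner (gradient K k) x + \<alpha>"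
    using basis_affine[OF assms(1) k] by blast
  show "(\<phi> k has_derivative inner (gradient K k)) (at x)"
    by (rule has_derivative_affine_on[OF assms(2) bounded_linear_inner_right \<alpha>])
qed

lemma grad_Vh:
  fixes a :: "nat \<Rightarrow> 'a::real_normed_vector"
  assumes "K \<in> \<T>" "x \<in> interior K"
  shows "grad (\<lambda>x. \<Sum>k<Nv. \<phi> k x *\<^sub>R a k) x = (\<chi> i. \<Sum>k<Nv. vec_nth (gradient K k) i *\<^sub>R a k)"
  using grad_eqI[OF Vh_has_derivative[OF assms], of a] by (simp add: inner_axis)

lemma grad_basis: "K \<in> \<T> \<Longrightarrow> x \<in> interior K \<Longrightarrow> k < Nv \<Longrightarrow> grad (\<phi> k) x = gradient K k"
proof -
  assume a: "K \<in> \<T>" "x \<in> interior K" "k < Nv"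
  hence k: "k < N" using Nv_le_N by simp
  obtain \<alpha> where \<alpha>: "\<And>x. x \<in> K \<Longrightarrow> \<phi> k x = inner (gradient K k) x + \<alpha>"
    using basis_affine[OF a(1) k] by blast
  have "(\<phi> k has_derivative inner (gradient K k)) (at x)"
    by (rule has_derivative_affine_on[OF a(2) bounded_linear_inner_right \<alpha>])
  from grad_eqI[OF this] show ?thesis by (simp add: inner_axis vec_eq_iff)
qed

lemma Vh_continuous:
  fixes a :: "nat \<Rightarrow> 'a::real_normed_vector"
  shows "continuous_on (closure \<Omega>) (\<lambda>x. \<Sum>k<Nv. \<phi> k x *\<^sub>R a k)"
proof (intro continuous_on_sum continuous_on_scaleR continuous_on_const)
  fix k assume "k \<in> {..<Nv}"
  thus "continuous_on (closure \<Omega>) (\<phi> k)" using Nv_le_N by (intro basis_continuous) simp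
qed

text \<open>With vanishing gradient on every element \<open>u\<close> takes finitely many values, so by continuity it is
constant on every ball in \<open>\<Omega>\<close>.  A nonzero level set of \<open>u\<close> avoids the boundary and is
therefore both open and closed; being bounded, it must be empty.\<close>

lemma zero_gradient_imp_zero:
  fixes a :: "nat \<Rightarrow> real"
  assumes "\<And>K. K \<in> \<T> \<Longrightarrow> (\<Sum>k<Nv. a k *\<^sub>R gradient K k) = 0" and l: "l < Nv"
  shows "a l = 0"
proof (rule ccontr)
  assume ne: "a l \<noteq> 0"
  define u where "u x = (\<Sum>k<Nv. \<phi> k x *\<^sub>R a k)" for x
  have cont: "continuous_on (closure \<Omega>) u" unfolding u_def by (rule Vh_continuous)
  have "\<exists>c. \<forall>x\<in>K. u x = c" if K: "K \<in> \<T>" for K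
  proof -
    have "\<exists>\<alpha>. \<forall>x\<in>K. \<phi> k x = inner (gradient K k) x + \<alpha>" if "k < Nv" for k
      using basis_affine[OF K] that Nv_le_N by (metis order_less_le_trans)
    then obtain \<alpha> where \<alpha>: "\<And>k x. k < Nv \<Longrightarrow> x \<in> K \<Longrightarrow> \<phi> k x = inner (gradient K k) x + \<alpha> k" by metis
    have "u x = (\<Sum>k<Nv. \<alpha> k * a k)" if "x \<in> K" for x
    proof -
      have "u x = inner (\<Sum>k<Nv. a k *\<^sub>R gradient K k) x + (\<Sum>k<Nv. \<alpha> k * a k)"
        using that unfolding u_def inner_sum_left sum.distrib[symmetric]
        by (intro sum.cong) (auto simp: \<alpha> algebra_simps)
      thus ?thesis by (simp add: assms(1)[OF K])
    qed
    thus ?thesis by blast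
  qed
  then obtain c where c: "\<And>K x. K \<in> \<T> \<Longrightarrow> x \<in> K \<Longrightarrow> u x = c K" by metis
  have fin: "finite (u ` closure \<Omega>)"
    by (rule finite_subset[of _ "c ` \<T>"]) (use c finite_mesh in \<open>auto simp flip: Union_mesh\<close>)
  define E where "E = {x \<in> closure \<Omega>. u x = a l}"
  have "compact (closure \<Omega>)" using bounded_domain by simp
  have E\<Omega>: "E \<subseteq> \<Omega>"
  proof
    fix x assume "x \<in> E"
    hence "x \<in> closure \<Omega>" "u x \<noteq> 0" using ne by (auto simp: E_def)
    thus "x \<in> \<Omega>" using Vh_frontier[of x a] unfolding u_def frontier_def interior_open[OF open_domain] by blast
  qed
  have closed: "closed E" unfolding E_def
    using continuous_closed_preimage_constant[OF cont closed_closure, of "a l"] by simp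
  have "open E"
    unfolding open_contains_ball
  proof
    fix x assume x: "x \<in> E"
    then obtain e where e: "0 < e" "ball x e \<subseteq> \<Omega>" using E\<Omega> open_domain openE by blast
    have "u constant_on ball x e"
    proof (rule continuous_finite_range_constant)
      have "ball x e \<subseteq> closure \<Omega>" using e(2) closure_subset by (rule order_trans)
      thus "continuous_on (ball x e) u" "finite (u ` ball x e)"
        using continuous_on_subset[OF cont] finite_subset[OF image_mono fin] by blast+
    qed simp
    hence "u y = a l" if "y \<in> ball x e" for y
      using that x centre_in_ball[of x e] e(1) unfolding constant_on_def E_def by auto
    hence "ball x e \<subseteq> E" using e(2) closure_subset[of \<Omega>] unfolding E_def by blast
    thus "\<exists>e>0. ball x e \<subseteq> E" using e(1) by blast
  qed
  moreover have "p l \<in> E"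
    using subsetD[OF closure_subset interior_vertex[OF l]] Vh_vertex[OF l, of a] by (simp add: E_def u_def)
  ultimately have "E = UNIV" using closed clopen[of E] by blast
  moreover have "bounded E" using bounded_domain E\<Omega> by (rule bounded_subset)
  ultimately show False by simp
qed

end

section \<open>Integrals of piecewise continuous functions\<close>

lemma set_integrable_continuous_compact:
  fixes f :: "'a::euclidean_space \<Rightarrow> 'b::euclidean_space"
  assumes "compact K" "continuous_on K f" shows "set_integrable lebesgue K f"
  unfolding set_integrable_def
  using borel_integrable_compact[OF assms] by (simp add: integrable_completion borel_measurable_integrable)

lemma set_integral_nonneg: "(\<And>x. x \<in> S \<Longrightarrow> 0 \<le> f x) \<Longrightarrow> 0 \<le> (LINT x:S|M. f x :: real)"
  unfolding set_lebesgue_integral_def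
  by (rule Bochner_Integration.integral_nonneg) (simp add: indicator_def)

lemma set_integral_sum:
  fixes f :: "'i \<Rightarrow> 'a \<Rightarrow> 'b::{banach, second_countable_topology}"
  assumes "\<And>i. i \<in> I \<Longrightarrow> set_integrable M A (f i)"
  shows "(LINT x:A|M. (\<Sum>i\<in>I. f i x)) = (\<Sum>i\<in>I. LINT x:A|M. f i x)"
  using assms unfolding set_lebesgue_integral_def set_integrable_def scaleR_sum_right
  by (rule Bochner_Integration.integral_sum)

text \<open>The open set where \<open>f > 0\<close> is nonempty and so not negligible.\<close>

lemma set_integral_pos:
  fixes f :: "'a::euclidean_space \<Rightarrow> real"
  assumes S: "open S" and cont: "continuous_on S f" and nn: "\<And>x. x \<in> S \<Longrightarrow> 0 \<le> f x"
    and pos: "x0 \<in> S" "0 < f x0" and int: "set_integrable lebesgue S f"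
  shows "0 < (LINT x:S|lebesgue. f x)"
proof -
  let ?g = "\<lambda>x. indicator S x *\<^sub>R f x"
  have g0: "0 \<le> ?g x" for x using nn by (simp add: indicator_def)
  have int': "integrable lebesgue ?g" using int unfolding set_integrable_def .
  have "0 \<le> integral\<^sup>L lebesgue ?g" using g0 by simp
  moreover have "integral\<^sup>L lebesgue ?g \<noteq> 0"
  proof
    assume "integral\<^sup>L lebesgue ?g = 0"
    hence ae: "AE x in lebesgue. ?g x = 0"
      using integral_nonneg_eq_0_iff_AE[OF int'] g0 by simp
    define U where "U = S \<inter> f -` {0<..}"
    have "open U" unfolding U_def using cont S by (rule continuous_open_preimage) simp
    moreover have "x0 \<in> U" using pos by (simp add: U_def)
    moreover have "negligible U"
    proof -
      obtain E where E: "{x \<in> space lebesgue. \<not> ?g x = 0} \<subseteq> E" "emeasure lebesgue E = 0" "E \<in> sets lebesgue"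
        using ae by (rule AE_E)
      have "negligible E" using E(2,3) by (auto simp: negligible_iff_null_sets null_sets_def)
      moreover have "U \<subseteq> E" using E(1) by (auto simp: U_def)
      ultimately show ?thesis by (rule negligible_subset)
    qed
    ultimately show False using open_not_negligible by blast
  qed
  ultimately show ?thesis unfolding set_lebesgue_integral_def by simp
qed

context p1_mesh
begin

text \<open>Continuous up to the boundary of each element, with values on the element boundaries
disregarded.  All integrands of the discrete problem have this property, and it is stable
under the algebraic operations; this settles measurability and integrability once and for all.\<close>

definition pw_cont :: "(real ^ 'd \<Rightarrow> 'b::euclidean_space) \<Rightarrow> bool" where
  "pw_cont f \<longleftrightarrow> (\<forall>K\<in>\<T>. \<exists>g. continuous_on K g \<and> (\<forall>x\<in>interior K. f x = g x))"

lemma pw_contI: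
  assumes "\<And>K. K \<in> \<T> \<Longrightarrow> continuous_on K (g K)" "\<And>K x. K \<in> \<T> \<Longrightarrow> x \<in> interior K \<Longrightarrow> f x = g K x"
  shows "pw_cont f"
  unfolding pw_cont_def using assms by blast

lemma pw_cont_continuous: "continuous_on (closure \<Omega>) f \<Longrightarrow> pw_cont f"
  by (rule pw_contI[where g = "\<lambda>_. f"]) (auto intro: continuous_on_subset[OF _ element_subset])

lemma pw_cont_cong:
  assumes "pw_cont f" and eq: "\<And>K x. K \<in> \<T> \<Longrightarrow> x \<in> interior K \<Longrightarrow> f x = g x" shows "pw_cont g"
  using assms(1) unfolding pw_cont_def by (metis eq)

lemma pw_cont_bilinear:
  fixes h :: "'a::euclidean_space \<Rightarrow> 'b::euclidean_space \<Rightarrow> 'c::euclidean_space"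
  assumes h: "bounded_bilinear h" and f: "pw_cont f" and g: "pw_cont g"
  shows "pw_cont (\<lambda>x. h (f x) (g x))"
  unfolding pw_cont_def
proof
  fix K assume K: "K \<in> \<T>"
  obtain f' g' where f': "continuous_on K f'" "\<forall>x\<in>interior K. f x = f' x"
    and g': "continuous_on K g'" "\<forall>x\<in>interior K. g x = g' x"
    using f g K unfolding pw_cont_def by meson
  have "continuous_on K (\<lambda>x. h (f' x) (g' x))"
    by (rule bounded_bilinear.continuous_on[OF h f'(1) g'(1)])
  thus "\<exists>k. continuous_on K k \<and> (\<forall>x\<in>interior K. h (f x) (g x) = k x)"
    using f'(2) g'(2) by (intro exI[of _ "\<lambda>x. h (f' x) (g' x)"]) simp
qed

lemma pw_cont_linear:
  fixes h :: "'a::euclidean_space \<Rightarrow> 'b::euclidean_space"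
  assumes h: "bounded_linear h" and f: "pw_cont f"
  shows "pw_cont (\<lambda>x. h (f x))"
  unfolding pw_cont_def
proof
  fix K assume K: "K \<in> \<T>"
  obtain f' where f': "continuous_on K f'" "\<forall>x\<in>interior K. f x = f' x"
    using f K unfolding pw_cont_def by meson
  have "continuous_on K (\<lambda>x. h (f' x))" by (rule bounded_linear.continuous_on[OF h f'(1)])
  thus "\<exists>k. continuous_on K k \<and> (\<forall>x\<in>interior K. h (f x) = k x)"
    using f'(2) by (intro exI[of _ "\<lambda>x. h (f' x)"]) simp
qed

lemma pw_cont_add:
  assumes f: "pw_cont f" and g: "pw_cont g" shows "pw_cont (\<lambda>x. f x + g x)"
  unfolding pw_cont_def
proof
  fix K assume K: "K \<in> \<T>"
  obtain f' g' where f': "continuous_on K f'" "\<forall>x\<in>interior K. f x = f' x"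
    and g': "continuous_on K g'" "\<forall>x\<in>interior K. g x = g' x"
    using f g K unfolding pw_cont_def by meson
  have "continuous_on K (\<lambda>x. f' x + g' x)" using f'(1) g'(1) by (rule continuous_on_add)
  thus "\<exists>k. continuous_on K k \<and> (\<forall>x\<in>interior K. f x + g x = k x)"
    using f'(2) g'(2) by (intro exI[of _ "\<lambda>x. f' x + g' x"]) simp
qed

lemma pw_cont_const: "pw_cont (\<lambda>x. k)"
  by (intro pw_cont_continuous continuous_on_const)

lemma pw_cont_sum: "(\<And>i. i \<in> I \<Longrightarrow> pw_cont (f i)) \<Longrightarrow> pw_cont (\<lambda>x. \<Sum>i\<in>I. f i x)"
  by (induction I rule: infinite_finite_induct) (auto simp: pw_cont_const pw_cont_add)

lemmas pw_cont_mult = pw_cont_bilinear[OF bounded_bilinear_mult]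
lemmas pw_cont_scaleR = pw_cont_bilinear[OF bounded_bilinear_scaleR]
lemmas pw_cont_inner = pw_cont_bilinear[OF bounded_bilinear_inner]
lemmas pw_cont_nth = pw_cont_linear[OF bounded_linear_vec_nth]
lemmas pw_cont_cnj = pw_cont_linear[OF bounded_linear_cnj]
lemmas pw_cont_of_real = pw_cont_linear[OF bounded_linear_of_real]

text \<open>On each element \<open>f\<close> agrees off the negligible frontier with a function that is continuous on a compact
set.  The elements overlap in null sets, and their union differs from \<open>\<Omega>\<close> by the boundary, which is a
null set.\<close>

lemma pw_cont_integral:
  fixes f :: "real ^ 'd \<Rightarrow> 'b::euclidean_space"
  assumes "pw_cont f"
  shows pw_cont_element_integrable: "\<And>K. K \<in> \<T> \<Longrightarrow> set_integrable lebesgue K f"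
    and pw_cont_integrable: "set_integrable lebesgue \<Omega> f"
    and pw_cont_integral_sum: "(LINT x:\<Omega>|lebesgue. f x) = (\<Sum>K\<in>\<T>. LINT x:K|lebesgue. f x)"
proof -
  show el: "set_integrable lebesgue K f" if K: "K \<in> \<T>" for K
  proof -
    obtain g where g: "continuous_on K g" "\<forall>x\<in>interior K. f x = g x"
      using assms K unfolding pw_cont_def by blast
    have "negligible (frontier K)" using negligible_convex_frontier element_convex[OF K] by blast
    moreover have "f x = g x" if "x \<in> K - frontier K" for x
      using that g(2) closure_subset[of K] by (auto simp: frontier_def)
    ultimately show ?thesis
      using absolutely_integrable_spike[OF set_integrable_continuous_compact[OF element_compact[OF K] g(1)]]
      by blast
  qed
  have "set_integrable lebesgue (\<Union>K\<in>\<T>. K) f"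
    using finite_mesh el fmeasurableD[OF lmeasurable_compact[OF element_compact]]
    by (rule set_integrable_UN)
  hence cl: "set_integrable lebesgue (closure \<Omega>) f" by (simp add: Union_mesh)
  thus om: "set_integrable lebesgue \<Omega> f"
    by (rule set_integrable_subset) (use open_domain closure_subset in \<open>auto simp: sets_completionI_sets\<close>)
  have "(f has_integral (\<Sum>K\<in>\<T>. integral K f)) (\<Union>\<T>)"
  proof (rule has_integral_Union[OF finite_mesh])
    show "(f has_integral integral K f) K" if "K \<in> \<T>" for K
      using set_lebesgue_integral_eq_integral(1)[OF el[OF that]] by (rule integrable_integral)
    show "pairwise (\<lambda>K K'. negligible (K \<inter> K')) \<T>"
      using negligible_subset[OF negligible_skeleton elements_Int_subset_skeleton]
      by (simp add: pairwise_def)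
  qed
  hence "integral (closure \<Omega>) f = (\<Sum>K\<in>\<T>. LINT x:K|lebesgue. f x)"
    using set_lebesgue_integral_eq_integral(2)[OF el] by (simp add: Union_mesh integral_unique)
  moreover have "integral (closure \<Omega>) f = integral \<Omega> f"
  proof (rule integral_spike_set)
    have "closure \<Omega> - \<Omega> \<subseteq> frontier \<Omega>" using open_domain by (simp add: frontier_def interior_open)
    hence "negligible (closure \<Omega> - \<Omega>)" using negligible_frontier_domain negligible_subset by blast
    thus "negligible {x \<in> closure \<Omega> - \<Omega>. f x \<noteq> 0}" by (rule negligible_subset) blast
    have e: "{x \<in> \<Omega> - closure \<Omega>. f x \<noteq> 0} = {}" using closure_subset by blast
    show "negligible {x \<in> \<Omega> - closure \<Omega>. f x \<noteq> 0}" unfolding e by (rule negligible_empty)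
  qed
  ultimately show "(LINT x:\<Omega>|lebesgue. f x) = (\<Sum>K\<in>\<T>. LINT x:K|lebesgue. f x)"
    using set_lebesgue_integral_eq_integral(2)[OF om] by simp
qed

lemma pw_cont_element_integral_cong:
  fixes f :: "real ^ 'd \<Rightarrow> 'b::euclidean_space"
  assumes f: "pw_cont f" and K: "K \<in> \<T>" and eq: "\<And>x. x \<in> interior K \<Longrightarrow> f x = g x"
    and g: "pw_cont g"
  shows "(LINT x:K|lebesgue. f x) = (LINT x:K|lebesgue. g x)"
proof -
  have "negligible (frontier K)" using negligible_convex_frontier element_convex[OF K] by blast
  moreover have "g x = f x" if "x \<in> K - frontier K" for x
    using that eq closure_subset[of K] by (auto simp: frontier_def)
  ultimately have "integral K f = integral K g" by (rule integral_spike)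
  thus ?thesis
    using set_lebesgue_integral_eq_integral(2)[OF pw_cont_element_integrable[OF f K]]
      set_lebesgue_integral_eq_integral(2)[OF pw_cont_element_integrable[OF g K]] by simp
qed

lemma pw_cont_integral_cong:
  fixes f :: "real ^ 'd \<Rightarrow> 'b::euclidean_space"
  assumes f: "pw_cont f" and eq: "\<And>K x. K \<in> \<T> \<Longrightarrow> x \<in> interior K \<Longrightarrow> f x = g x"
  shows "(LINT x:\<Omega>|lebesgue. f x) = (LINT x:\<Omega>|lebesgue. g x)"
proof -
  have g: "pw_cont g" using f eq by (rule pw_cont_cong)
  show ?thesis unfolding pw_cont_integral_sum[OF f] pw_cont_integral_sum[OF g]
    using pw_cont_element_integral_cong[OF f _ _ g] eq by (intro sum.cong) auto
qed

lemma pw_cont_grad_Vh: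
  fixes a :: "nat \<Rightarrow> 'a::euclidean_space"
  shows "pw_cont (\<lambda>x. vec_nth (grad (\<lambda>x. \<Sum>k<Nv. \<phi> k x *\<^sub>R a k) x) i)"
  by (rule pw_contI[where g = "\<lambda>K x. \<Sum>k<Nv. vec_nth (gradient K k) i *\<^sub>R a k"]) (auto simp: grad_Vh)

lemma pw_cont_grad_Vh_real:
  fixes a :: "nat \<Rightarrow> real"
  shows "pw_cont (grad (\<lambda>x. \<Sum>k<Nv. \<phi> k x *\<^sub>R a k))"
proof (rule pw_contI)
  show "grad (\<lambda>x. \<Sum>k<Nv. \<phi> k x *\<^sub>R a k) x = (\<Sum>k<Nv. a k *\<^sub>R gradient K k)"
    if "K \<in> \<T>" "x \<in> interior K" for K x
    unfolding grad_Vh[OF that] by (simp add: Finite_Cartesian_Product.vec_eq_iff mult.commute)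
qed (rule continuous_on_const)

lemma pw_cont_grad_basis: "k < Nv \<Longrightarrow> pw_cont (grad (\<phi> k))"
  by (rule pw_contI[where g = "\<lambda>K x. gradient K k"]) (auto simp: grad_basis)

lemma pw_cont_basis: "k < Nv \<Longrightarrow> pw_cont (\<phi> k)"
  using Nv_le_N by (intro pw_cont_continuous basis_continuous) simp

lemma pw_cont_Vh:
  fixes a :: "nat \<Rightarrow> 'a::euclidean_space"
  shows "pw_cont (\<lambda>x. \<Sum>k<Nv. \<phi> k x *\<^sub>R a k)"
  by (intro pw_cont_continuous Vh_continuous)

end

section \<open>Integration by parts\<close>

lemma lipschitz_on_mult_bounded:
  fixes f g :: "'a::metric_space \<Rightarrow> real"
  assumes "L-lipschitz_on X f" "M-lipschitz_on X g"
    and "\<And>x. x \<in> X \<Longrightarrow> \<bar>f x\<bar> \<le> A" "\<And>x. x \<in> X \<Longrightarrow> \<bar>g x\<bar> \<le> B" "0 \<le> A" "0 \<le> B"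
  shows "(A * M + B * L)-lipschitz_on X (\<lambda>x. f x * g x)"
proof (rule lipschitz_onI)
  fix x y assume xy: "x \<in> X" "y \<in> X"
  have "\<bar>f x * g x - f y * g y\<bar> = \<bar>f x * (g x - g y) + g y * (f x - f y)\<bar>" by (simp add: algebra_simps)
  also have "\<dots> \<le> \<bar>f x\<bar> * \<bar>g x - g y\<bar> + \<bar>g y\<bar> * \<bar>f x - f y\<bar>"
    by (metis abs_mult abs_triangle_ineq)
  also have "\<dots> \<le> A * (M * dist x y) + B * (L * dist x y)"
    using lipschitz_onD[OF assms(1) xy] lipschitz_onD[OF assms(2) xy] assms(3,4)[OF xy(1)] assms(4)[OF xy(2)] assms(5,6)
    by (intro add_mono mult_mono) (auto simp: dist_real_def)
  also have "\<dots> = (A * M + B * L) * dist x y" by (simp add: algebra_simps)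
  finally show "dist (f x * g x) (f y * g y) \<le> (A * M + B * L) * dist x y"
    by (simp add: dist_real_def)
next
  show "0 \<le> A * M + B * L" using assms lipschitz_on_nonneg by (metis add_nonneg_nonneg mult_nonneg_nonneg)
qed

text \<open>A function that is Lipschitz on each of finitely many closed sets covering the space need
not be Lipschitz on a nonconvex union of some of them, but on the whole space it is: a segment
between two points is cut by the cover into closed subsets of an interval.\<close>

lemma lipschitz_glue:
  fixes F :: "'a::real_normed_vector \<Rightarrow> 'b::metric_space"
  assumes "finite \<C>" "\<And>S. S \<in> \<C> \<Longrightarrow> closed S" "\<Union>\<C> = UNIV" "\<And>S. S \<in> \<C> \<Longrightarrow> \<exists>L. L-lipschitz_on S F"
  shows "\<exists>L. L-lipschitz_on UNIV F"
proof -
  obtain l where l: "\<And>S. S \<in> \<C> \<Longrightarrow> (l S)-lipschitz_on S F" using assms(4) by metis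
  define L where "L = (\<Sum>S\<in>\<C>. l S)"
  have l0: "0 \<le> l S" if "S \<in> \<C>" for S using l[OF that] by (rule lipschitz_on_nonneg)
  hence L0: "0 \<le> L" unfolding L_def by (rule sum_nonneg)
  have L: "L-lipschitz_on S F" if "S \<in> \<C>" for S
    using l[OF that] by (rule lipschitz_on_le) (use assms(1) l0 that in \<open>auto simp: L_def intro: member_le_sum\<close>)
  have "dist (F x) (F y) \<le> L * dist x y" for x y
  proof -
    define h where "h t = x + t *\<^sub>R (y - x)" for t :: real
    have "(L * norm (y - x))-lipschitz_on {0..1} (F \<circ> h)"
    proof (rule lipschitz_on_closed_Union[where I = \<C> and U = "\<lambda>S. h -` S"])
      fix S assume S: "S \<in> \<C>"
      show "(L * norm (y - x))-lipschitz_on (h -` S) (F \<circ> h)"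
      proof (rule lipschitz_onI)
        fix s t assume "s \<in> h -` S" "t \<in> h -` S"
        hence "dist (F (h s)) (F (h t)) \<le> L * dist (h s) (h t)" by (intro lipschitz_onD[OF L[OF S]]) auto
        also have "h s - h t = (s - t) *\<^sub>R (y - x)" by (simp add: h_def algebra_simps)
        hence "dist (h s) (h t) = norm (y - x) * dist s t" by (simp add: dist_norm)
        finally show "dist ((F \<circ> h) s) ((F \<circ> h) t) \<le> L * norm (y - x) * dist s t" by (simp add: mult.assoc)
      qed (use L0 in simp)
      show "closed (h -` S)" using assms(2)[OF S] unfolding h_def
        by (intro closed_vimage continuous_intros)
    qed (use assms(1,3) L0 in auto)
    hence "dist ((F \<circ> h) 0) ((F \<circ> h) 1) \<le> L * norm (y - x) * dist 0 (1::real)"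
      by (rule lipschitz_onD) auto
    thus ?thesis by (simp add: h_def dist_norm norm_minus_commute)
  qed
  thus ?thesis using L0 by (intro exI[of _ L] lipschitz_onI) auto
qed

text \<open>The difference quotients of \<open>F\<close> in the direction \<open>e\<close> have integral zero because Lebesgue measure is
invariant under translations.  They are bounded by the Lipschitz constant times the norm of \<open>e\<close>, they
vanish outside a fixed ball, and they converge to \<open>F'\<close> almost everywhere.\<close>

lemma lipschitz_integral_directional_derivative:
  fixes F :: "'a::euclidean_space \<Rightarrow> real"
  assumes lip: "L-lipschitz_on UNIV F" and supp: "\<And>x. F x \<noteq> 0 \<Longrightarrow> norm x \<le> r"
    and N: "negligible N" and der: "\<And>x. x \<notin> N \<Longrightarrow> ((\<lambda>t. F (x + t *\<^sub>R e)) has_real_derivative F' x) (at 0)"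
    and meas: "F' \<in> borel_measurable lebesgue"
  shows "integral\<^sup>L lebesgue F' = 0"
proof -
  have contF: "continuous_on UNIV F" using lip by (rule lipschitz_on_continuous_on)
  hence F[measurable]: "F \<in> borel_measurable borel" by (rule borel_measurable_continuous_onI)
  define t where "t n = 1 / real (Suc n)" for n
  have t: "0 < t n" "t n \<le> 1" for n by (auto simp: t_def)
  define q where "q n x = (F (x + t n *\<^sub>R e) - F x) / t n" for n x
  \<comment> \<open>Step sizes are at most 1, so a difference quotient at a point outside this ball sees only zeros of \<open>F\<close>.\<close>
  define R where "R = r + norm e"
  have intF: "integrable lborel F"
  proof -
    have "integrable lborel (\<lambda>x. indicator (cball 0 r) x *\<^sub>R F x)"
      by (rule borel_integrable_compact) (use contF in \<open>auto intro: continuous_on_subset\<close>)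
    also have "(\<lambda>x. indicator (cball 0 r) x *\<^sub>R F x) = F"
      using supp by (fastforce simp: indicator_def)
    finally show ?thesis .
  qed
  have shift: "integrable lborel (\<lambda>x. F (x + c))" "integral\<^sup>L lborel (\<lambda>x. F (x + c)) = integral\<^sup>L lborel F" for c
  proof -
    have "integrable (distr lborel borel ((+) c)) F" using intF by (simp add: lborel_distr_plus)
    hence "integrable lborel (\<lambda>x. F (c + x))" by (subst (asm) integrable_distr_eq) auto
    thus "integrable lborel (\<lambda>x. F (x + c))" by (simp add: add.commute)
    have "integral\<^sup>L lborel F = integral\<^sup>L (distr lborel borel ((+) c)) F" by (simp add: lborel_distr_plus)
    also have "\<dots> = integral\<^sup>L lborel (\<lambda>x. F (c + x))" by (rule integral_distr) auto
    finally show "integral\<^sup>L lborel (\<lambda>x. F (x + c)) = integral\<^sup>L lborel F" by (simp add: add.commute)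
  qed
  have q0: "integral\<^sup>L lebesgue (q n) = 0" for n
  proof -
    have "integral\<^sup>L lebesgue (q n) = integral\<^sup>L lborel (q n)"
      by (rule integral_completion) (unfold q_def, measurable)
    also have "\<dots> = (integral\<^sup>L lborel (\<lambda>x. F (x + t n *\<^sub>R e)) - integral\<^sup>L lborel F) / t n"
      unfolding q_def using shift intF by simp
    finally show ?thesis using shift by simp
  qed
  have "(\<lambda>n. integral\<^sup>L lebesgue (q n)) \<longlonglongrightarrow> integral\<^sup>L lebesgue F'"
  proof (rule integral_dominated_convergence[where w = "\<lambda>x. indicator (cball 0 R) x *\<^sub>R (L * norm e)"])
    show "q n \<in> borel_measurable lebesgue" for n
    proof -
      have "q n \<in> borel_measurable borel" unfolding q_def by measurable
      thus ?thesis by (intro measurable_completion) simp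
    qed
    have "set_integrable lebesgue (cball 0 R) (\<lambda>x::'a. L * norm e)"
      by (rule set_integrable_continuous_compact) auto
    thus "integrable lebesgue (\<lambda>x::'a. indicator (cball 0 R) x *\<^sub>R (L * norm e))"
      unfolding set_integrable_def .
    show "AE x in lebesgue. (\<lambda>n. q n x) \<longlonglongrightarrow> F' x"
    proof (rule AE_I')
      show "N \<in> null_sets lebesgue" using N negligible_iff_null_sets by blast
      have "(\<lambda>n. q n x) \<longlonglongrightarrow> F' x" if "x \<notin> N" for x
      proof -
        have "((\<lambda>s. (F (x + s *\<^sub>R e) - F x) / s) \<longlongrightarrow> F' x) (at 0)"
          using der[OF that] by (simp add: DERIV_def)
        moreover have "t \<longlonglongrightarrow> 0"
          using LIMSEQ_inverse_real_of_nat unfolding t_def inverse_eq_divide .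
        hence "filterlim t (at 0) sequentially"
          unfolding filterlim_at using t(1) by (simp add: less_imp_neq[symmetric])
        ultimately show ?thesis unfolding q_def by (rule filterlim_compose)
      qed
      thus "{x \<in> space lebesgue. \<not> (\<lambda>n. q n x) \<longlonglongrightarrow> F' x} \<subseteq> N" by blast
    qed
    have "norm (q n x) \<le> indicator (cball 0 R) x *\<^sub>R (L * norm e)" for n x
    proof (cases "x \<in> cball 0 R")
      case True
      have "\<bar>F (x + t n *\<^sub>R e) - F x\<bar> \<le> L * (t n * norm e)"
        using lipschitz_onD[OF lip, of "x + t n *\<^sub>R e" x] t(1)[of n] by (simp add: dist_norm)
      thus ?thesis using True t(1)[of n] by (simp add: q_def field_simps)
    next
      case False
      hence x: "r + norm e < norm x" by (simp add: R_def)
      have "norm (t n *\<^sub>R e) \<le> norm e" using t[of n] by (simp add: mult_left_le_one_le)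
      hence "r < norm (x + t n *\<^sub>R e)" using norm_diff_ineq[of x "t n *\<^sub>R e"] x by linarith
      hence "F (x + t n *\<^sub>R e) = 0" using supp by force
      moreover have "F x = 0" using supp[of x] x norm_ge_zero[of e] by force
      ultimately show ?thesis using False by (simp add: q_def)
    qed
    thus "AE x in lebesgue. norm (q n x) \<le> indicator (cball 0 R) x *\<^sub>R (L * norm e)" for n by simp
  qed (rule meas)
  thus ?thesis using q0 by (simp add: LIMSEQ_const_iff)
qed

lemma has_derivative_imp_directional:
  fixes F :: "'a::real_normed_vector \<Rightarrow> real"
  assumes "(F has_derivative D) (at x)"
  shows "((\<lambda>t. F (x + t *\<^sub>R e)) has_real_derivative D e) (at 0)"
proof -
  have "((\<lambda>t::real. x + t *\<^sub>R e) has_derivative (\<lambda>t. t *\<^sub>R e)) (at 0)"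
    by (auto intro!: derivative_eq_intros)
  moreover have "(F has_derivative D) (at (x + 0 *\<^sub>R e))" using assms by simp
  ultimately have "((\<lambda>t. F (x + t *\<^sub>R e)) has_derivative (\<lambda>t. D (t *\<^sub>R e))) (at 0)"
    by (rule has_derivative_compose)
  moreover have "(\<lambda>t. D (t *\<^sub>R e)) = (*) (D e)"
    using linear_scale[OF has_derivative_linear[OF assms]] by (auto simp: mult.commute)
  ultimately show ?thesis by (simp add: has_field_derivative_def)
qed

lemma continuous_compact_abs_bound:
  fixes f :: "'a::topological_space \<Rightarrow> real"
  assumes "compact K" "continuous_on K f"
  obtains A where "0 \<le> A" "\<And>x. x \<in> K \<Longrightarrow> \<bar>f x\<bar> \<le> A"
proof -
  have "bounded (f ` K)" using compact_continuous_image[OF assms(2,1)] by (rule compact_imp_bounded)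
  then obtain A where A: "0 < A" "\<forall>y\<in>f ` K. norm y \<le> A" by (auto simp: bounded_pos)
  show thesis by (rule that[of A]) (use A in auto)
qed

context p1_mesh
begin

lemma Vh_lipschitz:
  fixes a :: "nat \<Rightarrow> real"
  assumes K: "K \<in> \<T>"
  shows "\<exists>L. L-lipschitz_on K (\<lambda>x. \<Sum>k<Nv. \<phi> k x *\<^sub>R a k)"
proof -
  define u where "u x = (\<Sum>k<Nv. \<phi> k x *\<^sub>R a k)" for x
  define D where "D h = (\<Sum>k<Nv. inner (gradient K k) h *\<^sub>R a k)" for h
  have D: "(u has_derivative D) (at x)" if "x \<in> interior K" for x
    using Vh_has_derivative[OF K that, of a] unfolding u_def[abs_def] D_def[abs_def] .
  obtain x0 where x0: "x0 \<in> interior K" using element_interior_nonempty[OF K] by blast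
  have "(onorm D)-lipschitz_on (interior K) u"
    by (rule bounded_derivative_imp_lipschitz[where f' = "\<lambda>_. D"])
      (use element_convex[OF K] onorm_pos_le[OF has_derivative_bounded_linear[OF D[OF x0]]]
        in \<open>auto intro: convex_interior has_derivative_at_withinI D\<close>)
  hence "(onorm D)-lipschitz_on (closure (interior K)) u"
    by (rule lipschitz_on_closure)
      (unfold element_closure_interior[OF K] u_def, rule continuous_on_subset[OF Vh_continuous element_subset[OF K]])
  thus ?thesis unfolding element_closure_interior[OF K] u_def by blast
qed

text \<open>The domain may have reentrant corners, so \<open>b\<close> need not be Lipschitz on \<open>\<Omega>\<close>; on one convex
element the bound on the derivative suffices.\<close>

lemma C1_component_lipschitz:
  fixes b :: "real ^ 'd \<Rightarrow> real ^ 'd"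
  assumes b: "C1_closure \<Omega> b" and K: "K \<in> \<T>"
  shows "\<exists>L. L-lipschitz_on K (\<lambda>x. vec_nth (b x) i)"
proof -
  obtain b' where b': "\<forall>x\<in>\<Omega>. (b has_derivative blinfun_apply (b' x)) (at x)" "continuous_on (closure \<Omega>) b'"
    and cont: "continuous_on (closure \<Omega>) b" using b unfolding C1_closure_def by blast
  have "compact (closure \<Omega>)" using bounded_domain by simp
  moreover have "continuous_on (closure \<Omega>) (\<lambda>x. norm (b' x))" using b'(2) by (rule continuous_on_norm)
  ultimately obtain C where C: "0 \<le> C" "\<And>x. x \<in> closure \<Omega> \<Longrightarrow> \<bar>norm (b' x)\<bar> \<le> C"
    using continuous_compact_abs_bound by blast
  have "C-lipschitz_on (interior K) (\<lambda>x. vec_nth (b x) i)"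
  proof (rule bounded_derivative_imp_lipschitz)
    fix x assume x: "x \<in> interior K"
    hence x\<Omega>: "x \<in> \<Omega>" using element_interior_subset[OF K] by blast
    show "((\<lambda>x. vec_nth (b x) i) has_derivative (\<lambda>h. vec_nth (blinfun_apply (b' x) h) i)) (at x within interior K)"
      using b'(1)[rule_format, OF x\<Omega>]
      by (rule has_derivative_at_withinI[OF bounded_linear.has_derivative[OF bounded_linear_vec_nth]])
    show "onorm (\<lambda>h. vec_nth (blinfun_apply (b' x) h) i) \<le> C"
    proof (rule onorm_le)
      fix h
      have "norm (vec_nth (blinfun_apply (b' x) h) i) \<le> norm (blinfun_apply (b' x) h)"
        by (simp add: component_le_norm_cart)
      also have "\<dots> \<le> norm (b' x) * norm h" by (rule norm_blinfun)
      also have "\<dots> \<le> C * norm h" using C(2)[of x] x\<Omega> closure_subset by (intro mult_right_mono) auto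
      finally show "norm (vec_nth (blinfun_apply (b' x) h) i) \<le> C * norm h" .
    qed
  qed (use element_convex[OF K] C(1) in \<open>auto intro: convex_interior\<close>)
  hence "C-lipschitz_on (closure (interior K)) (\<lambda>x. vec_nth (b x) i)"
    by (rule lipschitz_on_closure)
      (unfold element_closure_interior[OF K], intro bounded_linear.continuous_on[OF bounded_linear_vec_nth]
        continuous_on_subset[OF cont element_subset[OF K]])
  thus ?thesis unfolding element_closure_interior[OF K] by blast
qed

text \<open>Here \<open>d i\<close> is the \<open>i\<close>-th partial derivative of \<open>b\<^sub>i u\<^sup>2\<close>.  Because \<open>u\<close> vanishes on the boundary, the extension \<open>F\<close> of
\<open>b\<^sub>i u\<^sup>2\<close> by zero agrees with \<open>b\<^sub>i u\<^sup>2\<close> on each closed element.  It is thus Lipschitz on every element and on the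
complement of \<open>\<Omega>\<close>, hence on the whole space.\<close>

lemma integral_component_divergence:
  fixes a :: "nat \<Rightarrow> real" and b :: "real ^ 'd \<Rightarrow> real ^ 'd"
  defines "u \<equiv> \<lambda>x. \<Sum>k<Nv. \<phi> k x *\<^sub>R a k"
  assumes b: "C1_closure \<Omega> b"
    and b': "\<And>x. x \<in> \<Omega> \<Longrightarrow> (b has_derivative blinfun_apply (b' x)) (at x)" "continuous_on (closure \<Omega>) b'"
  defines "d \<equiv> \<lambda>i x. vec_nth (blinfun_apply (b' x) (axis i 1)) i * (u x * u x)
      + vec_nth (b x) i * (2 * (u x * vec_nth (grad u x) i))"
  shows "pw_cont (d i)" and "(LINT x:\<Omega>|lebesgue. d i x) = 0"
proof -
  have cont: "continuous_on (closure \<Omega>) b" using b unfolding C1_closure_def by blast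
  have cb: "continuous_on (closure \<Omega>) (\<lambda>x. vec_nth (b x) i)"
    using cont by (rule bounded_linear.continuous_on[OF bounded_linear_vec_nth])
  have cb': "continuous_on (closure \<Omega>) (\<lambda>x. vec_nth (blinfun_apply (b' x) (axis i 1)) i)"
    by (intro bounded_linear.continuous_on[OF bounded_linear_vec_nth]
        bounded_bilinear.continuous_on[OF bounded_bilinear_blinfun_apply] b'(2) continuous_on_const)
  have u: "pw_cont u" unfolding u_def by (rule pw_cont_Vh)
  have cu: "continuous_on (closure \<Omega>) u" unfolding u_def by (rule Vh_continuous)
  show pw: "pw_cont (d i)" unfolding d_def
    by (intro pw_cont_add pw_cont_mult pw_cont_const u pw_cont_continuous[OF cb] pw_cont_continuous[OF cb'])
      (unfold u_def, rule pw_cont_grad_Vh)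
  define F where "F x = (if x \<in> \<Omega> then vec_nth (b x) i * (u x * u x) else 0)" for x
  have "\<exists>L. L-lipschitz_on UNIV F"
  proof (rule lipschitz_glue[of "insert (- \<Omega>) \<T>"])
    show "closed S" if "S \<in> insert (- \<Omega>) \<T>" for S
      using that open_domain element_compact compact_imp_closed by auto
    show "\<Union>(insert (- \<Omega>) \<T>) = UNIV" using Union_mesh closure_subset by auto
    show "\<exists>L. L-lipschitz_on S F" if S: "S \<in> insert (- \<Omega>) \<T>" for S
    proof (cases "S = - \<Omega>")
      case True
      have "0-lipschitz_on S F" by (rule lipschitz_onI) (auto simp: F_def True)
      thus ?thesis by blast
    next
      case False
      hence K: "S \<in> \<T>" using S by blast
      have F: "F x = vec_nth (b x) i * (u x * u x)" if "x \<in> S" for x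
      proof (cases "x \<in> \<Omega>")
        case False
        hence "x \<in> frontier \<Omega>" using that element_subset[OF K] open_domain
          by (auto simp: frontier_def interior_open)
        hence "u x = 0" unfolding u_def by (rule Vh_frontier)
        thus ?thesis by (simp add: F_def)
      qed (simp add: F_def)
      obtain Lb where Lb: "Lb-lipschitz_on S (\<lambda>x. vec_nth (b x) i)" using C1_component_lipschitz[OF b K] by blast
      obtain Lu where Lu: "Lu-lipschitz_on S u" using Vh_lipschitz[OF K] unfolding u_def by blast
      obtain A where A: "0 \<le> A" "\<And>x. x \<in> S \<Longrightarrow> \<bar>vec_nth (b x) i\<bar> \<le> A"
        using continuous_compact_abs_bound[OF element_compact[OF K] continuous_on_subset[OF cb element_subset[OF K]]] by blast
      obtain B where B: "0 \<le> B" "\<And>x. x \<in> S \<Longrightarrow> \<bar>u x\<bar> \<le> B"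
        using continuous_compact_abs_bound[OF element_compact[OF K] continuous_on_subset[OF cu element_subset[OF K]]] by blast
      have "\<bar>u x * u x\<bar> \<le> B * B" if "x \<in> S" for x
        unfolding abs_mult using B(1) B(2)[OF that] by (intro mult_mono) auto
      hence "(A * (B * Lu + B * Lu) + B * B * Lb)-lipschitz_on S (\<lambda>x. vec_nth (b x) i * (u x * u x))"
        using A B by (intro lipschitz_on_mult_bounded Lb Lu) auto
      hence "(A * (B * Lu + B * Lu) + B * B * Lb)-lipschitz_on S F"
        unfolding lipschitz_on_def using F by simp
      thus ?thesis by blast
    qed
  qed (use finite_mesh in simp)
  then obtain L where L: "L-lipschitz_on UNIV F" by blast
  obtain r where r: "\<And>x. x \<in> \<Omega> \<Longrightarrow> norm x \<le> r" using bounded_domain by (auto simp: bounded_iff)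
  have "integral\<^sup>L lebesgue (\<lambda>x. indicator \<Omega> x *\<^sub>R d i x) = 0"
  proof (rule lipschitz_integral_directional_derivative[OF L _ negligible_skeleton])
    show "norm x \<le> r" if "F x \<noteq> 0" for x using that r by (auto simp: F_def split: if_splits)
    show "(\<lambda>x. indicator \<Omega> x *\<^sub>R d i x) \<in> borel_measurable lebesgue"
      using pw_cont_integrable[OF pw] unfolding set_integrable_def by (rule borel_measurable_integrable)
    fix x assume x: "x \<notin> skeleton"
    show "((\<lambda>t. F (x + t *\<^sub>R axis i 1)) has_real_derivative indicator \<Omega> x *\<^sub>R d i x) (at 0)"
    proof (cases "x \<in> \<Omega>")
      case True
      obtain K where K: "K \<in> \<T>" "x \<in> interior K" using off_skeleton[OF True x] by blast
      define D where "D h = (\<Sum>k<Nv. inner (gradient K k) h *\<^sub>R a k)" for h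
      have D: "(u has_derivative D) (at x)"
        using Vh_has_derivative[OF K, of a] unfolding u_def D_def[abs_def] .
      have De: "vec_nth (grad u x) i = D (axis i 1)" using grad_eqI[OF D] by simp
      have "((\<lambda>x. vec_nth (b x) i * (u x * u x)) has_derivative
          (\<lambda>h. vec_nth (b x) i * (u x * D h + D h * u x) + vec_nth (blinfun_apply (b' x) h) i * (u x * u x))) (at x)"
        by (intro has_derivative_mult D bounded_linear.has_derivative[OF bounded_linear_vec_nth b'(1)[OF True]])
      hence "(F has_derivative
          (\<lambda>h. vec_nth (b x) i * (u x * D h + D h * u x) + vec_nth (blinfun_apply (b' x) h) i * (u x * u x))) (at x)"
        by (rule has_derivative_transform_within_open[OF _ open_domain True]) (simp add: F_def)
      from has_derivative_imp_directional[OF this, of "axis i 1"]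
      show ?thesis using True by (simp add: d_def De algebra_simps)
    next
      case False
      hence x': "x \<in> - closure \<Omega>" using x open_domain by (auto simp: skeleton_def frontier_def interior_open)
      have "((\<lambda>_. 0) has_derivative (\<lambda>_. 0)) (at x)" by (rule has_derivative_const)
      hence "(F has_derivative (\<lambda>_. 0)) (at x)"
        by (rule has_derivative_transform_within_open[OF _ _ x'])
          (use closure_subset in \<open>auto simp: F_def\<close>)
      from has_derivative_imp_directional[OF this, of "axis i 1"]
      show ?thesis using False by simp
    qed
  qed
  thus "(LINT x:\<Omega>|lebesgue. d i x) = 0" unfolding set_lebesgue_integral_def .
qed

text \<open>Summing the components gives \<open>\<nabla> \<cdot> (b u\<^sup>2) = (\<nabla> \<cdot> b) u\<^sup>2 + 2 u (b \<cdot> \<nabla>u)\<close> with integral zero.\<close>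

lemma integration_by_parts:
  fixes a :: "nat \<Rightarrow> real" and b :: "real ^ 'd \<Rightarrow> real ^ 'd"
  defines "u \<equiv> \<lambda>x. \<Sum>k<Nv. \<phi> k x *\<^sub>R a k"
  assumes b: "C1_closure \<Omega> b"
  shows pw_cont_divergence: "pw_cont (divergence b)"
    and "(LINT x:\<Omega>|lebesgue. u x * inner (b x) (grad u x)) = - 1/2 * (LINT x:\<Omega>|lebesgue. divergence b x * u x * u x)"
proof -
  obtain b' where b': "\<And>x. x \<in> \<Omega> \<Longrightarrow> (b has_derivative blinfun_apply (b' x)) (at x)" "continuous_on (closure \<Omega>) b'"
    and cont: "continuous_on (closure \<Omega>) b" using b unfolding C1_closure_def by blast
  have div: "divergence b x = (\<Sum>i\<in>UNIV. vec_nth (blinfun_apply (b' x) (axis i 1)) i)" if "x \<in> \<Omega>" for x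
    unfolding divergence_def frechet_derivative_at[OF b'(1)[OF that], symmetric] ..
  have "pw_cont (\<lambda>x. \<Sum>i\<in>UNIV. vec_nth (blinfun_apply (b' x) (axis i 1)) i)"
    by (intro pw_cont_continuous continuous_on_sum bounded_linear.continuous_on[OF bounded_linear_vec_nth]
        bounded_bilinear.continuous_on[OF bounded_bilinear_blinfun_apply] b'(2) continuous_on_const)
  thus pw_div: "pw_cont (divergence b)"
    by (rule pw_cont_cong) (use div element_interior_subset in force)
  have u: "pw_cont u" unfolding u_def by (rule pw_cont_Vh)
  have g: "pw_cont (grad u)" unfolding u_def by (rule pw_cont_grad_Vh_real)
  define d where "d i x = vec_nth (blinfun_apply (b' x) (axis i 1)) i * (u x * u x)
      + vec_nth (b x) i * (2 * (u x * vec_nth (grad u x) i))" for i x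
  have d: "pw_cont (d i)" "(LINT x:\<Omega>|lebesgue. d i x) = 0" for i
    unfolding d_def[abs_def] u_def[abs_def]
    by (rule integral_component_divergence(1)[OF b b'], assumption)
      (rule integral_component_divergence(2)[OF b b'], assumption)
  have int1: "set_integrable lebesgue \<Omega> (\<lambda>x. divergence b x * u x * u x)"
    by (intro pw_cont_integrable pw_cont_mult pw_div u)
  have int2: "set_integrable lebesgue \<Omega> (\<lambda>x. u x * inner (b x) (grad u x))"
    by (intro pw_cont_integrable pw_cont_mult pw_cont_inner u g pw_cont_continuous[OF cont])
  have "0 = (\<Sum>i\<in>UNIV. LINT x:\<Omega>|lebesgue. d i x)" using d(2) by simp
  also have "\<dots> = (LINT x:\<Omega>|lebesgue. (\<Sum>i\<in>UNIV. d i x))"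
    by (rule set_integral_sum[symmetric]) (rule pw_cont_integrable[OF d(1)])
  also have "\<dots> = (LINT x:\<Omega>|lebesgue. divergence b x * u x * u x + 2 * (u x * inner (b x) (grad u x)))"
  proof (rule set_lebesgue_integral_cong)
    show "\<Omega> \<in> sets lebesgue" using open_domain by (simp add: borel_open sets_completionI_sets)
    show "\<forall>x. x \<in> \<Omega> \<longrightarrow> (\<Sum>i\<in>UNIV. d i x) = divergence b x * u x * u x + 2 * (u x * inner (b x) (grad u x))"
      by (auto simp: d_def div inner_vec_def sum.distrib sum_distrib_left sum_distrib_right mult_ac)
  qed
  also have "\<dots> = (LINT x:\<Omega>|lebesgue. divergence b x * u x * u x) + 2 * (LINT x:\<Omega>|lebesgue. u x * inner (b x) (grad u x))"
    using int1 int2 by simp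
  finally show "(LINT x:\<Omega>|lebesgue. u x * inner (b x) (grad u x)) = - 1/2 * (LINT x:\<Omega>|lebesgue. divergence b x * u x * u x)"
    by simp
qed

end

section \<open>The stiffness and mass forms\<close>

lemma bounded_bilinear_matrix_vector_mult:
  "bounded_bilinear (\<lambda>(M :: real ^ 'd ^ 'd::finite) v. M *v v)"
  unfolding bilinear_conv_bounded_bilinear[symmetric] bilinear_def
  by (auto intro!: linearI simp: matrix_vector_right_distrib matrix_vector_mult_scaleR
      matrix_vector_mult_add_rdistrib scaleR_matrix_vector_assoc)

lemma sum_nth_scaleR_sum:
  fixes a :: "nat \<Rightarrow> complex" and g :: "nat \<Rightarrow> real ^ 'd::finite"
  shows "(\<Sum>i\<in>UNIV. vec_nth b i *\<^sub>R (\<Sum>k\<in>I. vec_nth (g k) i *\<^sub>R a k)) = (\<Sum>k\<in>I. of_real (inner b (g k)) * a k)"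
  unfolding scaleR_sum_right
  by (subst sum.swap) (simp add: inner_vec_def sum_distrib_right scaleR_conv_of_real mult.assoc)

lemma sum_times_cnj_sum:
  "(\<Sum>k\<in>I. of_real (\<alpha> k) * a k) * cnj (\<Sum>l\<in>J. \<beta> l *\<^sub>R w l) = (\<Sum>l\<in>J. \<Sum>k\<in>I. cnj (w l) * of_real (\<beta> l * \<alpha> k) * a k)"
  unfolding cnj_sum sum_product by (subst sum.swap) (simp add: scaleR_conv_of_real mult_ac)

lemma sum_gradient_form:
  fixes a w :: "nat \<Rightarrow> complex" and g :: "nat \<Rightarrow> real ^ 'd::finite"
  shows "(\<Sum>i\<in>UNIV. (\<Sum>j\<in>UNIV. vec_nth (vec_nth M i) j *\<^sub>R (\<Sum>k\<in>I. vec_nth (g k) j *\<^sub>R a k)) * cnj (\<Sum>l\<in>J. vec_nth (g l) i *\<^sub>R w l))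
    = (\<Sum>l\<in>J. \<Sum>k\<in>I. cnj (w l) * of_real (inner (g l) (M *v g k)) * a k)"
proof -
  have "(\<Sum>i\<in>UNIV. (\<Sum>j\<in>UNIV. vec_nth (vec_nth M i) j *\<^sub>R (\<Sum>k\<in>I. vec_nth (g k) j *\<^sub>R a k)) * cnj (\<Sum>l\<in>J. vec_nth (g l) i *\<^sub>R w l))
    = (\<Sum>i\<in>UNIV. \<Sum>l\<in>J. \<Sum>k\<in>I. cnj (w l) * of_real (vec_nth (g l) i * inner (vec_nth M i) (g k)) * a k)"
    unfolding sum_nth_scaleR_sum sum_times_cnj_sum ..
  also have "\<dots> = (\<Sum>l\<in>J. \<Sum>k\<in>I. \<Sum>i\<in>UNIV. cnj (w l) * of_real (vec_nth (g l) i * inner (vec_nth M i) (g k)) * a k)"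
    by (subst sum.swap) (intro sum.cong refl sum.swap)
  also have "\<dots> = (\<Sum>l\<in>J. \<Sum>k\<in>I. cnj (w l) * of_real (inner (g l) (M *v g k)) * a k)"
  proof (intro sum.cong refl)
    fix l k
    have "inner (g l) (M *v g k) = (\<Sum>i\<in>UNIV. vec_nth (g l) i * inner (vec_nth M i) (g k))"
      by (simp add: inner_vec_def matrix_vector_mult_def)
    thus "(\<Sum>i\<in>UNIV. cnj (w l) * of_real (vec_nth (g l) i * inner (vec_nth M i) (g k)) * a k)
        = cnj (w l) * of_real (inner (g l) (M *v g k)) * a k"
      by (simp add: sum_distrib_left sum_distrib_right)
  qed
  finally show ?thesis .
qed

locale p1_fem = p1_mesh \<Omega> \<T> p \<phi> N Nv
  for \<Omega> :: "(real ^ 'd::finite) set" and \<T> p \<phi> N Nv +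
  fixes D :: "real ^ 'd \<Rightarrow> real ^ 'd ^ 'd" and b :: "real ^ 'd \<Rightarrow> real ^ 'd" and c :: "real ^ 'd \<Rightarrow> real"
  assumes D_continuous: "continuous_on (closure \<Omega>) D" and b_C1: "C1_closure \<Omega> b"
    and c_continuous: "continuous_on (closure \<Omega>) c"
    and D_spd: "\<And>x. x \<in> \<Omega> \<Longrightarrow> sym_pos_def (D x)"
    and zero_order_nonneg: "\<And>x. x \<in> \<Omega> \<Longrightarrow> 0 \<le> c x - 1/2 * divergence b x"
begin

lemma b_continuous: "continuous_on (closure \<Omega>) b"
  using b_C1 by (simp add: C1_closure_def)

lemmas pw_D = pw_cont_continuous[OF D_continuous]
lemmas pw_b = pw_cont_continuous[OF b_continuous]
lemmas pw_c = pw_cont_continuous[OF c_continuous]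
lemmas pw_cont_mat_vec = pw_cont_bilinear[OF bounded_bilinear_matrix_vector_mult]

text \<open>The integrand of the stiffness matrix with \<open>D\<close> itself instead of its element means.\<close>

definition density :: "nat \<Rightarrow> nat \<Rightarrow> real ^ 'd \<Rightarrow> real" where
  "density j k x = inner (grad (\<phi> j) x) (D x *v grad (\<phi> k) x) + \<phi> j x * inner (b x) (grad (\<phi> k) x)
     + c x * \<phi> j x * \<phi> k x"

definition A :: "nat \<Rightarrow> nat \<Rightarrow> real" where "A j k = (LINT x:\<Omega>|lebesgue. density j k x)"

definition B :: "nat \<Rightarrow> nat \<Rightarrow> real" where "B j k = (LINT x:\<Omega>|lebesgue. \<phi> j x * \<phi> k x)"

lemma pw_cont_density: "j < Nv \<Longrightarrow> k < Nv \<Longrightarrow> pw_cont (density j k)"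
  unfolding density_def
  by (intro pw_cont_add pw_cont_mult pw_cont_inner pw_cont_mat_vec pw_D pw_b pw_c pw_cont_grad_basis pw_cont_basis)

lemma pw_cont_mass_density: "j < Nv \<Longrightarrow> k < Nv \<Longrightarrow> pw_cont (\<lambda>x. \<phi> j x * \<phi> k x)"
  by (intro pw_cont_mult pw_cont_basis)

lemma element_measure_pos: assumes "K \<in> \<T>" shows "measure lebesgue K \<noteq> 0"
proof
  assume "measure lebesgue K = 0"
  hence "negligible K" using lmeasurable_compact[OF element_compact[OF assms]] negligible_iff_measure0 by blast
  hence "negligible (interior K)" using interior_subset by (rule negligible_subset)
  thus False using open_not_negligible[OF open_interior] element_interior_nonempty[OF assms] by blast
qed

text \<open>The gradients are constant on each element, so averaging \<open>D\<close> over the element does not change the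
integral of the diffusion term.\<close>

lemma stiffness_mat_entry:
  assumes j: "j < Nv" and k: "k < Nv"
  shows "stiffness_mat \<T> D b c \<phi> Nv $$ (j, k) = A j k"
proof -
  have "(LINT x:K|lebesgue. inner (grad (\<phi> j) x) (mean_on K D *v grad (\<phi> k) x)
      + \<phi> j x * inner (b x) (grad (\<phi> k) x) + c x * \<phi> j x * \<phi> k x)
    = (LINT x:K|lebesgue. density j k x)" if K: "K \<in> \<T>" for K
  proof -
    define r where "r x = \<phi> j x * inner (b x) (grad (\<phi> k) x) + c x * \<phi> j x * \<phi> k x" for x
    define T where "T M = inner (gradient K j) (M *v gradient K k)" for M :: "real ^ 'd ^ 'd"
    have T: "bounded_linear T"
      unfolding T_def
      by (rule bounded_linear_compose[OF bounded_linear_inner_right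
            bounded_bilinear.bounded_linear_left[OF bounded_bilinear_matrix_vector_mult]])
    have r: "pw_cont r" unfolding r_def
      by (intro pw_cont_add pw_cont_mult pw_cont_inner pw_b pw_c pw_cont_grad_basis pw_cont_basis j k)
    have h: "pw_cont (\<lambda>x. inner (grad (\<phi> j) x) (D x *v grad (\<phi> k) x))"
      by (intro pw_cont_inner pw_cont_mat_vec pw_D pw_cont_grad_basis j k)
    have m: "pw_cont (\<lambda>x. inner (grad (\<phi> j) x) (mean_on K D *v grad (\<phi> k) x))"
      by (intro pw_cont_inner pw_cont_mat_vec pw_cont_const pw_cont_grad_basis j k)
    have TD: "pw_cont (\<lambda>x. T (D x))" using T pw_D by (rule pw_cont_linear)
    have lK: "K \<in> lmeasurable" using K by (intro lmeasurable_compact element_compact)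
    have "(LINT x:K|lebesgue. inner (grad (\<phi> j) x) (mean_on K D *v grad (\<phi> k) x))
        = (LINT x:K|lebesgue. T (mean_on K D))"
      by (rule pw_cont_element_integral_cong[OF m K _ pw_cont_const]) (simp add: T_def grad_basis[OF K] j k)
    also have "\<dots> = measure lebesgue K * T (mean_on K D)"
      using lK fmeasurableD2[OF lK] by (simp add: set_lebesgue_integral_def fmeasurableD less_top)
    also have "\<dots> = T (LINT x:K|lebesgue. D x)"
      using element_measure_pos[OF K] linear_scale[OF bounded_linear.linear[OF T]]
      by (simp add: mean_on_def)
    also have "\<dots> = (LINT x:K|lebesgue. T (D x))"
      using integral_bounded_linear[OF T, of lebesgue "\<lambda>x. indicator K x *\<^sub>R D x"]
        pw_cont_element_integrable[OF pw_D K] linear_scale[OF bounded_linear.linear[OF T]]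
      by (simp add: set_lebesgue_integral_def set_integrable_def)
    also have "\<dots> = (LINT x:K|lebesgue. inner (grad (\<phi> j) x) (D x *v grad (\<phi> k) x))"
      by (rule pw_cont_element_integral_cong[OF TD K _ h]) (simp add: T_def grad_basis[OF K] j k)
    finally have "(LINT x:K|lebesgue. inner (grad (\<phi> j) x) (mean_on K D *v grad (\<phi> k) x) + r x)
        = (LINT x:K|lebesgue. inner (grad (\<phi> j) x) (D x *v grad (\<phi> k) x) + r x)"
      by (simp add: pw_cont_element_integrable[OF m K] pw_cont_element_integrable[OF h K]
          pw_cont_element_integrable[OF r K])
    thus ?thesis by (simp add: r_def density_def[abs_def] add.assoc)
  qed
  thus ?thesis using j k
    by (simp add: stiffness_mat_def A_def pw_cont_integral_sum[OF pw_cont_density[OF j k]])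
qed

lemma mass_mat_entry: "j < Nv \<Longrightarrow> k < Nv \<Longrightarrow> mass_mat \<T> \<phi> Nv $$ (j, k) = B j k"
  by (simp add: mass_mat_def B_def pw_cont_integral_sum[OF pw_cont_mass_density])

lemma integral_sesquilinear:
  fixes a w :: "nat \<Rightarrow> complex"
  assumes "\<And>l k. l < Nv \<Longrightarrow> k < Nv \<Longrightarrow> pw_cont (f l k)"
  shows "(LINT x:\<Omega>|lebesgue. (\<Sum>l<Nv. \<Sum>k<Nv. cnj (w l) * complex_of_real (f l k x) * a k))
    = (\<Sum>l<Nv. \<Sum>k<Nv. cnj (w l) * complex_of_real (LINT x:\<Omega>|lebesgue. f l k x) * a k)"
proof -
  have pw: "pw_cont (\<lambda>x. cnj (w l) * complex_of_real (f l k x) * a k)" if "l < Nv" "k < Nv" for l k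
    by (intro pw_cont_mult pw_cont_const pw_cont_of_real assms that)
  have "(LINT x:\<Omega>|lebesgue. (\<Sum>l<Nv. \<Sum>k<Nv. cnj (w l) * complex_of_real (f l k x) * a k))
    = (\<Sum>l<Nv. LINT x:\<Omega>|lebesgue. (\<Sum>k<Nv. cnj (w l) * complex_of_real (f l k x) * a k))"
    by (rule set_integral_sum) (intro pw_cont_integrable pw_cont_sum pw, auto)
  also have "\<dots> = (\<Sum>l<Nv. \<Sum>k<Nv. LINT x:\<Omega>|lebesgue. cnj (w l) * complex_of_real (f l k x) * a k)"
    by (intro sum.cong refl set_integral_sum pw_cont_integrable pw) auto
  finally show ?thesis by (simp add: set_integral_complex_of_real)
qed

lemma integral_bilinear:
  fixes a :: "nat \<Rightarrow> real"
  assumes "\<And>l k. l < Nv \<Longrightarrow> k < Nv \<Longrightarrow> pw_cont (f l k)"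
  shows "(LINT x:\<Omega>|lebesgue. (\<Sum>l<Nv. \<Sum>k<Nv. a l * f l k x * a k))
    = (\<Sum>l<Nv. \<Sum>k<Nv. a l * (LINT x:\<Omega>|lebesgue. f l k x) * a k)"
proof -
  have pw: "pw_cont (\<lambda>x. a l * f l k x * a k)" if "l < Nv" "k < Nv" for l k
    by (intro pw_cont_mult pw_cont_const assms that)
  have "(LINT x:\<Omega>|lebesgue. (\<Sum>l<Nv. \<Sum>k<Nv. a l * f l k x * a k))
    = (\<Sum>l<Nv. LINT x:\<Omega>|lebesgue. (\<Sum>k<Nv. a l * f l k x * a k))"
    by (rule set_integral_sum) (intro pw_cont_integrable pw_cont_sum pw, auto)
  also have "\<dots> = (\<Sum>l<Nv. \<Sum>k<Nv. LINT x:\<Omega>|lebesgue. a l * f l k x * a k)"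
    by (intro sum.cong refl set_integral_sum pw_cont_integrable pw) auto
  finally show ?thesis by simp
qed

lemma density_element:
  assumes "K \<in> \<T>" "x \<in> interior K" "j < Nv" "k < Nv"
  shows "density j k x = inner (gradient K j) (D x *v gradient K k) + \<phi> j x * inner (b x) (gradient K k)
    + c x * \<phi> j x * \<phi> k x"
  using assms by (simp add: density_def grad_basis)

text \<open>On the interior of an element both sides have the same integrand; the three terms of the weak form are
expanded there one by one.\<close>

lemma weak_form_eq:
  fixes a w :: "nat \<Rightarrow> complex"
  shows "weak_form \<Omega> D b c (\<lambda>x. \<Sum>k<Nv. \<phi> k x *\<^sub>R a k) (\<lambda>x. \<Sum>k<Nv. \<phi> k x *\<^sub>R w k)
    = (\<Sum>l<Nv. \<Sum>k<Nv. cnj (w l) * of_real (A l k) * a k)"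
proof -
  define u where "u x = (\<Sum>k<Nv. \<phi> k x *\<^sub>R a k)" for x
  define v where "v x = (\<Sum>k<Nv. \<phi> k x *\<^sub>R w k)" for x
  define f1 where "f1 x = (\<Sum>i\<in>UNIV. (\<Sum>j\<in>UNIV. vec_nth (vec_nth (D x) i) j *\<^sub>R vec_nth (grad u x) j) * cnj (vec_nth (grad v x) i))" for x
  define f2 where "f2 x = (\<Sum>i\<in>UNIV. vec_nth (b x) i *\<^sub>R vec_nth (grad u x) i) * cnj (v x)" for x
  define f3 where "f3 x = (c x *\<^sub>R u x) * cnj (v x)" for x
  have u: "pw_cont u" "pw_cont (\<lambda>x. vec_nth (grad u x) i)" for i
    unfolding u_def[abs_def] by (rule pw_cont_Vh, rule pw_cont_grad_Vh)
  have v: "pw_cont v" "pw_cont (\<lambda>x. vec_nth (grad v x) i)" for i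
    unfolding v_def[abs_def] by (rule pw_cont_Vh, rule pw_cont_grad_Vh)
  have f1: "pw_cont f1" unfolding f1_def
    by (intro pw_cont_sum pw_cont_mult pw_cont_scaleR pw_cont_nth[OF pw_cont_nth[OF pw_D]] pw_cont_cnj u v)
  have f2: "pw_cont f2" unfolding f2_def
    by (intro pw_cont_sum pw_cont_mult pw_cont_scaleR pw_cont_nth[OF pw_b] pw_cont_cnj u v)
  have f3: "pw_cont f3" unfolding f3_def
    by (intro pw_cont_mult pw_cont_scaleR pw_c pw_cont_cnj u v)
  have "weak_form \<Omega> D b c u v = (LINT x:\<Omega>|lebesgue. f1 x) + (LINT x:\<Omega>|lebesgue. f2 x) + (LINT x:\<Omega>|lebesgue. f3 x)"
    by (simp add: weak_form_def L2_cvector_def L2_cscalar_def f1_def f2_def f3_def)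
  also have "\<dots> = (LINT x:\<Omega>|lebesgue. f1 x + f2 x + f3 x)"
    using f1 f2 f3 by (simp add: pw_cont_integrable)
  also have "\<dots> = (LINT x:\<Omega>|lebesgue. (\<Sum>l<Nv. \<Sum>k<Nv. cnj (w l) * complex_of_real (density l k x) * a k))"
  proof (rule pw_cont_integral_cong)
    show "pw_cont (\<lambda>x. f1 x + f2 x + f3 x)" by (intro pw_cont_add f1 f2 f3)
    fix K x assume K: "K \<in> \<T>" "x \<in> interior K"
    have gu: "vec_nth (grad u x) i = (\<Sum>k<Nv. vec_nth (gradient K k) i *\<^sub>R a k)"
      and gv: "vec_nth (grad v x) i = (\<Sum>k<Nv. vec_nth (gradient K k) i *\<^sub>R w k)" for i
      unfolding u_def[abs_def] v_def[abs_def] grad_Vh[OF K] by simp_all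
    have 1: "f1 x = (\<Sum>l<Nv. \<Sum>k<Nv. cnj (w l) * of_real (inner (gradient K l) (D x *v gradient K k)) * a k)"
      unfolding f1_def gu gv by (rule sum_gradient_form)
    have 2: "f2 x = (\<Sum>l<Nv. \<Sum>k<Nv. cnj (w l) * of_real (\<phi> l x * inner (b x) (gradient K k)) * a k)"
      unfolding f2_def gu sum_nth_scaleR_sum v_def by (rule sum_times_cnj_sum)
    have "c x *\<^sub>R u x = (\<Sum>k<Nv. of_real (c x * \<phi> k x) * a k)"
      by (simp add: u_def scaleR_conv_of_real sum_distrib_left mult.assoc)
    hence 3: "f3 x = (\<Sum>l<Nv. \<Sum>k<Nv. cnj (w l) * of_real (\<phi> l x * (c x * \<phi> k x)) * a k)"
      unfolding f3_def v_def by (simp only: sum_times_cnj_sum)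
    show "f1 x + f2 x + f3 x = (\<Sum>l<Nv. \<Sum>k<Nv. cnj (w l) * complex_of_real (density l k x) * a k)"
      unfolding 1 2 3 sum.distrib[symmetric]
      by (intro sum.cong refl) (simp add: density_element[OF K] algebra_simps)
  qed
  also have "\<dots> = (\<Sum>l<Nv. \<Sum>k<Nv. cnj (w l) * of_real (A l k) * a k)"
    unfolding A_def by (rule integral_sesquilinear) (rule pw_cont_density)
  finally show ?thesis by (simp add: u_def[abs_def] v_def[abs_def])
qed

lemma L2_cscalar_eq:
  fixes a w :: "nat \<Rightarrow> complex"
  shows "L2_cscalar \<Omega> (\<lambda>x. \<Sum>k<Nv. \<phi> k x *\<^sub>R a k) (\<lambda>x. \<Sum>k<Nv. \<phi> k x *\<^sub>R w k)
    = (\<Sum>l<Nv. \<Sum>k<Nv. cnj (w l) * of_real (B l k) * a k)"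
proof -
  have "(\<Sum>k<Nv. \<phi> k x *\<^sub>R a k) * cnj (\<Sum>k<Nv. \<phi> k x *\<^sub>R w k)
      = (\<Sum>l<Nv. \<Sum>k<Nv. cnj (w l) * complex_of_real (\<phi> l x * \<phi> k x) * a k)" for x
    using sum_times_cnj_sum[of "\<lambda>k. \<phi> k x" a "{..<Nv}" "\<lambda>k. \<phi> k x" w "{..<Nv}"]
    by (simp add: scaleR_conv_of_real)
  hence "L2_cscalar \<Omega> (\<lambda>x. \<Sum>k<Nv. \<phi> k x *\<^sub>R a k) (\<lambda>x. \<Sum>k<Nv. \<phi> k x *\<^sub>R w k)
    = (LINT x:\<Omega>|lebesgue. (\<Sum>l<Nv. \<Sum>k<Nv. cnj (w l) * complex_of_real (\<phi> l x * \<phi> k x) * a k))"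
    by (simp only: L2_cscalar_def)
  also have "\<dots> = (\<Sum>l<Nv. \<Sum>k<Nv. cnj (w l) * of_real (B l k) * a k)"
    unfolding B_def by (rule integral_sesquilinear) (rule pw_cont_mass_density)
  finally show ?thesis .
qed

definition quad :: "(nat \<Rightarrow> nat \<Rightarrow> real) \<Rightarrow> (nat \<Rightarrow> real) \<Rightarrow> real" where
  "quad M a = (\<Sum>l<Nv. \<Sum>k<Nv. a l * M l k * a k)"

lemma quad_B_eq_L2:
  fixes a :: "nat \<Rightarrow> real"
  shows "L2_real \<Omega> (\<lambda>x. \<Sum>k<Nv. \<phi> k x *\<^sub>R a k) (\<lambda>x. \<Sum>k<Nv. \<phi> k x *\<^sub>R a k) = quad B a"
proof -
  have "inner (\<Sum>k<Nv. \<phi> k x *\<^sub>R a k) (\<Sum>k<Nv. \<phi> k x *\<^sub>R a k) = (\<Sum>l<Nv. \<Sum>k<Nv. a l * (\<phi> l x * \<phi> k x) * a k)" for x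
    by (simp add: sum_product mult_ac)
  hence "L2_real \<Omega> (\<lambda>x. \<Sum>k<Nv. \<phi> k x *\<^sub>R a k) (\<lambda>x. \<Sum>k<Nv. \<phi> k x *\<^sub>R a k)
      = (LINT x:\<Omega>|lebesgue. (\<Sum>l<Nv. \<Sum>k<Nv. a l * (\<phi> l x * \<phi> k x) * a k))" by (simp only: L2_real_def)
  also have "\<dots> = quad B a"
    unfolding quad_def B_def by (rule integral_bilinear) (rule pw_cont_mass_density)
  finally show ?thesis .
qed

text \<open>Expanding the quadratic form gives the energy with the term \<open>(b \<cdot> \<nabla>u, u)\<close>, which integration by parts
turns into the contribution \<open>- 1/2 (\<nabla> \<cdot> b) u\<^sup>2\<close> to the zero-order term.\<close>

lemma quad_A_eq_energy:
  fixes a :: "nat \<Rightarrow> real"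
  defines "u \<equiv> \<lambda>x. \<Sum>k<Nv. \<phi> k x *\<^sub>R a k"
  shows "quad A a = L2_real \<Omega> (\<lambda>x. D x *v grad u x) (grad u) + L2_real \<Omega> (\<lambda>x. (c x - 1/2 * divergence b x) * u x) u"
proof -
  have u: "pw_cont u" and g: "pw_cont (grad u)"
    unfolding u_def by (rule pw_cont_Vh, rule pw_cont_grad_Vh_real)
  note div = pw_cont_divergence[OF b_C1]
  have h1: "pw_cont (\<lambda>x. inner (grad u x) (D x *v grad u x))"
    by (intro pw_cont_inner pw_cont_mat_vec pw_D g)
  have h2: "pw_cont (\<lambda>x. u x * inner (b x) (grad u x))"
    by (intro pw_cont_mult pw_cont_inner pw_b u g)
  have h3: "pw_cont (\<lambda>x. c x * u x * u x)" by (intro pw_cont_mult pw_c u)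
  have h4: "pw_cont (\<lambda>x. divergence b x * u x * u x)" by (intro pw_cont_mult div u)
  have "quad A a = (LINT x:\<Omega>|lebesgue. (\<Sum>l<Nv. \<Sum>k<Nv. a l * density l k x * a k))"
    unfolding quad_def A_def by (rule integral_bilinear[symmetric]) (rule pw_cont_density)
  also have "\<dots> = (LINT x:\<Omega>|lebesgue. inner (grad u x) (D x *v grad u x) + u x * inner (b x) (grad u x) + c x * u x * u x)"
  proof (rule pw_cont_integral_cong[symmetric])
    show "pw_cont (\<lambda>x. inner (grad u x) (D x *v grad u x) + u x * inner (b x) (grad u x) + c x * u x * u x)"
      by (intro pw_cont_add h1 h2 h3)
    fix K x assume K: "K \<in> \<T>" "x \<in> interior K"
    have gu: "grad u x = (\<Sum>k<Nv. a k *\<^sub>R gradient K k)"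
      unfolding u_def grad_Vh[OF K] by (simp add: Finite_Cartesian_Product.vec_eq_iff mult.commute)
    have mv: "D x *v (\<Sum>k<Nv. a k *\<^sub>R gradient K k) = (\<Sum>k<Nv. a k *\<^sub>R (D x *v gradient K k))"
      by (simp add: linear_sum[OF matrix_vector_mul_linear] matrix_vector_mult_scaleR)
    have 1: "inner (grad u x) (D x *v grad u x) = (\<Sum>l<Nv. \<Sum>k<Nv. a l * inner (gradient K l) (D x *v gradient K k) * a k)"
      unfolding gu mv inner_sum_left inner_sum_right by (subst sum.swap) (simp add: mult_ac)
    have 2: "u x * inner (b x) (grad u x) = (\<Sum>l<Nv. \<Sum>k<Nv. a l * (\<phi> l x * inner (b x) (gradient K k)) * a k)"
      unfolding gu unfolding u_def inner_sum_right sum_product by (simp add: mult_ac)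
    have "u x * u x = (\<Sum>l<Nv. \<Sum>k<Nv. \<phi> l x * \<phi> k x * (a l * a k))"
      unfolding u_def sum_product by (simp add: mult_ac)
    hence 3: "c x * u x * u x = (\<Sum>l<Nv. \<Sum>k<Nv. a l * (c x * \<phi> l x * \<phi> k x) * a k)"
      by (simp add: mult.assoc sum_distrib_left) (simp add: mult_ac)
    show "inner (grad u x) (D x *v grad u x) + u x * inner (b x) (grad u x) + c x * u x * u x
        = (\<Sum>l<Nv. \<Sum>k<Nv. a l * density l k x * a k)"
      unfolding 1 2 3 sum.distrib[symmetric]
      by (intro sum.cong refl) (simp add: density_element[OF K] algebra_simps)
  qed
  also have "\<dots> = (LINT x:\<Omega>|lebesgue. inner (grad u x) (D x *v grad u x))
      + (LINT x:\<Omega>|lebesgue. u x * inner (b x) (grad u x)) + (LINT x:\<Omega>|lebesgue. c x * u x * u x)"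
    by (simp add: pw_cont_integrable h1 h2 h3)
  also have "(LINT x:\<Omega>|lebesgue. u x * inner (b x) (grad u x)) = - 1/2 * (LINT x:\<Omega>|lebesgue. divergence b x * u x * u x)"
    unfolding u_def by (rule integration_by_parts[OF b_C1])
  also have "(LINT x:\<Omega>|lebesgue. inner (grad u x) (D x *v grad u x)) + - 1/2 * (LINT x:\<Omega>|lebesgue. divergence b x * u x * u x)
      + (LINT x:\<Omega>|lebesgue. c x * u x * u x)
    = (LINT x:\<Omega>|lebesgue. inner (grad u x) (D x *v grad u x))
      + (LINT x:\<Omega>|lebesgue. c x * u x * u x - 1/2 * (divergence b x * u x * u x))"
    by (simp add: pw_cont_integrable h3 h4)
  also have "\<dots> = L2_real \<Omega> (\<lambda>x. D x *v grad u x) (grad u) + L2_real \<Omega> (\<lambda>x. (c x - 1/2 * divergence b x) * u x) u"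
    by (simp add: L2_real_def inner_commute algebra_simps)
  finally show ?thesis .
qed

lemma rayleigh_eq:
  fixes a :: "nat \<Rightarrow> real"
  shows "rayleigh \<Omega> D b c (\<lambda>x. \<Sum>k<Nv. \<phi> k x *\<^sub>R a k) = quad A a / quad B a"
  unfolding rayleigh_def quad_A_eq_energy quad_B_eq_L2 ..

lemma domain_sets: "\<Omega> \<in> sets lebesgue"
  using open_domain by (simp add: borel_open sets_completionI_sets)

lemma D_nonneg: "x \<in> \<Omega> \<Longrightarrow> 0 \<le> inner \<xi> (D x *v \<xi>)"
  using D_spd[of x] unfolding sym_pos_def_def by (cases "\<xi> = 0") (auto simp: less_imp_le)

lemma quad_B_pos:
  assumes "l < Nv" "a l \<noteq> 0" shows "0 < quad B a"
proof -
  define u where "u x = (\<Sum>k<Nv. \<phi> k x *\<^sub>R a k)" for x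
  have pu: "pw_cont u" unfolding u_def[abs_def] by (rule pw_cont_Vh)
  have "continuous_on \<Omega> u"
    unfolding u_def by (rule continuous_on_subset[OF Vh_continuous closure_subset])
  hence "0 < (LINT x:\<Omega>|lebesgue. u x * u x)"
    using interior_vertex[OF assms(1)] Vh_vertex[OF assms(1), of a] assms(2)
    by (intro set_integral_pos[OF open_domain, where ?x0.0 = "p l"] pw_cont_integrable pw_cont_mult pu
        continuous_on_mult) (auto simp: u_def zero_less_mult_iff)
  thus ?thesis using quad_B_eq_L2[of a] by (simp add: L2_real_def u_def)
qed

lemma B_nonneg: "j < Nv \<Longrightarrow> k < Nv \<Longrightarrow> 0 \<le> B j k"
  unfolding B_def using closure_subset Nv_le_N
  by (intro set_integral_nonneg mult_nonneg_nonneg basis_nonneg) auto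

lemma B_sym: "B j k = B k j"
  unfolding B_def by (simp add: mult.commute)

lemma B_diag: assumes "k < Nv" shows "0 < B k k"
proof -
  have "0 < quad B (\<lambda>l. if l = k then 1 else 0)" using assms by (intro quad_B_pos[of k]) auto
  also have "\<dots> = (\<Sum>l<Nv. if l = k then B k k else 0)"
    unfolding quad_def
  proof (intro sum.cong refl)
    fix l
    have "(\<Sum>i<Nv. (if l = k then 1 else 0) * B l i * (if i = k then 1 else 0)) = (\<Sum>i<Nv. if i = k then (if l = k then B k k else 0) else 0)"
      by (intro sum.cong) auto
    thus "(\<Sum>i<Nv. (if l = k then 1 else 0) * B l i * (if i = k then 1 else 0)) = (if l = k then B k k else 0)"
      using assms by simp
  qed
  finally show ?thesis using assms by simp
qed

text \<open>Some element \<open>K\<close> carries a nonzero gradient, and \<open>D\<close> is positive definite at the points of its interior,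
so the diffusion term is positive; the zero-order term is nonnegative.\<close>

lemma quad_A_pos:
  assumes "l < Nv" "a l \<noteq> 0" shows "0 < quad A a"
proof -
  define u where "u x = (\<Sum>k<Nv. \<phi> k x *\<^sub>R a k)" for x
  have pu: "pw_cont u" and pg: "pw_cont (grad u)"
    unfolding u_def[abs_def] by (rule pw_cont_Vh, rule pw_cont_grad_Vh_real)
  define e where "e x = inner (grad u x) (D x *v grad u x)" for x
  have pe: "pw_cont e" unfolding e_def by (intro pw_cont_inner pw_cont_mat_vec pw_D pg)
  obtain K where K: "K \<in> \<T>" and gK: "(\<Sum>k<Nv. a k *\<^sub>R gradient K k) \<noteq> 0"
    using zero_gradient_imp_zero[OF _ assms(1), of a] assms(2) by blast
  define g where "g = (\<Sum>k<Nv. a k *\<^sub>R gradient K k)"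
  have gu: "grad u x = g" if "x \<in> interior K" for x
    unfolding u_def[abs_def] g_def grad_Vh[OF K that] by (simp add: Finite_Cartesian_Product.vec_eq_iff mult.commute)
  have sub: "interior K \<subseteq> \<Omega>" by (rule element_interior_subset[OF K])
  have iK: "interior K \<in> sets lebesgue" by (simp add: borel_open sets_completionI_sets)
  have int: "set_integrable lebesgue \<Omega> e" "set_integrable lebesgue (interior K) e"
    using pw_cont_integrable[OF pe] set_integrable_subset[OF pw_cont_integrable[OF pe] iK sub] by auto
  obtain x0 where x0: "x0 \<in> interior K" using element_interior_nonempty[OF K] by blast
  have "0 < (LINT x:interior K|lebesgue. e x)"
  proof (rule set_integral_pos[OF open_interior _ _ x0 _ int(2)])
    have "continuous_on (interior K) (\<lambda>x. inner g (D x *v g))"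
      using continuous_on_subset[OF D_continuous order_trans[OF sub closure_subset]]
      by (intro continuous_on_inner continuous_on_const
          bounded_bilinear.continuous_on[OF bounded_bilinear_matrix_vector_mult])
    thus "continuous_on (interior K) e" by (rule continuous_on_eq) (simp add: e_def gu)
    show "0 \<le> e x" if "x \<in> interior K" for x using D_nonneg that sub by (auto simp: e_def)
    show "0 < e x0" using D_spd[of x0] x0 sub gK by (auto simp: e_def gu g_def sym_pos_def_def)
  qed
  also have "\<dots> \<le> (LINT x:\<Omega>|lebesgue. e x)"
    unfolding set_lebesgue_integral_def
    using int D_nonneg sub unfolding set_integrable_def
    by (intro integral_mono) (auto simp: e_def indicator_def)
  finally have "0 < (LINT x:\<Omega>|lebesgue. e x)" .
  moreover have "0 \<le> (LINT x:\<Omega>|lebesgue. (c x - 1/2 * divergence b x) * u x * u x)"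
    using zero_order_nonneg by (intro set_integral_nonneg) (simp add: mult.assoc)
  ultimately show ?thesis using quad_A_eq_energy[of a]
    by (simp add: L2_real_def u_def[abs_def] e_def inner_commute)
qed

lemma A_sym:
  assumes b0: "\<And>x. x \<in> \<Omega> \<Longrightarrow> b x = 0" shows "A j k = A k j"
  unfolding A_def
proof (rule set_lebesgue_integral_cong[OF domain_sets], intro allI impI)
  fix x assume x: "x \<in> \<Omega>"
  have "inner g (D x *v h) = inner h (D x *v g)" for g h
    using D_spd[OF x] dot_lmul_matrix[of g "D x" h] transpose_matrix_vector[of "D x" g]
    unfolding sym_pos_def_def by (metis inner_commute)
  thus "density j k x = density k j x" by (simp add: density_def b0[OF x] mult_ac)
qed

end

section \<open>The discrete eigenvalue problem\<close>

text \<open>With \<open>x\<^sub>i = y\<^sub>i v\<^sub>i\<close> and \<open>y\<^sub>i y\<^sub>j = (y\<^sub>i\<^sup>2 + y\<^sub>j\<^sup>2) / 2 - (y\<^sub>i - y\<^sub>j)\<^sup>2 / 2\<close> the form becomes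
\<open>\<Sum> - M\<^sub>i\<^sub>j v\<^sub>i v\<^sub>j (y\<^sub>i - y\<^sub>j)\<^sup>2 / 2\<close>: the terms with \<open>y\<^sub>i\<^sup>2\<close> and \<open>y\<^sub>j\<^sup>2\<close> cancel since \<open>M v = 0\<close>.\<close>

lemma ground_state_nonneg:
  fixes M :: "nat \<Rightarrow> nat \<Rightarrow> real"
  assumes sym: "\<And>i j. M i j = M j i" and off: "\<And>i j. i < n \<Longrightarrow> j < n \<Longrightarrow> i \<noteq> j \<Longrightarrow> M i j \<le> 0"
    and v: "\<And>i. i < n \<Longrightarrow> 0 < v i" and ker: "\<And>i. i < n \<Longrightarrow> (\<Sum>j<n. M i j * v j) = 0"
  shows "0 \<le> (\<Sum>i<n. \<Sum>j<n. x i * M i j * x j)"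
proof -
  define y where "y i = x i / v i" for i
  have x: "x i = y i * v i" if "i < n" for i using v[OF that] by (simp add: y_def)
  have 1: "(\<Sum>i<n. \<Sum>j<n. (y i)\<^sup>2 * v i * (M i j * v j)) = 0"
    using ker by (simp flip: sum_distrib_left)
  have "(\<Sum>i<n. \<Sum>j<n. (y j)\<^sup>2 * v j * (M j i * v i)) = 0"
    by (subst sum.swap) (rule 1)
  hence 2: "(\<Sum>i<n. \<Sum>j<n. (y j)\<^sup>2 * v j * (M i j * v i)) = 0" by (simp add: sym)
  have "(\<Sum>i<n. \<Sum>j<n. x i * M i j * x j)
      = (\<Sum>i<n. \<Sum>j<n. 1/2 * ((y i)\<^sup>2 * v i * (M i j * v j)) + 1/2 * ((y j)\<^sup>2 * v j * (M i j * v i))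
          + 1/2 * (- M i j * (v i * v j) * (y i - y j)\<^sup>2))"
    by (intro sum.cong refl) (simp add: x power2_eq_square algebra_simps)
  also have "\<dots> = 1/2 * (\<Sum>i<n. \<Sum>j<n. (y i)\<^sup>2 * v i * (M i j * v j))
      + 1/2 * (\<Sum>i<n. \<Sum>j<n. (y j)\<^sup>2 * v j * (M i j * v i))
      + (\<Sum>i<n. \<Sum>j<n. 1/2 * (- M i j * (v i * v j) * (y i - y j)\<^sup>2))"
    by (simp only: sum.distrib sum_distrib_left)
  also have "\<dots> = (\<Sum>i<n. \<Sum>j<n. 1/2 * (- M i j * (v i * v j) * (y i - y j)\<^sup>2))"
    unfolding 1 2 by simp
  also have "0 \<le> \<dots>"
  proof (intro sum_nonneg)
    fix i j assume ij: "i \<in> {..<n}" "j \<in> {..<n}"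
    show "0 \<le> 1/2 * (- M i j * (v i * v j) * (y i - y j)\<^sup>2)"
    proof (cases "i = j")
      case False
      hence "0 \<le> - M i j" using off ij by simp
      moreover have "0 \<le> v i * v j" using v[of i] v[of j] ij by simp
      ultimately show ?thesis by (intro mult_nonneg_nonneg[OF _ mult_nonneg_nonneg] mult_nonneg_nonneg[of "- M i j"]) auto
    qed simp
  qed
  finally show ?thesis .
qed

context p1_fem
begin

lemma Vh_nonzero_iff:
  fixes a :: "nat \<Rightarrow> 'a::real_vector"
  shows "(\<lambda>x. \<Sum>k<Nv. \<phi> k x *\<^sub>R a k) \<noteq> (\<lambda>x. 0) \<longleftrightarrow> (\<exists>k<Nv. a k \<noteq> 0)"
proof
  assume "(\<lambda>x. \<Sum>k<Nv. \<phi> k x *\<^sub>R a k) \<noteq> (\<lambda>x. 0)"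
  thus "\<exists>k<Nv. a k \<noteq> 0" by (rule contrapos_np) (auto intro!: sum.neutral)
next
  assume "\<exists>k<Nv. a k \<noteq> 0"
  then obtain k where k: "k < Nv" "a k \<noteq> 0" by blast
  show "(\<lambda>x. \<Sum>k<Nv. \<phi> k x *\<^sub>R a k) \<noteq> (\<lambda>x. 0)"
  proof
    assume "(\<lambda>x. \<Sum>k<Nv. \<phi> k x *\<^sub>R a k) = (\<lambda>x. 0)"
    from fun_cong[OF this, of "p k"] show False using Vh_vertex[OF k(1), of a] k(2) by simp
  qed
qed

lemma Vh_I: "(\<lambda>x. \<Sum>k<Nv. \<phi> k x *\<^sub>R a k) \<in> Vh \<phi> Nv"
  unfolding Vh_def by blast

lemma Vh_E: assumes "u \<in> Vh \<phi> Nv" obtains a where "u = (\<lambda>x. \<Sum>k<Nv. \<phi> k x *\<^sub>R a k)"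
  using assms unfolding Vh_def by blast

lemma fe_eigenvalue_E:
  assumes "fe_eigenvalue \<Omega> D b c \<phi> Nv l"
  obtains a where "fe_eigenpair \<Omega> D b c \<phi> Nv l (\<lambda>x. \<Sum>k<Nv. \<phi> k x *\<^sub>R a k)"
proof -
  obtain u where u: "fe_eigenpair \<Omega> D b c \<phi> Nv l u" using assms unfolding fe_eigenvalue_def by blast
  hence "u \<in> Vh \<phi> Nv" by (simp add: fe_eigenpair_def)
  then obtain a where "u = (\<lambda>x. \<Sum>k<Nv. \<phi> k x *\<^sub>R a k)" by (rule Vh_E)
  thus thesis using u that by blast
qed

text \<open>Testing with the functions \<open>\<phi> i\<close> gives the rows of the matrix equation, and conversely all
test functions are combinations of these.\<close>

lemma fe_eigenpair_iff:
  "fe_eigenpair \<Omega> D b c \<phi> Nv l (\<lambda>x. \<Sum>k<Nv. \<phi> k x *\<^sub>R a k) \<longleftrightarrow> (\<exists>k<Nv. a k \<noteq> 0) \<and>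
    (\<forall>i<Nv. (\<Sum>j<Nv. of_real (A i j) * a j) = l * (\<Sum>j<Nv. of_real (B i j) * a j))"
proof -
  have "(\<forall>v\<in>Vh \<phi> Nv. weak_form \<Omega> D b c (\<lambda>x. \<Sum>k<Nv. \<phi> k x *\<^sub>R a k) v = l * L2_cscalar \<Omega> (\<lambda>x. \<Sum>k<Nv. \<phi> k x *\<^sub>R a k) v)
    \<longleftrightarrow> (\<forall>w. weak_form \<Omega> D b c (\<lambda>x. \<Sum>k<Nv. \<phi> k x *\<^sub>R a k) (\<lambda>x. \<Sum>k<Nv. \<phi> k x *\<^sub>R w k)
          = l * L2_cscalar \<Omega> (\<lambda>x. \<Sum>k<Nv. \<phi> k x *\<^sub>R a k) (\<lambda>x. \<Sum>k<Nv. \<phi> k x *\<^sub>R w k))"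
    unfolding Vh_def by blast
  also have "\<dots> \<longleftrightarrow> (\<forall>w. (\<Sum>i<Nv. cnj (w i) * (\<Sum>j<Nv. of_real (A i j) * a j))
      = (\<Sum>i<Nv. cnj (w i) * (l * (\<Sum>j<Nv. of_real (B i j) * a j))))"
    unfolding weak_form_eq L2_cscalar_eq sum_distrib_left by (simp add: mult_ac)
  also have "\<dots> \<longleftrightarrow> (\<forall>i<Nv. (\<Sum>j<Nv. of_real (A i j) * a j) = l * (\<Sum>j<Nv. of_real (B i j) * a j))"
  proof (intro iffI allI impI)
    fix i assume all: "\<forall>w. (\<Sum>i<Nv. cnj (w i) * (\<Sum>j<Nv. of_real (A i j) * a j))
      = (\<Sum>i<Nv. cnj (w i) * (l * (\<Sum>j<Nv. of_real (B i j) * a j)))" and i: "i < Nv"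
    have delta: "(\<Sum>m<Nv. cnj (if m = i then 1 else 0) * s m) = s i" for s :: "nat \<Rightarrow> complex"
    proof -
      have "(\<Sum>m<Nv. cnj (if m = i then 1 else 0) * s m) = (\<Sum>m<Nv. if m = i then s m else 0)"
        by (intro sum.cong) auto
      thus ?thesis using i by simp
    qed
    show "(\<Sum>j<Nv. of_real (A i j) * a j) = l * (\<Sum>j<Nv. of_real (B i j) * a j)"
      using spec[OF all, of "\<lambda>m. if m = i then 1 else 0"] unfolding delta .
  qed (auto intro: sum.cong)
  finally show ?thesis
    unfolding fe_eigenpair_def Vh_nonzero_iff using Vh_I[of a] by blast
qed

lemma generalized_eigenvector_iff:
  "generalized_eigenvector (stiffness_mat \<T> D b c \<phi> Nv) (mass_mat \<T> \<phi> Nv) l a \<longleftrightarrow> (\<exists>k<Nv. a k \<noteq> 0) \<and>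
    (\<forall>i<Nv. (\<Sum>j<Nv. of_real (A i j) * a j) = l * (\<Sum>j<Nv. of_real (B i j) * a j))"
proof -
  have dim: "dim_row (stiffness_mat \<T> D b c \<phi> Nv) = Nv" "dim_col (stiffness_mat \<T> D b c \<phi> Nv) = Nv"
    "dim_row (mass_mat \<T> \<phi> Nv) = Nv" "dim_col (mass_mat \<T> \<phi> Nv) = Nv"
    by (simp_all add: stiffness_mat_def mass_mat_def)
  define w where "w = Matrix.vec Nv a"
  have w0: "w \<noteq> 0\<^sub>v Nv \<longleftrightarrow> (\<exists>k<Nv. a k \<noteq> 0)"
    by (auto simp: w_def Matrix.vec_eq_iff)
  have "vec_index (map_mat complex_of_real (stiffness_mat \<T> D b c \<phi> Nv) *\<^sub>v w) i = (\<Sum>j<Nv. of_real (A i j) * a j)"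
    "vec_index (map_mat complex_of_real (mass_mat \<T> \<phi> Nv) *\<^sub>v w) i = (\<Sum>j<Nv. of_real (B i j) * a j)"
    if "i < Nv" for i
    using that by (auto simp: dim scalar_prod_def w_def atLeast0LessThan stiffness_mat_entry mass_mat_entry intro!: sum.cong)
  hence "map_mat complex_of_real (stiffness_mat \<T> D b c \<phi> Nv) *\<^sub>v w = l \<cdot>\<^sub>v (map_mat complex_of_real (mass_mat \<T> \<phi> Nv) *\<^sub>v w)
    \<longleftrightarrow> (\<forall>i<Nv. (\<Sum>j<Nv. of_real (A i j) * a j) = l * (\<Sum>j<Nv. of_real (B i j) * a j))"
    by (simp add: Matrix.vec_eq_iff dim)
  thus ?thesis unfolding generalized_eigenvector_def Let_def dim w_def[symmetric] w0 by simp
qed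

lemma Re_hermitian_form:
  "Re (\<Sum>i<Nv. \<Sum>j<Nv. cnj (a i) * of_real (M i j) * a j) = quad M (\<lambda>i. Re (a i)) + quad M (\<lambda>i. Im (a i))"
  unfolding quad_def Re_sum sum.distrib[symmetric] by (intro sum.cong refl) (simp add: algebra_simps)

lemma Im_hermitian_form:
  assumes "\<And>i j. M i j = M j i"
  shows "Im (\<Sum>i<Nv. \<Sum>j<Nv. cnj (a i) * of_real (M i j) * a j) = 0"
proof -
  have "Im (\<Sum>i<Nv. \<Sum>j<Nv. cnj (a i) * of_real (M i j) * a j)
      = (\<Sum>i<Nv. \<Sum>j<Nv. Re (a i) * M i j * Im (a j)) - (\<Sum>i<Nv. \<Sum>j<Nv. Im (a i) * M i j * Re (a j))"
    unfolding Im_sum sum_subtractf[symmetric] by (intro sum.cong refl) (simp add: algebra_simps)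
  also have "(\<Sum>i<Nv. \<Sum>j<Nv. Im (a i) * M i j * Re (a j)) = (\<Sum>i<Nv. \<Sum>j<Nv. Re (a i) * M i j * Im (a j))"
    by (subst sum.swap) (simp add: assms[of _ i for i] mult_ac)
  finally show ?thesis by simp
qed

lemma quad_zero: "quad M a = 0" if "\<And>k. k < Nv \<Longrightarrow> a k = 0"
  using that by (simp add: quad_def)

text \<open>Testing with the eigenfunction itself gives \<open>w\<^sup>* A w = l (w\<^sup>* B w)\<close>.  The factor \<open>w\<^sup>* B w\<close> is real because
\<open>B\<close> is symmetric, and the real parts of both forms split into the real quadratic forms of the
real and imaginary parts of \<open>w\<close>.\<close>

lemma eigenvalue_Re_pos:
  assumes "fe_eigenvalue \<Omega> D b c \<phi> Nv l" shows "0 < Re l"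
proof -
  obtain a where "fe_eigenpair \<Omega> D b c \<phi> Nv l (\<lambda>x. \<Sum>k<Nv. \<phi> k x *\<^sub>R a k)"
    using assms by (rule fe_eigenvalue_E)
  then obtain k where k: "k < Nv" "a k \<noteq> 0"
    and e: "\<And>i. i < Nv \<Longrightarrow> (\<Sum>j<Nv. of_real (A i j) * a j) = l * (\<Sum>j<Nv. of_real (B i j) * a j)"
    unfolding fe_eigenpair_iff by blast
  have nn: "0 \<le> quad A x" "0 \<le> quad B x" for x
    using quad_A_pos[of _ x] quad_B_pos[of _ x] quad_zero[of x A] quad_zero[of x B] by force+
  have pos: "0 < quad A (\<lambda>i. Re (a i)) + quad A (\<lambda>i. Im (a i))"
    "0 < quad B (\<lambda>i. Re (a i)) + quad B (\<lambda>i. Im (a i))"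
  proof -
    have "Re (a k) \<noteq> 0 \<or> Im (a k) \<noteq> 0" using k(2) by (auto simp: complex_eq_iff)
    thus "0 < quad A (\<lambda>i. Re (a i)) + quad A (\<lambda>i. Im (a i))"
      "0 < quad B (\<lambda>i. Re (a i)) + quad B (\<lambda>i. Im (a i))"
      using nn k(1) quad_A_pos[of k] quad_B_pos[of k] by (auto simp: add_pos_nonneg add_nonneg_pos)
  qed
  have "(\<Sum>i<Nv. \<Sum>j<Nv. cnj (a i) * of_real (A i j) * a j) = (\<Sum>i<Nv. cnj (a i) * (\<Sum>j<Nv. of_real (A i j) * a j))"
    by (simp add: sum_distrib_left mult.assoc)
  also have "\<dots> = (\<Sum>i<Nv. cnj (a i) * (l * (\<Sum>j<Nv. of_real (B i j) * a j)))"
    using e by (intro sum.cong) auto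
  also have "\<dots> = l * (\<Sum>i<Nv. \<Sum>j<Nv. cnj (a i) * of_real (B i j) * a j)"
    by (simp add: sum_distrib_left mult_ac)
  finally have "Re (\<Sum>i<Nv. \<Sum>j<Nv. cnj (a i) * of_real (A i j) * a j)
    = Re (l * (\<Sum>i<Nv. \<Sum>j<Nv. cnj (a i) * of_real (B i j) * a j))" by simp
  also have "\<dots> = Re l * Re (\<Sum>i<Nv. \<Sum>j<Nv. cnj (a i) * of_real (B i j) * a j)"
    using Im_hermitian_form[OF B_sym] by simp
  finally show ?thesis unfolding Re_hermitian_form using pos by (metis zero_less_mult_pos2)
qed

end

theorem theorem3p1:
  fixes \<Omega> :: "(real ^ 'd::finite) set"
    and D :: "real ^ 'd \<Rightarrow> real ^ 'd ^ 'd"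
    and b :: "real ^ 'd \<Rightarrow> real ^ 'd"
    and c :: "real ^ 'd \<Rightarrow> real"
    and \<T> :: "(real ^ 'd) set set"
    and p :: "nat \<Rightarrow> real ^ 'd"
    and \<phi> :: "nat \<Rightarrow> real ^ 'd \<Rightarrow> real"
    and N Nv :: nat
  assumes "polyhedral_domain \<Omega>"
    and "continuous_on (closure \<Omega>) D" and "C1_closure \<Omega> b" and "continuous_on (closure \<Omega>) c"
    and "\<forall>x\<in>\<Omega>. sym_pos_def (D x)"
    and "\<forall>x\<in>\<Omega>. 0 \<le> c x - 1/2 * divergence b x"
    and "simplicial_mesh \<Omega> \<T>"
    and "vertex_numbering \<Omega> \<T> N Nv p" and "1 \<le> Nv"
    and "P1_nodal_basis \<T> N p \<phi>"
    and "M_matrix (stiffness_mat \<T> D b c \<phi> Nv)"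
    and "irreducible_mat (stiffness_mat \<T> D b c \<phi> Nv)"
  shows
    "(\<comment> \<open>equivalence of the variational and the matrix eigenvalue problem\<close>
      \<forall>l a. fe_eigenpair \<Omega> D b c \<phi> Nv l (\<lambda>x. \<Sum>k<Nv. \<phi> k x *\<^sub>R a k) \<longleftrightarrow>
        generalized_eigenvector (stiffness_mat \<T> D b c \<phi> Nv) (mass_mat \<T> \<phi> Nv) l a) \<and>
     (\<exists>(l1::real) (u1::real ^ 'd \<Rightarrow> real).
      \<comment> \<open>(a)\<close>
      (\<forall>l. principal_eigenvalue \<Omega> D b c \<phi> Nv l \<longleftrightarrow> l = complex_of_real l1) \<and>
      \<comment> \<open>(b)\<close>
      u1 \<in> Vh \<phi> Nv \<and>
      fe_eigenpair \<Omega> D b c \<phi> Nv (complex_of_real l1) (\<lambda>x. complex_of_real (u1 x)) \<and>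
      (\<forall>x \<in> \<Omega> - boundary_simplices \<Omega> \<T>. 0 < u1 x) \<and>
      \<comment> \<open>(c)\<close>
      alg_multiplicity (stiffness_mat \<T> D b c \<phi> Nv) (mass_mat \<T> \<phi> Nv) (complex_of_real l1) = 1 \<and>
      (\<forall>u. fe_eigenpair \<Omega> D b c \<phi> Nv (complex_of_real l1) u \<longrightarrow>
        (\<exists>\<alpha>. u = (\<lambda>x. \<alpha> * complex_of_real (u1 x)))) \<and>
      \<comment> \<open>(d)\<close>
      l1 = rayleigh \<Omega> D b c u1 \<and> 0 < l1 \<and>
      \<comment> \<open>(e)\<close>
      (\<forall>l. fe_eigenvalue \<Omega> D b c \<phi> Nv l \<longrightarrow> 0 < Re l \<and> l1 \<le> cmod l) \<and>
      \<comment> \<open>(f)\<close>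
      ((\<forall>x\<in>\<Omega>. b x = 0) \<longrightarrow>
        (\<exists>v \<in> Vh \<phi> Nv. v \<noteq> (\<lambda>x. 0) \<and> l1 = rayleigh \<Omega> D b c v) \<and>
        (\<forall>v \<in> Vh \<phi> Nv. v \<noteq> (\<lambda>x. 0) \<longrightarrow> l1 \<le> rayleigh \<Omega> D b c v)))"
proof -
  interpret p1_fem \<Omega> \<T> p \<phi> N Nv D b c
    using assms by unfold_locales blast+
  define S where "S = stiffness_mat \<T> D b c \<phi> Nv"
  have S: "dim_row S = Nv" "\<And>i j. i < Nv \<Longrightarrow> j < Nv \<Longrightarrow> S $$ (i, j) = A i j"
    "S \<in> carrier_mat Nv Nv"
    by (auto simp: S_def stiffness_mat_entry) (auto simp: stiffness_mat_def)
  have "M_matrix S" using assms(11) by (simp add: S_def)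
  then obtain A'm where A'm: "A'm \<in> carrier_mat Nv Nv" "inverts_mat S A'm" "inverts_mat A'm S"
      "\<forall>i<Nv. \<forall>j<Nv. 0 \<le> A'm $$ (i, j)"
    and off: "\<forall>i<Nv. \<forall>j<Nv. i \<noteq> j \<longrightarrow> S $$ (i, j) \<le> 0"
    unfolding M_matrix_def S(1) by blast
  interpret m_matrix_pencil Nv A "\<lambda>i j. A'm $$ (i, j)" B
  proof
    fix i j assume ij: "i < Nv" "j < Nv"
    have "(S * A'm) $$ (i, j) = (\<Sum>k<Nv. A i k * A'm $$ (k, j))"
      using ij S A'm(1) by (auto simp: scalar_prod_def atLeast0LessThan intro!: sum.cong)
    moreover have "S * A'm = 1\<^sub>m Nv" using A'm(2) S(1) by (simp add: inverts_mat_def)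
    ultimately show "(\<Sum>k<Nv. A i k * A'm $$ (k, j)) = (if i = j then 1 else 0)" using ij by simp
    have "(A'm * S) $$ (i, j) = (\<Sum>k<Nv. A'm $$ (i, k) * A k j)"
      using ij S A'm(1) by (auto simp: scalar_prod_def atLeast0LessThan intro!: sum.cong)
    moreover have "A'm * S = 1\<^sub>m Nv" using A'm(1,3) by (simp add: inverts_mat_def)
    ultimately show "(\<Sum>k<Nv. A'm $$ (i, k) * A k j) = (if i = j then 1 else 0)" using ij by simp
    show "0 \<le> A'm $$ (i, j)" using A'm(4) ij by blast
    show "0 \<le> B i j" using ij by (rule B_nonneg)
    show "A i j \<le> 0" if "i \<noteq> j" using off ij that S(2) by force
  next
    fix I :: "nat set" assume I: "I \<noteq> {}" "I \<subset> {..<Nv}"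
    have "irreducible_mat S" using assms(12) by (simp add: S_def)
    then obtain i j where ij: "i \<in> I" "j \<in> {..<Nv} - I" "S $$ (i, j) \<noteq> 0"
      using I unfolding irreducible_mat_def S(1) by blast
    moreover have "S $$ (i, j) = A i j" using ij I by (intro S(2)) auto
    ultimately show "\<exists>i\<in>I. \<exists>j\<in>{..<Nv} - I. A i j \<noteq> 0" by auto
  qed (use assms(9) B_diag in auto)
  obtain l1 v where l1: "0 < l1" and v: "\<And>i. i < Nv \<Longrightarrow> 0 < v i"
    and Av: "\<And>i. i < Nv \<Longrightarrow> (\<Sum>j<Nv. A i j * v j) = l1 * (\<Sum>j<Nv. B i j * v j)"
    and bound: "\<And>l z k. (\<And>i. i < Nv \<Longrightarrow> (\<Sum>j<Nv. of_real (A i j) * z j) = l * (\<Sum>j<Nv. of_real (B i j) * z j))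
       \<Longrightarrow> k < Nv \<Longrightarrow> z k \<noteq> 0 \<Longrightarrow> l1 \<le> cmod l \<and> (cmod l = l1 \<longrightarrow> l = of_real l1)"
    and simple: "\<And>z. (\<And>i. i < Nv \<Longrightarrow> (\<Sum>j<Nv. of_real (A i j) * z j) = of_real l1 * (\<Sum>j<Nv. of_real (B i j) * z j))
       \<Longrightarrow> \<exists>\<alpha>. \<forall>i<Nv. z i = \<alpha> * complex_of_real (v i)"
    and order: "Polynomial.order (complex_of_real l1) (Determinant.det (Matrix.mat Nv Nv
        (\<lambda>(i, j). [:- complex_of_real (A i j), complex_of_real (B i j):]))) = 1"
    using principal_pencil_eigenvalue by blast
  define u1 where "u1 x = (\<Sum>k<Nv. \<phi> k x *\<^sub>R v k)" for x
  have u1c: "(\<lambda>x. complex_of_real (u1 x)) = (\<lambda>x. \<Sum>k<Nv. \<phi> k x *\<^sub>R complex_of_real (v k))"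
    by (simp add: u1_def scaleR_conv_of_real)
  have 0: "0 < Nv" using assms(9) by simp
  have u1_Vh: "u1 \<in> Vh \<phi> Nv" unfolding u1_def[abs_def] by (rule Vh_I)
  have u1_nz: "u1 \<noteq> (\<lambda>x. 0)" unfolding u1_def[abs_def] Vh_nonzero_iff using v[OF 0] 0 by force
  have eig1: "fe_eigenpair \<Omega> D b c \<phi> Nv (complex_of_real l1) (\<lambda>x. complex_of_real (u1 x))"
    unfolding u1c fe_eigenpair_iff
    using v[OF 0] 0 Av by (auto simp flip: of_real_mult of_real_sum intro!: exI[of _ 0])
  have ev: "l1 \<le> cmod l \<and> (cmod l = l1 \<longrightarrow> l = of_real l1)" if l: "fe_eigenvalue \<Omega> D b c \<phi> Nv l" for l
  proof -
    obtain a where "fe_eigenpair \<Omega> D b c \<phi> Nv l (\<lambda>x. \<Sum>k<Nv. \<phi> k x *\<^sub>R a k)"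
      using l by (rule fe_eigenvalue_E)
    thus ?thesis unfolding fe_eigenpair_iff using bound[of a l] by blast
  qed
  have ev1: "fe_eigenvalue \<Omega> D b c \<phi> Nv (complex_of_real l1)"
    unfolding fe_eigenvalue_def using eig1 by blast
  have principal: "principal_eigenvalue \<Omega> D b c \<phi> Nv l \<longleftrightarrow> l = complex_of_real l1" for l
  proof
    assume "principal_eigenvalue \<Omega> D b c \<phi> Nv l"
    hence l: "fe_eigenvalue \<Omega> D b c \<phi> Nv l" "cmod l \<le> cmod (complex_of_real l1)"
      using ev1 unfolding principal_eigenvalue_def by blast+
    hence "cmod l \<le> l1" using l1 by simp
    hence "cmod l = l1" using ev[OF l(1)] by (intro order_antisym) auto
    thus "l = complex_of_real l1" using ev[OF l(1)] by blast
  next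
    assume l: "l = complex_of_real l1"
    have "l1 \<le> cmod \<mu>" if "fe_eigenvalue \<Omega> D b c \<phi> Nv \<mu>" for \<mu> using ev[OF that] by blast
    moreover have "cmod l = l1" using l l1 by simp
    ultimately show "principal_eigenvalue \<Omega> D b c \<phi> Nv l"
      using ev1 unfolding principal_eigenvalue_def l by metis
  qed
  have pos: "0 < u1 x" if x: "x \<in> \<Omega> - boundary_simplices \<Omega> \<T>" for x
  proof -
    obtain k where k: "k < Nv" "0 < \<phi> k x" using basis_pos_off_boundary_simplices[OF x] by blast
    have "0 \<le> \<phi> i x" if "i < Nv" for i
      using that Nv_le_N x closure_subset[of \<Omega>] by (intro basis_nonneg) auto
    hence "0 < (\<Sum>k<Nv. \<phi> k x * v k)"
      using k v by (intro sum_pos2[of _ k]) (auto intro!: mult_nonneg_nonneg simp: less_imp_le)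
    thus ?thesis by (simp add: u1_def)
  qed
  have mult: "alg_multiplicity S (mass_mat \<T> \<phi> Nv) (complex_of_real l1) = 1"
  proof -
    have "Matrix.mat Nv Nv (\<lambda>(j, k). [:- complex_of_real (S $$ (j, k)), complex_of_real (mass_mat \<T> \<phi> Nv $$ (j, k)):])
       = Matrix.mat Nv Nv (\<lambda>(i, j). [:- complex_of_real (A i j), complex_of_real (B i j):])"
      by (rule eq_matI) (auto simp: S(2) mass_mat_entry)
    thus ?thesis unfolding alg_multiplicity_def S(1) using order by simp
  qed
  have geom: "\<exists>\<alpha>. u = (\<lambda>x. \<alpha> * complex_of_real (u1 x))"
    if u: "fe_eigenpair \<Omega> D b c \<phi> Nv (complex_of_real l1) u" for u
  proof -
    obtain a where a: "u = (\<lambda>x. \<Sum>k<Nv. \<phi> k x *\<^sub>R a k)"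
      using u unfolding fe_eigenpair_def by (blast elim: Vh_E)
    obtain \<alpha> where \<alpha>: "\<forall>i<Nv. a i = \<alpha> * complex_of_real (v i)"
      using u simple[of a] unfolding a fe_eigenpair_iff by blast
    have "u = (\<lambda>x. \<alpha> * complex_of_real (u1 x))"
      unfolding a u1_def by (rule ext) (simp add: \<alpha> sum_distrib_left scaleR_conv_of_real mult_ac)
    thus ?thesis by blast
  qed
  have quad_v: "quad A v = l1 * quad B v"
  proof -
    have "quad A v = (\<Sum>i<Nv. v i * (\<Sum>j<Nv. A i j * v j))"
      by (simp add: quad_def sum_distrib_left mult.assoc)
    also have "\<dots> = (\<Sum>i<Nv. v i * (l1 * (\<Sum>j<Nv. B i j * v j)))"
      by (intro sum.cong refl) (simp add: Av)
    also have "\<dots> = l1 * quad B v"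
      by (simp add: quad_def sum_distrib_left mult_ac)
    finally show ?thesis .
  qed
  have ray: "l1 = rayleigh \<Omega> D b c u1"
  proof -
    have "0 < quad B v" using quad_B_pos[OF 0, of v] v[OF 0] by simp
    thus ?thesis unfolding u1_def[abs_def] rayleigh_eq quad_v by simp
  qed
  have min: "l1 \<le> rayleigh \<Omega> D b c w"
    if b0: "\<forall>x\<in>\<Omega>. b x = 0" and w: "w \<in> Vh \<phi> Nv" "w \<noteq> (\<lambda>x. 0)" for w
  proof -
    obtain a where a: "w = (\<lambda>x. \<Sum>k<Nv. \<phi> k x *\<^sub>R a k)" using w(1) by (rule Vh_E)
    obtain k where k: "k < Nv" "a k \<noteq> 0" using w(2) unfolding a Vh_nonzero_iff by blast
    have B: "0 < quad B a" using k by (rule quad_B_pos)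
    \<comment> \<open>The matrix \<open>A - l1 B\<close> inherits nonpositive off-diagonal entries from \<open>A\<close> and \<open>- B\<close>.\<close>
    have "0 \<le> (\<Sum>i<Nv. \<Sum>j<Nv. a i * (A i j - l1 * B i j) * a j)"
    proof (rule ground_state_nonneg[where v = v])
      show "A i j - l1 * B i j = A j i - l1 * B j i" for i j
        using A_sym[of i j] B_sym[of i j] b0 by simp
      show "A i j - l1 * B i j \<le> 0" if "i < Nv" "j < Nv" "i \<noteq> j" for i j
        using off_diagonal[OF that] mult_nonneg_nonneg[OF less_imp_le[OF l1] B_nonneg[OF that(1,2)]] by simp
      show "(\<Sum>j<Nv. (A i j - l1 * B i j) * v j) = 0" if "i < Nv" for i
        using Av[OF that] by (simp add: left_diff_distrib sum_subtractf sum_distrib_left mult.assoc)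
    qed (rule v)
    also have "\<dots> = quad A a - l1 * quad B a"
      unfolding quad_def sum_distrib_left sum_subtractf[symmetric]
      by (intro sum.cong refl) (simp add: algebra_simps)
    finally show ?thesis unfolding a rayleigh_eq using B by (simp add: field_simps)
  qed
  have equiv: "\<forall>l a. fe_eigenpair \<Omega> D b c \<phi> Nv l (\<lambda>x. \<Sum>k<Nv. \<phi> k x *\<^sub>R a k) \<longleftrightarrow>
        generalized_eigenvector (stiffness_mat \<T> D b c \<phi> Nv) (mass_mat \<T> \<phi> Nv) l a"
    unfolding fe_eigenpair_iff generalized_eigenvector_iff by (intro allI) (rule refl)
  show ?thesis
    using equiv principal u1_Vh u1_nz eig1 pos mult[unfolded S_def] geom ray l1 eigenvalue_Re_pos ev min
    by (intro conjI exI[of _ l1] exI[of _ u1]) blast+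
qed

end
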